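(* Let $d\ge 2$, let $\mathbb{K}$ be an infinite field, and let $f\in\operatorname{Hom}(\mathbb{K}^{n_1}\times\cdots\times\mathbb{K}^{n_d},\mathbb{K})$ be multilinear. Then \[ \operatorname{AR}_{\mathbb{K}}(f)\le\operatorname{PR}_{\mathbb{K}}(f)\le(2^{d-1}-1)\operatorname{AR}_{\mathbb{K}}(f). \]
   Context: Partition rank: a nonzero multilinear $f$ has $\operatorname{PR}_{\mathbb{K}}(f)=1$ if there is a nonempty proper subset $A\subsetneq[d]$ and multilinear functions $g$ in the arguments $(x_i)_{i\in A}$ and $h$ in the arguments $(x_i)_{i\notin A}$ (over $\mathbb{K}$) with $f=gh$; in general $\operatorname{PR}_{\mathbb{K}}(f)$ is the least $r\ge0$ such that $f$ is a sum of $r$ multilinear functions of partition rank $1$. For an infinite field $\mathbb{K}$ and $S\subseteq\mathbb{K}^n$, $\overline{S}\subseteq\overline{\mathbb{K}}^n$ is the set of common zeros in $\overline{\mathbb{K}}^n$ of all polynomials in $\mathbb{K}[x_1,\dots,x_n]$ vanishing on $S$. The analytic rank is $\operatorname{AR}_{\mathbb{K}}(f)\coloneqq\operatorname{codim}\overline{Z_{F_f}(\mathbb{K})}$, where $Z_{F_f}(\mathbb{K})=\{(\mathsf{v}_1,\dots,\mathsf{v}_{d-1})\in\mathbb{K}^{n_1}\times\cdots\times\mathbb{K}^{n_{d-1}}: f(\mathsf{v}_1,\dots,\mathsf{v}_{d-1},\mathsf{w})=0\ \forall \mathsf{w}\in\mathbb{K}^{n_d}\}$ and codimension is in $\overline{\mathbb{K}}^{n_1+\cdots+n_{d-1}}$.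 *)

theory Defs
  imports "HOL-Algebra.Algebraic_Closure_Type" "HOL-Library.Poly_Mapping"
begin

text \<open>A function on K^{n_0} x ... x K^{n_{d-1}} is represented as a function
  f :: (nat => nat => 'k) => 'k, where x i j is the j-th coordinate of the i-th vector.
  multilinear_on A n g: g depends only on the arguments indexed by A (and only on
  their coordinates j < n i), and is linear in each argument i in A.\<close>

definition multilinear_on :: "nat set \<Rightarrow> (nat \<Rightarrow> nat) \<Rightarrow> ((nat \<Rightarrow> nat \<Rightarrow> 'k::field) \<Rightarrow> 'k) \<Rightarrow> bool" where
  "multilinear_on A n g \<longleftrightarrow>
     (\<forall>x y. (\<forall>i\<in>A. \<forall>j<n i. x i j = y i j) \<longrightarrow> g x = g y) \<and>
     (\<forall>i\<in>A. \<forall>x u w a b. g (x(i := (\<lambda>j. a * u j + b * w j))) = a * g (x(i := u)) + b * g (x(i := w)))"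

abbreviation multilinear :: "nat \<Rightarrow> (nat \<Rightarrow> nat) \<Rightarrow> ((nat \<Rightarrow> nat \<Rightarrow> 'k::field) \<Rightarrow> 'k) \<Rightarrow> bool" where
  "multilinear d n f \<equiv> multilinear_on {..<d} n f"

definition pr_one :: "nat \<Rightarrow> (nat \<Rightarrow> nat) \<Rightarrow> ((nat \<Rightarrow> nat \<Rightarrow> 'k::field) \<Rightarrow> 'k) \<Rightarrow> bool" where
  "pr_one d n f \<longleftrightarrow> f \<noteq> (\<lambda>x. 0) \<and>
     (\<exists>A g h. A \<noteq> {} \<and> A \<subset> {..<d} \<and> multilinear_on A n g \<and>
        multilinear_on ({..<d} - A) n h \<and> f = (\<lambda>x. g x * h x))"

definition partition_rank :: "nat \<Rightarrow> (nat \<Rightarrow> nat) \<Rightarrow> ((nat \<Rightarrow> nat \<Rightarrow> 'k::field) \<Rightarrow> 'k) \<Rightarrow> nat" where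
  "partition_rank d n f = (LEAST r. \<exists>gs. length gs = r \<and> (\<forall>g\<in>set gs. pr_one d n g) \<and>
                                      f = (\<lambda>x. \<Sum>g\<leftarrow>gs. g x))"

text \<open>Multivariate polynomials with variables of type 'v and coefficients in 'a,
  as finitely supported maps from monomials (finitely supported exponent maps) to coefficients.\<close>


definition poly_vars_in :: "'v set \<Rightarrow> (('v \<Rightarrow>\<^sub>0 nat) \<Rightarrow>\<^sub>0 'a::zero) \<Rightarrow> bool" where
  "poly_vars_in I p \<longleftrightarrow> (\<forall>m\<in>Poly_Mapping.keys p. Poly_Mapping.keys m \<subseteq> I)"

definition peval :: "('a::zero \<Rightarrow> 'b::comm_semiring_1) \<Rightarrow> (('v \<Rightarrow>\<^sub>0 nat) \<Rightarrow>\<^sub>0 'a) \<Rightarrow> ('v \<Rightarrow> 'b) \<Rightarrow> 'b" where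
  "peval \<phi> p y = (\<Sum>m\<in>Poly_Mapping.keys p. \<phi> (Poly_Mapping.lookup p m) * (\<Prod>v\<in>Poly_Mapping.keys m. y v ^ Poly_Mapping.lookup m v))"

definition aff :: "'v set \<Rightarrow> ('v \<Rightarrow> 'b::zero) set" where
  "aff I = {y. \<forall>v. v \<notin> I \<longrightarrow> y v = 0}"

definition zariski_closure_K :: "'v set \<Rightarrow> ('v \<Rightarrow> 'k::field) set \<Rightarrow> ('v \<Rightarrow> 'k alg_closure) set" where
  "zariski_closure_K I S = {y \<in> aff I. \<forall>p. poly_vars_in I p \<longrightarrow>
       (\<forall>s\<in>S. peval id p s = 0) \<longrightarrow> peval to_ac p y = 0}"

definition zariski_closed :: "'v set \<Rightarrow> ('v \<Rightarrow> 'L::field) set \<Rightarrow> bool" where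
  "zariski_closed I W \<longleftrightarrow> (\<exists>Ps. (\<forall>p\<in>Ps. poly_vars_in I p) \<and>
       W = {y \<in> aff I. \<forall>p\<in>Ps. peval id p y = 0})"

definition zariski_irreducible :: "'v set \<Rightarrow> ('v \<Rightarrow> 'L::field) set \<Rightarrow> bool" where
  "zariski_irreducible I W \<longleftrightarrow> zariski_closed I W \<and> W \<noteq> {} \<and>
     (\<forall>Y Z. zariski_closed I Y \<longrightarrow> zariski_closed I Z \<longrightarrow> W = Y \<union> Z \<longrightarrow> W = Y \<or> W = Z)"

definition zariski_dim :: "'v set \<Rightarrow> ('v \<Rightarrow> 'L::field) set \<Rightarrow> nat" where
  "zariski_dim I W = Sup {m. \<exists>C. (\<forall>i\<le>m. zariski_irreducible I (C i) \<and> C i \<subseteq> W) \<and>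
                                (\<forall>i<m. C i \<subset> C (Suc i))}"

definition zariski_codim :: "'v set \<Rightarrow> ('v \<Rightarrow> 'L::field) set \<Rightarrow> nat" where
  "zariski_codim I W = card I - zariski_dim I W"

text \<open>Coordinates of (v_0,...,v_{d-2}) are indexed by pairs (i,j) with i < d-1, j < n i.\<close>
definition ar_index :: "nat \<Rightarrow> (nat \<Rightarrow> nat) \<Rightarrow> (nat \<times> nat) set" where
  "ar_index d n = Sigma {..<d-1} (\<lambda>i. {..<n i})"

definition Z_F :: "nat \<Rightarrow> (nat \<Rightarrow> nat) \<Rightarrow> ((nat \<Rightarrow> nat \<Rightarrow> 'k::field) \<Rightarrow> 'k) \<Rightarrow> (nat \<times> nat \<Rightarrow> 'k) set" where
  "Z_F d n f = {v \<in> aff (ar_index d n).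
      \<forall>w. f (\<lambda>i j. if i = d - 1 then w j else v (i, j)) = 0}"

definition analytic_rank :: "nat \<Rightarrow> (nat \<Rightarrow> nat) \<Rightarrow> ((nat \<Rightarrow> nat \<Rightarrow> 'k::field) \<Rightarrow> 'k) \<Rightarrow> nat" where
  "analytic_rank d n f =
     zariski_codim (ar_index d n) (zariski_closure_K (ar_index d n) (Z_F d n f))"

end

theory Submission
  imports Defs "HOL-Library.Product_Lexorder"
begin

text \<open>
  Write \<^term>\<open>f\<close> as a vector of multilinear equations in the first \<open>d - 1\<close> arguments.

  Lower bound: one factor of each summand of a partition rank decomposition only involves the first
  \<open>d - 1\<close> arguments. Solving these \<open>r\<close> multilinear equations one argument at a time, each time a
  linear system, parametrizes rationally a part of the zero set in which all but \<open>r\<close> coordinates are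
  free. Freeing these coordinates one after another yields a long chain of irreducible sets.

  Upper bound: a chain of irreducible sets of length \<open>m\<close> provides, by comparing Hilbert functions,
  \<open>m\<close> coordinates that satisfy no polynomial relation on the zero set, hence a generic point of it
  over an ultrapower \<open>L\<close> of the base field. The field generated by its coordinates has
  derivations dual to all but \<open>r\<close> of the coordinates, \<open>r\<close> being the analytic rank. Applying \<open>d - 1\<close> of
  them to the equations at the generic point and expanding with the Leibniz rule expresses
  every coefficient of \<^term>\<open>f\<close> through products, one for each nonempty set of arguments and each of the \<open>r\<close>
  exceptional coordinates. This decomposition over \<open>L\<close> descends to the base field since it is
  given by finitely many polynomial equations.
\<close>

section \<open>Polynomial functions\<close>

text \<open>The constant 2^(d-1) - 1 counts the nonempty subsets of the first d-1 arguments. After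
  differentiating, every unwanted term has a first factor that misbehaves; it is filed under the set
  of derivations hitting that factor and the coordinate the factor belongs to. Coordinates dual to
  the derivations never misbehave, since their derivatives are exactly 0 or 1, so only codimension
  many coordinates occur.

  Two features of K shape the argument. It need not be algebraically closed, yet the factors must be
  defined over K; so the generic point is approximated by K-points of the zero set, inside an
  ultrapower. It need not be perfect either: the function field may be inseparable over the free
  coordinates, and derivations dual to these need not exist. They are exchanged for other
  coordinates, and only their number is controlled.

  Dimension is measured by chains over the algebraic closure, whereas freeness of coordinates
  concerns polynomials over K. The two meet in monomials: linear relations over K between monomials
  on the K-points persist on the closure.\<close>

definition mon :: "('v \<Rightarrow>\<^sub>0 nat) \<Rightarrow> ('v \<Rightarrow> 'b::comm_semiring_1) \<Rightarrow> 'b" where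
  "mon a y = (\<Prod>v\<in>Poly_Mapping.keys a. y v ^ Poly_Mapping.lookup a v)"

definition mdeg :: "('v \<Rightarrow>\<^sub>0 nat) \<Rightarrow> nat" where
  "mdeg a = (\<Sum>v\<in>Poly_Mapping.keys a. Poly_Mapping.lookup a v)"

text \<open>Polynomials are kept as functions, since zero sets only see values. The degree bound
  serves the dimension counts and the clearing of denominators; \<open>pf\<close> forgets
  it.\<close>

inductive_set pfd :: "'v set \<Rightarrow> nat \<Rightarrow> (('v \<Rightarrow> 'b::comm_ring_1) \<Rightarrow> 'b) set" for I E where
  mon: "Poly_Mapping.keys a \<subseteq> I \<Longrightarrow> mdeg a \<le> E \<Longrightarrow> (\<lambda>y. c * mon a y) \<in> pfd I E"
| add: "p \<in> pfd I E \<Longrightarrow> q \<in> pfd I E \<Longrightarrow> (\<lambda>y. p y + q y) \<in> pfd I E"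

definition pf :: "'v set \<Rightarrow> (('v \<Rightarrow> 'b::comm_ring_1) \<Rightarrow> 'b) set" where
  "pf I = (\<Union>E. pfd I E)"

lemma mon_superset:
  "finite B \<Longrightarrow> Poly_Mapping.keys a \<subseteq> B \<Longrightarrow> mon a y = (\<Prod>v\<in>B. y v ^ Poly_Mapping.lookup a v)"
  unfolding mon_def by (rule prod.mono_neutral_left) (auto simp: in_keys_iff)

lemma mdeg_superset:
  "finite B \<Longrightarrow> Poly_Mapping.keys a \<subseteq> B \<Longrightarrow> mdeg a = (\<Sum>v\<in>B. Poly_Mapping.lookup a v)"
  unfolding mdeg_def by (rule sum.mono_neutral_left) (auto simp: in_keys_iff)

lemma mon_add: "mon (a + b) y = mon a y * mon b y"
proof -
  let ?B = "Poly_Mapping.keys a \<union> Poly_Mapping.keys b"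
  have "mon (a + b) y = (\<Prod>v\<in>?B. y v ^ Poly_Mapping.lookup (a + b) v)"
    by (rule mon_superset) (auto dest: subsetD[OF keys_add])
  then show ?thesis
    by (simp add: lookup_add power_add prod.distrib mon_superset[of ?B])
qed

lemma mdeg_add: "mdeg (a + b) = mdeg a + mdeg b"
proof -
  let ?B = "Poly_Mapping.keys a \<union> Poly_Mapping.keys b"
  have "mdeg (a + b) = (\<Sum>v\<in>?B. Poly_Mapping.lookup (a + b) v)"
    by (rule mdeg_superset) (auto dest: subsetD[OF keys_add])
  then show ?thesis
    by (simp add: lookup_add sum.distrib mdeg_superset[of ?B])
qed

lemma mon_zero [simp]: "mon 0 y = 1" and mdeg_zero [simp]: "mdeg 0 = 0"
  by (simp_all add: mon_def mdeg_def)

lemma pfd_mono: "p \<in> pfd I E \<Longrightarrow> I \<subseteq> I' \<Longrightarrow> E \<le> E' \<Longrightarrow> p \<in> pfd I' E'"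
proof (induction rule: pfd.induct)
  case (mon a c)
  then show ?case by (intro pfd.mon) auto
qed (auto intro: pfd.add)

lemma pfd_const: "(\<lambda>y. c) \<in> pfd I E"
  using pfd.mon[of 0 I E c] by simp

lemma pfd_var: "v \<in> I \<Longrightarrow> (\<lambda>y. y v) \<in> pfd I (Suc E)"
  using pfd.mon[of "Poly_Mapping.single v 1" I "Suc E" 1] by (simp add: mon_def mdeg_def)

lemma pfd_cmult: "p \<in> pfd I E \<Longrightarrow> (\<lambda>y. c * p y) \<in> pfd I E"
proof (induction rule: pfd.induct)
  case (mon a d)
  then show ?case using pfd.mon[of a I E "c * d"] by (simp add: mult.assoc)
qed (auto simp: algebra_simps intro: pfd.add)

lemma pfd_mult_mon:
  "p \<in> pfd I E \<Longrightarrow> Poly_Mapping.keys a \<subseteq> I \<Longrightarrow> mdeg a \<le> E' \<Longrightarrow> (\<lambda>y. p y * mon a y) \<in> pfd I (E + E')"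
proof (induction rule: pfd.induct)
  case (mon b d)
  have "(\<lambda>y. d * mon (b + a) y) \<in> pfd I (E + E')"
    using mon by (intro pfd.mon) (auto simp: mdeg_add dest!: subsetD[OF keys_add])
  then show ?case by (simp add: mon_add algebra_simps)
qed (auto simp: algebra_simps intro: pfd.add)

lemma pfd_mult: "q \<in> pfd I E' \<Longrightarrow> p \<in> pfd I E \<Longrightarrow> (\<lambda>y. p y * q y) \<in> pfd I (E + E')"
proof (induction rule: pfd.induct)
  case (mon b d)
  have "(\<lambda>y. d * (p y * mon b y)) \<in> pfd I (E + E')"
    using mon by (intro pfd_cmult pfd_mult_mon)
  then show ?case by (simp add: algebra_simps)
qed (auto simp: algebra_simps intro: pfd.add)

lemma pfd_power: "q \<in> pfd I E \<Longrightarrow> (\<lambda>y. q y ^ k) \<in> pfd I (k * E)"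
  by (induction k) (auto intro: pfd_const pfd_mult simp: add.commute dest: pfd_mult)

lemma pfI: "p \<in> pfd I E \<Longrightarrow> p \<in> pf I"
  by (auto simp: pf_def)

lemma pfE: "p \<in> pf I \<Longrightarrow> (\<And>E. p \<in> pfd I E \<Longrightarrow> thesis) \<Longrightarrow> thesis"
  by (auto simp: pf_def)

lemma pf_const: "(\<lambda>y. c) \<in> pf I"
  by (rule pfI[OF pfd_const])

lemma pf_var: "v \<in> I \<Longrightarrow> (\<lambda>y. y v) \<in> pf I"
  by (rule pfI[OF pfd_var])

lemma pf_mon: "Poly_Mapping.keys a \<subseteq> I \<Longrightarrow> (\<lambda>y. c * mon a y) \<in> pf I"
  by (rule pfI[OF pfd.mon]) auto

lemma pf_mono: "p \<in> pf I \<Longrightarrow> I \<subseteq> I' \<Longrightarrow> p \<in> pf I'"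
  by (meson pfE pfI pfd_mono order_refl)

lemma pf_add: "p \<in> pf I \<Longrightarrow> q \<in> pf I \<Longrightarrow> (\<lambda>y. p y + q y) \<in> pf I"
proof (elim pfE)
  fix E E' assume "p \<in> pfd I E" "q \<in> pfd I E'"
  then have "p \<in> pfd I (E + E')" "q \<in> pfd I (E + E')"
    by (auto intro: pfd_mono)
  then show ?thesis by (intro pfI[OF pfd.add])
qed

lemma pf_mult: "p \<in> pf I \<Longrightarrow> q \<in> pf I \<Longrightarrow> (\<lambda>y. p y * q y) \<in> pf I"
  by (elim pfE) (rule pfI[OF pfd_mult])

lemma pf_cmult: "p \<in> pf I \<Longrightarrow> (\<lambda>y. c * p y) \<in> pf I"
  by (elim pfE) (rule pfI[OF pfd_cmult])

lemma pf_uminus: "p \<in> pf I \<Longrightarrow> (\<lambda>y. - p y) \<in> pf I"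
  using pf_cmult[of p I "-1"] by simp

lemma pf_diff: "p \<in> pf I \<Longrightarrow> q \<in> pf I \<Longrightarrow> (\<lambda>y. p y - q y) \<in> pf I"
  using pf_add[OF _ pf_uminus, of p I q] by simp

lemma pf_power: "p \<in> pf I \<Longrightarrow> (\<lambda>y. p y ^ k) \<in> pf I"
  by (elim pfE) (rule pfI[OF pfd_power])

lemma pf_sum: "(\<And>i. i \<in> A \<Longrightarrow> f i \<in> pf I) \<Longrightarrow> (\<lambda>y. \<Sum>i\<in>A. f i y) \<in> pf I"
  by (induction A rule: infinite_finite_induct) (auto intro: pf_const pf_add)

lemma pf_prod: "(\<And>i. i \<in> A \<Longrightarrow> f i \<in> pf I) \<Longrightarrow> (\<lambda>y. \<Prod>i\<in>A. f i y) \<in> pf I"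
  by (induction A rule: infinite_finite_induct) (auto intro: pf_const pf_mult)

lemma pf_induct [consumes 1, case_names mon add]:
  assumes "q \<in> pf I"
    and "\<And>a c. Poly_Mapping.keys a \<subseteq> I \<Longrightarrow> P (\<lambda>y. c * mon a y)"
    and "\<And>p q. p \<in> pf I \<Longrightarrow> q \<in> pf I \<Longrightarrow> P p \<Longrightarrow> P q \<Longrightarrow> P (\<lambda>y. p y + q y)"
  shows "P q"
proof -
  obtain E where "q \<in> pfd I E" using assms(1) by (rule pfE)
  then show ?thesis by (induction rule: pfd.induct) (auto intro: assms pfI)
qed

lemma pf_cong: "p \<in> pf I \<Longrightarrow> (\<And>v. v \<in> I \<Longrightarrow> x v = y v) \<Longrightarrow> p x = p y"
proof (induction rule: pf_induct)
  case (mon a c)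
  then have "mon a x = mon a y"
    unfolding mon_def by (intro prod.cong) auto
  then show ?case by simp
qed auto

lemma pf_line:
  assumes "q \<in> pf I"
  shows "\<exists>P. \<forall>l. q (\<lambda>v. s v + l * (t v - s v)) = poly P l"
  using assms
proof (induction rule: pf_induct)
  case (mon a c)
  have "c * mon a (\<lambda>v. s v + l * (t v - s v)) =
      poly ([:c:] * (\<Prod>v\<in>Poly_Mapping.keys a. [:s v, t v - s v:] ^ Poly_Mapping.lookup a v)) l" for l
    by (simp add: mon_def poly_prod poly_power)
  then show ?case by blast
next
  case (add p q)
  then show ?case by (metis poly_add)
qed

text \<open>On the line joining a non-zero of \<open>p\<close> to a non-zero of \<open>q\<close>
  both restrict to nonzero univariate polynomials, so their product has finitely many roots
  there.\<close>

lemma pf_no_zero_divisors: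
  fixes p q :: "('v \<Rightarrow> 'k::field) \<Rightarrow> 'k"
  assumes "infinite (UNIV :: 'k set)" "p \<in> pf I" "q \<in> pf I" "p s \<noteq> 0" "q t \<noteq> 0"
  shows "\<exists>y. p y \<noteq> 0 \<and> q y \<noteq> 0"
proof -
  obtain P Q where P: "\<And>l. p (\<lambda>v. s v + l * (t v - s v)) = poly P l"
    and Q: "\<And>l. q (\<lambda>v. s v + l * (t v - s v)) = poly Q l"
    using pf_line[OF assms(2)] pf_line[OF assms(3)] by metis
  have "P \<noteq> 0" "Q \<noteq> 0"
    using P[of 0] Q[of 1] assms(4,5) by auto
  then have "finite {l. poly (P * Q) l = 0}"
    using poly_roots_finite by (metis mult_eq_0_iff)
  then obtain l where "poly (P * Q) l \<noteq> 0"
    using assms(1) by (metis (mono_tags, lifting) UNIV_eq_I mem_Collect_eq)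
  then show ?thesis using P Q by (metis mult_eq_0_iff poly_mult)
qed

section \<open>Formal polynomials and polynomial functions\<close>

lemma peval_mon: "peval \<phi> p y = (\<Sum>m\<in>Poly_Mapping.keys p. \<phi> (Poly_Mapping.lookup p m) * mon m y)"
  unfolding peval_def mon_def ..

lemma peval_superset:
  assumes "\<phi> 0 = 0" "finite B" "Poly_Mapping.keys p \<subseteq> B"
  shows "peval \<phi> p y = (\<Sum>m\<in>B. \<phi> (Poly_Mapping.lookup p m) * mon m y)"
  unfolding peval_mon using assms by (intro sum.mono_neutral_left) (auto simp: in_keys_iff)

lemma peval_add:
  fixes \<phi> :: "'a::comm_ring_1 \<Rightarrow> 'b::comm_ring_1"
  assumes "\<phi> 0 = 0" "\<And>a b. \<phi> (a + b) = \<phi> a + \<phi> b"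
  shows "peval \<phi> (p + q) y = peval \<phi> p y + peval \<phi> q y"
proof -
  let ?B = "Poly_Mapping.keys p \<union> Poly_Mapping.keys q"
  have "peval \<phi> (p + q) y = (\<Sum>m\<in>?B. \<phi> (Poly_Mapping.lookup (p + q) m) * mon m y)"
    by (rule peval_superset) (auto simp: assms(1) dest!: subsetD[OF keys_add])
  then show ?thesis
    by (simp add: peval_superset[of \<phi> ?B] assms lookup_add algebra_simps sum.distrib)
qed

lemma peval_single: "\<phi> 0 = 0 \<Longrightarrow> peval \<phi> (Poly_Mapping.single m c) y = \<phi> c * mon m y"
  by (simp add: peval_mon)

lemma pf_formal:
  assumes "q \<in> pf I"
  shows "\<exists>p. poly_vars_in I p \<and> peval id p = q"
  using assms
proof (induction rule: pf_induct)
  case (mon a c)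
  then show ?case
    by (intro exI[of _ "Poly_Mapping.single a c"]) (auto simp: poly_vars_in_def peval_single)
next
  case (add p q)
  then obtain p' q' where "poly_vars_in I p'" "peval id p' = p" "poly_vars_in I q'" "peval id q' = q"
    by blast
  moreover have "peval id (p' + q') = (\<lambda>y. peval id p' y + peval id q' y)"
    by (rule ext, rule peval_add) simp_all
  moreover from calculation have "poly_vars_in I (p' + q')"
    by (auto simp: poly_vars_in_def dest!: subsetD[OF keys_add])
  ultimately show ?case by metis
qed

lemma peval_pf: "poly_vars_in I p \<Longrightarrow> peval \<phi> p \<in> pf I"
  unfolding peval_mon poly_vars_in_def by (intro pf_sum pf_mon) auto

lemma mon_hom: "mon a (\<lambda>v. to_ac (y v)) = to_ac (mon a y)"
  by (simp add: mon_def to_ac_prod)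

lemma peval_to_ac: "peval to_ac p (\<lambda>v. to_ac (y v)) = to_ac (peval id p y)"
  by (simp add: peval_mon mon_hom to_ac_sum)

section \<open>Linear systems with polynomial coefficients\<close>

text \<open>Gaussian elimination without division. \<open>P\<close> is the set of pivot columns, at
  most one per row, and \<open>g\<close> the product of the pivots: arbitrary free entries
  \<open>u\<close> extend to a polynomial solution once multiplied by \<open>g\<close>. Pivots are
  nonzero only as polynomials, so a solution is useful only where \<open>g\<close> does not
  vanish.\<close>

lemma pf_elimination:
  fixes a :: "'r \<Rightarrow> 'j \<Rightarrow> ('v \<Rightarrow> 'k::field) \<Rightarrow> 'k"
  assumes inf: "infinite (UNIV :: 'k set)"
  assumes "finite Rw" "finite N" "\<forall>i\<in>Rw. \<forall>j\<in>N. a i j \<in> pf I"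
  shows "\<exists>P g. P \<subseteq> N \<and> card P \<le> card Rw \<and> g \<in> pf I \<and> (\<exists>s. g s \<noteq> 0) \<and>
    (\<forall>u. (\<forall>j\<in>N. u j \<in> pf I) \<longrightarrow> (\<exists>x. (\<forall>j\<in>N. x j \<in> pf I) \<and>
      (\<forall>j\<in>N - P. \<forall>t. x j t = g t * u j t) \<and> (\<forall>i\<in>Rw. \<forall>t. (\<Sum>j\<in>N. a i j t * x j t) = 0)))"
  using assms(2-4)
proof (induction Rw arbitrary: N a rule: finite_induct)
  case empty
  then show ?case
    by (intro exI[of _ "{}"] exI[of _ "\<lambda>_. 1"]) (auto intro: pf_const)
next
  case (insert r Rw)
  show ?case
  proof (cases "\<forall>j\<in>N. \<forall>t. a r j t = 0")
    case True
    obtain P g where P: "P \<subseteq> N" "card P \<le> card Rw" "g \<in> pf I" "\<exists>s. g s \<noteq> 0" and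
      x: "\<forall>u. (\<forall>j\<in>N. u j \<in> pf I) \<longrightarrow> (\<exists>x. (\<forall>j\<in>N. x j \<in> pf I) \<and>
      (\<forall>j\<in>N - P. \<forall>t. x j t = g t * u j t) \<and> (\<forall>i\<in>Rw. \<forall>t. (\<Sum>j\<in>N. a i j t * x j t) = 0))"
      using insert.IH[of N a] insert.prems by blast
    have "\<And>x t. (\<Sum>j\<in>N. a r j t * x j t) = 0"
      using True by (intro sum.neutral) auto
    then show ?thesis using P x insert(1,2)
      by (intro exI[of _ P] exI[of _ g]) auto
  next
    case False
    then obtain p s0 where p: "p \<in> N" "a r p s0 \<noteq> 0" by blast
    define N' where "N' = N - {p}"
    have fN': "finite N'" and N: "N = insert p N'" "p \<notin> N'"
      using insert.prems p by (auto simp: N'_def)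
    \<comment> \<open>Eliminating the unknown \<open>p\<close> by cross multiplication keeps the
      entries polynomial.\<close>
    define a' where "a' = (\<lambda>i j t. a r p t * a i j t - a i p t * a r j t)"
    have "\<forall>i\<in>Rw. \<forall>j\<in>N'. a' i j \<in> pf I"
      unfolding a'_def using insert.prems p N by (auto intro!: pf_diff pf_mult)
    then obtain P g where P: "P \<subseteq> N'" "card P \<le> card Rw" "g \<in> pf I" "\<exists>s. g s \<noteq> 0" and
      x: "\<And>u. (\<forall>j\<in>N'. u j \<in> pf I) \<Longrightarrow> (\<exists>x. (\<forall>j\<in>N'. x j \<in> pf I) \<and>
      (\<forall>j\<in>N' - P. \<forall>t. x j t = g t * u j t) \<and> (\<forall>i\<in>Rw. \<forall>t. (\<Sum>j\<in>N'. a' i j t * x j t) = 0))"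
      using insert.IH[OF fN', of a'] by blast
    have arp: "a r p \<in> pf I" using insert.prems p by auto
    have "finite P" using P fN' finite_subset by blast
    then have "card (insert p P) \<le> card (insert r Rw)"
      using P(2) insert(1,2) by (simp add: card_insert_if)
    moreover have "insert p P \<subseteq> N" using P N by auto
    moreover have "(\<lambda>t. a r p t * g t) \<in> pf I" using arp P by (intro pf_mult)
    moreover have "\<exists>s. a r p s * g s \<noteq> 0"
      using pf_no_zero_divisors[OF inf arp P(3)] p(2) P(4) by auto
    moreover have "\<exists>x. (\<forall>j\<in>N. x j \<in> pf I) \<and>
        (\<forall>j\<in>N - insert p P. \<forall>t. x j t = a r p t * g t * u j t) \<and>
        (\<forall>i\<in>insert r Rw. \<forall>t. (\<Sum>j\<in>N. a i j t * x j t) = 0)" if u: "\<forall>j\<in>N. u j \<in> pf I" for u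
    proof -
      obtain x where x: "\<forall>j\<in>N'. x j \<in> pf I" "\<forall>j\<in>N' - P. \<forall>t. x j t = g t * u j t"
        "\<forall>i\<in>Rw. \<forall>t. (\<Sum>j\<in>N'. a' i j t * x j t) = 0"
        using x[of u] u N by auto
      \<comment> \<open>Row \<open>r\<close> is solved for the unknown \<open>p\<close>; all other
        unknowns are scaled by the pivot instead of dividing by it.\<close>
      define y where "y = (\<lambda>j t. if j = p then - (\<Sum>j\<in>N'. a r j t * x j t) else a r p t * x j t)"
      have sN: "(\<Sum>j\<in>N. a i j t * y j t) =
          (\<Sum>j\<in>N'. a r p t * a i j t * x j t) - a i p t * (\<Sum>j\<in>N'. a r j t * x j t)" for i t
      proof -
        have "(\<Sum>j\<in>N. a i j t * y j t) = a i p t * y p t + (\<Sum>j\<in>N'. a i j t * y j t)"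
          using N fN' by simp
        also have "(\<Sum>j\<in>N'. a i j t * y j t) = (\<Sum>j\<in>N'. a r p t * a i j t * x j t)"
          using N(2) by (intro sum.cong) (auto simp: y_def)
        finally show ?thesis by (simp add: y_def)
      qed
      have "(\<Sum>j\<in>N. a i j t * y j t) = 0" if "i \<in> insert r Rw" for i t
      proof (cases "i = r")
        case True
        then show ?thesis unfolding sN by (simp add: sum_distrib_left mult.assoc)
      next
        case False
        then have "(\<Sum>j\<in>N'. a' i j t * x j t) = 0" using x(3) that by auto
        then show ?thesis
          unfolding sN a'_def by (simp add: sum_distrib_left algebra_simps sum_subtractf)
      qed
      moreover have "y j \<in> pf I" if "j \<in> N" for j
      proof (cases "j = p")
        case True
        have "(\<lambda>t. - (\<Sum>j\<in>N'. a r j t * x j t)) \<in> pf I"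
          using x(1) insert.prems N by (intro pf_uminus pf_sum pf_mult) auto
        then show ?thesis using True by (simp add: y_def)
      next
        case False
        have "(\<lambda>t. a r p t * x j t) \<in> pf I"
          using x(1) N that False arp by (intro pf_mult) auto
        then show ?thesis using False by (simp add: y_def)
      qed
      moreover have "\<forall>j\<in>N - insert p P. \<forall>t. y j t = a r p t * g t * u j t"
        using x(2) N by (auto simp: y_def)
      ultimately show ?thesis by blast
    qed
    ultimately show ?thesis by blast
  qed
qed

lemma homogeneous_system_nontrivial:
  fixes a :: "'r \<Rightarrow> 'j \<Rightarrow> 'k::field"
  assumes inf: "infinite (UNIV :: 'k set)" and "finite Rw" "finite N" "card Rw < card N"
  shows "\<exists>x. (\<exists>j\<in>N. x j \<noteq> 0) \<and> (\<forall>i\<in>Rw. (\<Sum>j\<in>N. a i j * x j) = 0)"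
proof -
  obtain P g s where P: "P \<subseteq> N" "card P \<le> card Rw" "g \<in> pf {}" and
    x: "\<forall>u. (\<forall>j\<in>N. u j \<in> pf ({}::nat set)) \<longrightarrow> (\<exists>x. (\<forall>j\<in>N. x j \<in> pf {}) \<and>
      (\<forall>j\<in>N - P. \<forall>t. x j t = g t * u j t) \<and> (\<forall>i\<in>Rw. \<forall>t. (\<Sum>j\<in>N. a i j * x j t) = 0))"
    and s: "g s \<noteq> 0"
    using pf_elimination[OF assms(1-3), of "\<lambda>i j t. a i j" "{}::nat set", OF ballI[OF ballI[OF pf_const]]]
    by (elim exE conjE) (rule that)
  \<comment> \<open>All free unknowns are set to 1; there is one because the pivots are fewer than
    the unknowns.\<close>
  obtain x where "\<forall>j\<in>N - P. \<forall>t. x j t = g t" "\<forall>i\<in>Rw. \<forall>t. (\<Sum>j\<in>N. a i j * x j t) = 0"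
    using spec[OF x, of "\<lambda>j _. 1"] by (auto simp: pf_const)
  moreover obtain j where "j \<in> N - P"
    using P assms by (metis Diff_iff card_mono finite_subset leD order.strict_trans1 subsetI)
  ultimately show ?thesis using s by (intro exI[of _ "\<lambda>j. x j s"]) (auto intro!: bexI[of _ j])
qed

section \<open>Multilinear functions in coordinates\<close>

definition unit_vec :: "nat \<Rightarrow> nat \<Rightarrow> 'k::zero_neq_one" where
  "unit_vec j = (\<lambda>j'. if j' = j then 1 else 0)"

lemma multilinear_on_cong:
  "multilinear_on A n g \<Longrightarrow> (\<And>i j. i \<in> A \<Longrightarrow> j < n i \<Longrightarrow> x i j = y i j) \<Longrightarrow> g x = g y"
  unfolding multilinear_on_def by blast

lemma multilinear_on_zero_slot:
  assumes "multilinear_on A n g" "i \<in> A"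
  shows "g (x(i := (\<lambda>j. 0))) = 0"
proof -
  have "g (x(i := (\<lambda>j. 0 * x i j + 0 * x i j))) = 0 * g (x(i := x i)) + 0 * g (x(i := x i))"
    using assms unfolding multilinear_on_def by blast
  then show ?thesis by simp
qed

lemma multilinear_on_add_slot:
  "multilinear_on A n g \<Longrightarrow> i \<in> A \<Longrightarrow> g (x(i := (\<lambda>j. u j + b * w j))) = g (x(i := u)) + b * g (x(i := w))"
proof -
  assume "multilinear_on A n g" "i \<in> A"
  then have "g (x(i := (\<lambda>j. 1 * u j + b * w j))) = 1 * g (x(i := u)) + b * g (x(i := w))"
    unfolding multilinear_on_def by blast
  then show ?thesis by simp
qed

lemma multilinear_on_slot:
  assumes g: "multilinear_on A n g" and i: "i \<in> A"
  shows "g (x(i := u)) = (\<Sum>j<n i. u j * g (x(i := unit_vec j)))"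
proof -
  \<comment> \<open>Induction on the number of coordinates of \<open>u\<close> that are kept, the
    others being 0.\<close>
  have "g (x(i := (\<lambda>j. if j < k then u j else 0))) = (\<Sum>j<k. u j * g (x(i := unit_vec j)))" for k
  proof (induction k)
    case 0
    show ?case
      using multilinear_on_zero_slot[OF g i, of x] by (simp only: not_less_zero if_False lessThan_0 sum.empty)
  next
    case (Suc k)
    have "(\<lambda>j. if j < Suc k then u j else 0) = (\<lambda>j. (if j < k then u j else 0) + u k * unit_vec k j)"
      by (auto simp: unit_vec_def fun_eq_iff less_Suc_eq)
    then show ?case using Suc multilinear_on_add_slot[OF g i] by (simp del: fun_upd_apply add: sum.lessThan_Suc)
  qed
  moreover have "g (x(i := u)) = g (x(i := (\<lambda>j. if j < n i then u j else 0)))"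
    by (rule multilinear_on_cong[OF g]) auto
  ultimately show ?thesis by simp
qed

lemma multilinear_on_expand:
  assumes g: "multilinear_on A n g" and "finite A"
  shows "g x = (\<Sum>\<tau>\<in>PiE A (\<lambda>i. {..<n i}). g (\<lambda>i. unit_vec (\<tau> i)) * (\<Prod>i\<in>A. x i (\<tau> i)))"
proof -
  \<comment> \<open>\<open>B\<close> holds the arguments already expanded; the remaining ones keep
    their value in \<open>x\<close>.\<close>
  have "g x = (\<Sum>\<tau>\<in>PiE B (\<lambda>i. {..<n i}). g (\<lambda>i. if i \<in> B then unit_vec (\<tau> i) else x i) * (\<Prod>i\<in>B. x i (\<tau> i)))"
    if "finite B" "B \<subseteq> A" for B
    using that
  proof (induction B rule: finite_induct)
    case empty
    then show ?case by simp
  next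
    case (insert b B)
    have inj: "inj_on (\<lambda>(j, \<tau>). \<tau>(b := j)) ({..<n b} \<times> PiE B (\<lambda>i. {..<n i}))"
      using insert.hyps(2) by (rule inj_combinator)
    have step: "g (\<lambda>i. if i \<in> B then unit_vec (\<tau> i) else x i) * (\<Prod>i\<in>B. x i (\<tau> i)) =
        (\<Sum>j<n b. g (\<lambda>i. if i \<in> insert b B then unit_vec ((\<tau>(b := j)) i) else x i) *
           (\<Prod>i\<in>insert b B. x i ((\<tau>(b := j)) i)))" for \<tau>
    proof -
      let ?y = "\<lambda>i. if i \<in> B then unit_vec (\<tau> i) else x i"
      have "g ?y = g (?y(b := x b))"
        using insert.hyps by (intro arg_cong[of _ _ g]) auto
      also have "\<dots> = (\<Sum>j<n b. x b j * g (?y(b := unit_vec j)))"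
        using insert.prems by (intro multilinear_on_slot[OF g]) auto
      also have "\<dots> = (\<Sum>j<n b. x b j * g (\<lambda>i. if i \<in> insert b B then unit_vec ((\<tau>(b := j)) i) else x i))"
        by (intro sum.cong refl arg_cong2[of _ _ _ _ "(*)"] arg_cong[of _ _ g]) (auto simp: fun_eq_iff)
      finally have "g ?y = \<dots>" .
      moreover have "(\<Prod>i\<in>insert b B. x i ((\<tau>(b := j)) i)) = x b j * (\<Prod>i\<in>B. x i (\<tau> i))" for j
      proof -
        have "(\<Prod>i\<in>B. x i ((\<tau>(b := j)) i)) = (\<Prod>i\<in>B. x i (\<tau> i))"
          using insert.hyps by (intro prod.cong) auto
        then show ?thesis using insert.hyps by simp
      qed
      ultimately show ?thesis
        by (simp add: sum_distrib_right sum_distrib_left algebra_simps)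
    qed
    have "g x = (\<Sum>\<tau>\<in>PiE B (\<lambda>i. {..<n i}). \<Sum>j<n b.
         g (\<lambda>i. if i \<in> insert b B then unit_vec ((\<tau>(b := j)) i) else x i) *
           (\<Prod>i\<in>insert b B. x i ((\<tau>(b := j)) i)))"
      using insert.IH insert.prems step by simp
    also have "\<dots> = (\<Sum>(j, \<tau>)\<in>{..<n b} \<times> PiE B (\<lambda>i. {..<n i}).
         g (\<lambda>i. if i \<in> insert b B then unit_vec ((\<tau>(b := j)) i) else x i) *
           (\<Prod>i\<in>insert b B. x i ((\<tau>(b := j)) i)))"
      by (subst sum.swap) (simp only: sum.cartesian_product)
    also have "\<dots> = (\<Sum>\<tau>\<in>PiE (insert b B) (\<lambda>i. {..<n i}).
         g (\<lambda>i. if i \<in> insert b B then unit_vec (\<tau> i) else x i) * (\<Prod>i\<in>insert b B. x i (\<tau> i)))"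
      unfolding PiE_insert_eq by (subst sum.reindex[OF inj]) (simp add: case_prod_unfold)
    finally show ?case .
  qed
  from this[OF assms(2) order_refl]
  have "g x = (\<Sum>\<tau>\<in>PiE A (\<lambda>i. {..<n i}). g (\<lambda>i. if i \<in> A then unit_vec (\<tau> i) else x i) * (\<Prod>i\<in>A. x i (\<tau> i)))" .
  moreover have "g (\<lambda>i. if i \<in> A then unit_vec (\<tau> i) else x i) = g (\<lambda>i. unit_vec (\<tau> i))" for \<tau> :: "nat \<Rightarrow> nat"
    by (rule multilinear_on_cong[OF g]) auto
  ultimately show ?thesis by simp
qed

lemma multilinear_on_scale:
  assumes g: "multilinear_on A n g" and "finite A"
  shows "g (\<lambda>i j. c i * x i j) = (\<Prod>i\<in>A. c i) * g x"
  by (subst (1 2) multilinear_on_expand[OF assms])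
     (simp add: prod.distrib sum_distrib_left algebra_simps)

lemma multilinear_on_pf:
  assumes g: "multilinear_on A n g" and "finite A"
    and x: "\<And>i j. i \<in> A \<Longrightarrow> j < n i \<Longrightarrow> (\<lambda>t. x t i j) \<in> pf I"
  shows "(\<lambda>t. g (x t)) \<in> pf I"
  by (subst multilinear_on_expand[OF g assms(2)])
     (intro pf_sum pf_cmult pf_prod x; force dest: PiE_mem)

section \<open>Irreducible closed sets\<close>

text \<open>Closure with respect to polynomials over the large field itself. For points with
  coordinates in the small field, \<open>zariski_closure_K\<close> uses fewer equations and
  therefore cannot be smaller.\<close>

definition vcl :: "'v set \<Rightarrow> ('v \<Rightarrow> 'L::field) set \<Rightarrow> ('v \<Rightarrow> 'L) set" where
  "vcl I T = {y \<in> aff I. \<forall>p. poly_vars_in I p \<longrightarrow> (\<forall>s\<in>T. peval id p s = 0) \<longrightarrow> peval id p y = 0}"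

lemma zariski_closed_vcl: "zariski_closed I (vcl I T)"
  unfolding zariski_closed_def vcl_def
  by (rule exI[of _ "{p. poly_vars_in I p \<and> (\<forall>s\<in>T. peval id p s = 0)}"]) auto

lemma vcl_superset: "T \<subseteq> aff I \<Longrightarrow> T \<subseteq> vcl I T"
  by (auto simp: vcl_def)

lemma vcl_mono: "T \<subseteq> T' \<Longrightarrow> vcl I T \<subseteq> vcl I T'"
  by (auto simp: vcl_def)

lemma vcl_pf_zero:
  assumes "p \<in> pf I" "\<forall>s\<in>T. p s = 0" "y \<in> vcl I T"
  shows "p y = 0"
proof -
  obtain p' where "poly_vars_in I p'" "peval id p' = p"
    using pf_formal assms(1) by blast
  then show ?thesis using assms(2,3) by (auto simp: vcl_def)
qed

text \<open>If two proper closed subsets covered the closure, each would have an equation that fails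
  somewhere on the closure. The product of the two vanishes on \<open>T\<close>, so one of them
  vanishes on \<open>T\<close> and hence on the closure.\<close>

lemma irreducible_vcl:
  assumes "T \<noteq> {}" "T \<subseteq> aff I"
    and prime: "\<And>p q. p \<in> pf I \<Longrightarrow> q \<in> pf I \<Longrightarrow> (\<forall>s\<in>T. p s * q s = 0) \<Longrightarrow>
      (\<forall>s\<in>T. p s = 0) \<or> (\<forall>s\<in>T. q s = 0)"
  shows "zariski_irreducible I (vcl I T)"
proof -
  have "vcl I T = Y \<or> vcl I T = Z" if "zariski_closed I Y" "zariski_closed I Z" and YZ: "vcl I T = Y \<union> Z" for Y Z
  proof (rule ccontr)
    assume neg: "\<not> (vcl I T = Y \<or> vcl I T = Z)"
    obtain Ps where Ps: "\<forall>p\<in>Ps. poly_vars_in I p" "Y = {y \<in> aff I. \<forall>p\<in>Ps. peval id p y = 0}"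
      using \<open>zariski_closed I Y\<close> unfolding zariski_closed_def by blast
    obtain Qs where Qs: "\<forall>p\<in>Qs. poly_vars_in I p" "Z = {y \<in> aff I. \<forall>p\<in>Qs. peval id p y = 0}"
      using \<open>zariski_closed I Z\<close> unfolding zariski_closed_def by blast
    obtain y z where "y \<in> vcl I T" "y \<notin> Y" "z \<in> vcl I T" "z \<notin> Z"
      using neg YZ by blast
    moreover have "y \<in> aff I" "z \<in> aff I" using calculation by (auto simp: vcl_def)
    ultimately obtain p q where pq: "p \<in> Ps" "peval id p y \<noteq> 0" "q \<in> Qs" "peval id q z \<noteq> 0"
      using Ps Qs by blast
    have "\<forall>s\<in>T. peval id p s * peval id q s = 0"
      using vcl_superset[OF assms(2)] YZ Ps(2) Qs(2) pq by auto
    then have "(\<forall>s\<in>T. peval id p s = 0) \<or> (\<forall>s\<in>T. peval id q s = 0)"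
      using pq Ps Qs by (intro prime peval_pf) auto
    then show False
      using pq Ps(1) Qs(1) \<open>y \<in> vcl I T\<close> \<open>z \<in> vcl I T\<close> by (auto simp: vcl_def)
  qed
  moreover have "vcl I T \<noteq> {}" using assms vcl_superset by blast
  ultimately show ?thesis
    unfolding zariski_irreducible_def using zariski_closed_vcl by blast
qed

lemma zariski_irreducible_prime:
  assumes irr: "zariski_irreducible I W" and p: "p \<in> pf I" and q: "q \<in> pf I"
    and pq: "\<forall>y\<in>W. p y * q y = 0"
  shows "(\<forall>y\<in>W. p y = 0) \<or> (\<forall>y\<in>W. q y = 0)"
proof -
  obtain Ps where Ps: "\<forall>p\<in>Ps. poly_vars_in I p" "W = {y \<in> aff I. \<forall>p\<in>Ps. peval id p y = 0}"
    using irr unfolding zariski_irreducible_def zariski_closed_def by blast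
  have cl: "zariski_closed I {y\<in>W. p y = 0}" if p: "p \<in> pf I" for p
  proof -
    obtain p' where "poly_vars_in I p'" "peval id p' = p"
      using pf_formal p by blast
    then show ?thesis
      using Ps unfolding zariski_closed_def by (intro exI[of _ "insert p' Ps"]) auto
  qed
  have "W = {y\<in>W. p y = 0} \<union> {y\<in>W. q y = 0}" using pq by auto
  then have "W = {y\<in>W. p y = 0} \<or> W = {y\<in>W. q y = 0}"
    using irr cl[OF p] cl[OF q] unfolding zariski_irreducible_def by blast
  then show ?thesis by blast
qed

section \<open>Chains of closures of rationally parametrized sets\<close>

lemma vcl_subset_closure_K:
  assumes "T \<subseteq> (\<lambda>s v. to_ac (s v)) ` S"
  shows "vcl I T \<subseteq> zariski_closure_K I S"
proof
  fix y assume y: "y \<in> vcl I T"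
  have "peval to_ac p y = 0" if "poly_vars_in I p" "\<forall>s\<in>S. peval id p s = 0" for p
    by (rule vcl_pf_zero[OF peval_pf[OF that(1)] _ y]) (use assms that in \<open>auto simp: peval_to_ac\<close>)
  then show "y \<in> zariski_closure_K I S"
    using y by (auto simp: zariski_closure_K_def vcl_def)
qed

lemma pf_to_ac:
  assumes "u \<in> pf I"
  shows "\<exists>u'\<in>pf I. \<forall>t. u' (\<lambda>v. to_ac (t v)) = to_ac (u t)"
proof -
  obtain p where "poly_vars_in I p" "peval id p = u" using pf_formal assms by blast
  then show ?thesis using peval_pf peval_to_ac by metis
qed

lemma pfd_clear_denominator:
  assumes "p \<in> pfd I E" and "\<And>v. v \<in> I \<Longrightarrow> u v \<in> pf I'" and G: "G \<in> pf I'"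
  shows "\<exists>q\<in>pf I'. \<forall>t. (G t :: 'b::field) \<noteq> 0 \<longrightarrow> p (\<lambda>v. u v t / G t) * G t ^ E = q t"
  using assms(1)
proof (induction rule: pfd.induct)
  case (mon a c)
  \<comment> \<open>The factor \<open>G t ^ (E - mdeg a)\<close> pads every monomial, so that all of
    them share the denominator \<open>G ^ E\<close>.\<close>
  let ?q = "\<lambda>t. c * ((\<Prod>v\<in>Poly_Mapping.keys a. u v t ^ Poly_Mapping.lookup a v) * G t ^ (E - mdeg a))"
  have "?q \<in> pf I'"
    using mon assms by (intro pf_cmult pf_mult pf_prod pf_power) auto
  moreover have "c * mon a (\<lambda>v. u v t / G t) * G t ^ E = ?q t" if "G t \<noteq> 0" for t
  proof -
    have "(\<Prod>v\<in>Poly_Mapping.keys a. G t ^ Poly_Mapping.lookup a v) = G t ^ mdeg a"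
      by (simp add: mdeg_def power_sum)
    moreover have "G t ^ E = G t ^ mdeg a * G t ^ (E - mdeg a)"
      using mon by (simp flip: power_add)
    ultimately show ?thesis
      using that by (simp add: mon_def power_divide prod_dividef)
  qed
  ultimately show ?case by (intro bexI[of _ ?q]) simp_all
next
  case (add p q)
  then obtain p' q' where "p' \<in> pf I'" "q' \<in> pf I'"
    "\<forall>t. G t \<noteq> 0 \<longrightarrow> p (\<lambda>v. u v t / G t) * G t ^ E = p' t"
    "\<forall>t. G t \<noteq> 0 \<longrightarrow> q (\<lambda>v. u v t / G t) * G t ^ E = q' t" by blast
  then show ?case
    by (intro bexI[of _ "\<lambda>t. p' t + q' t"]) (auto simp: algebra_simps intro: pf_add)
qed

lemma infinite_to_ac: "infinite (UNIV :: 'k::field set) \<Longrightarrow> infinite (UNIV :: 'k alg_closure set)"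
  by (metis finite_imageD finite_subset inj_to_ac subset_UNIV)

text \<open>The parameters indexed by \<open>J\<close> reappear as coordinates of the point. Freeing
  them one at a time, with all others frozen at \<open>t0\<close>, gives sets whose closures grow
  strictly, because the next coordinate is constant on the smaller set. Irreducibility comes from
  joining two parameters by a line.\<close>

lemma rational_parametrization_chain:
  fixes S :: "('v \<Rightarrow> 'k::field) set"
  assumes inf: "infinite (UNIV :: 'k set)" and J: "finite J" "J \<subseteq> I"
    and G: "G \<in> pf I" "G t0 \<noteq> 0" and u: "\<And>v. v \<in> I \<Longrightarrow> u v \<in> pf I"
    and uJ: "\<And>v t. v \<in> J \<Longrightarrow> u v t = G t * t v"
    and S: "\<And>t. G t \<noteq> 0 \<Longrightarrow> (\<lambda>v. if v \<in> I then u v t / G t else 0) \<in> S"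
  shows "\<exists>C. (\<forall>i\<le>card J. zariski_irreducible I (C i) \<and> C i \<subseteq> zariski_closure_K I S) \<and>
             (\<forall>i<card J. C i \<subset> C (Suc i))"
proof -
  define \<phi> where "\<phi> = (\<lambda>t v. if v \<in> I then u v t / G t else 0)"
  obtain e where e: "bij_betw e {..<card J} J"
    using ex_bij_betw_nat_finite[OF J(1)] by (auto simp: atLeast0LessThan)
  define Par where "Par k = {t. G t \<noteq> 0 \<and> (\<forall>v. v \<notin> e ` {..<k} \<longrightarrow> t v = t0 v)}" for k
  define T where "T k = (\<lambda>t v. to_ac (\<phi> t v)) ` Par k" for k
  have TS: "T k \<subseteq> (\<lambda>s v. to_ac (s v)) ` S" for k
    using S by (auto simp: T_def Par_def \<phi>_def)
  have Taff: "T k \<subseteq> aff I" for k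
    by (auto simp: T_def \<phi>_def aff_def)
  have Tne: "T k \<noteq> {}" for k
    using G(2) by (auto simp: T_def Par_def)
  obtain G' where G': "G' \<in> pf I" "\<And>t. G' (\<lambda>v. to_ac (t v)) = to_ac (G t)"
    using pf_to_ac[OF G(1)] by blast
  have "\<forall>v\<in>I. \<exists>w. w \<in> pf I \<and> (\<forall>t. w (\<lambda>v. to_ac (t v)) = to_ac (u v t))"
    using pf_to_ac[OF u] by blast
  then obtain u' where u': "\<And>v. v \<in> I \<Longrightarrow> u' v \<in> pf I"
    "\<And>v t. v \<in> I \<Longrightarrow> u' v (\<lambda>v. to_ac (t v)) = to_ac (u v t)"
    by metis
  \<comment> \<open>Vanishing along the parametrization becomes, where \<open>G\<close> is nonzero,
    vanishing of a polynomial in the parameters.\<close>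
  have clear: "\<exists>q\<in>pf I. \<forall>t. G t \<noteq> 0 \<longrightarrow> (p (\<lambda>v. to_ac (\<phi> t v)) = 0 \<longleftrightarrow> q (\<lambda>v. to_ac (t v)) = 0)"
    if p: "p \<in> pf I" for p
  proof -
    obtain E where "p \<in> pfd I E" using p by (rule pfE)
    then obtain q where q: "q \<in> pf I" "\<And>t. G' t \<noteq> 0 \<Longrightarrow> p (\<lambda>v. u' v t / G' t) * G' t ^ E = q t"
      using pfd_clear_denominator[of p I E u' I G'] u'(1) G'(1) by blast
    have "p (\<lambda>v. to_ac (\<phi> t v)) = 0 \<longleftrightarrow> q (\<lambda>v. to_ac (t v)) = 0" if "G t \<noteq> 0" for t
    proof -
      have "p (\<lambda>v. to_ac (\<phi> t v)) = p (\<lambda>v. u' v (\<lambda>v. to_ac (t v)) / G' (\<lambda>v. to_ac (t v)))"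
        by (rule pf_cong[OF p]) (simp add: \<phi>_def u' G')
      then show ?thesis using q(2)[of "\<lambda>v. to_ac (t v)"] that
        by (metis G'(2) mult_eq_0_iff power_not_zero to_ac_eq_0_iff)
    qed
    then show ?thesis using q(1) by blast
  qed
  have line: "\<exists>P. \<forall>l. q (\<lambda>v. to_ac (s v + l * (t v - s v))) = poly P (to_ac l)"
    if "q \<in> pf I" for q :: "('v \<Rightarrow> 'k alg_closure) \<Rightarrow> 'k alg_closure" and s t :: "'v \<Rightarrow> 'k"
    using pf_line[OF that, of "\<lambda>v. to_ac (s v)" "\<lambda>v. to_ac (t v)"] by auto
  \<comment> \<open>The line parameter is taken in the base field so that the points stay in
    \<open>S\<close>; a polynomial over the algebraic closure still excludes only finitely many
    values.\<close>
  have avoid: "\<exists>l. l \<noteq> l0 \<and> poly P (to_ac l) \<noteq> 0" if "P \<noteq> 0" for P and l0 :: 'k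
  proof -
    have "finite {l. poly P l = 0}" using that by (rule poly_roots_finite)
    then have "finite (insert l0 (to_ac -` {l. poly P l = 0}))"
      using finite_vimageI inj_to_ac by blast
    then obtain l where "l \<notin> insert l0 (to_ac -` {l. poly P l = 0})"
      using inf ex_new_if_finite by blast
    then show ?thesis by auto
  qed
  have irr: "zariski_irreducible I (vcl I (T k))" for k
  proof (rule irreducible_vcl[OF Tne Taff], rule ccontr)
    fix p q assume p: "p \<in> pf I" and q: "q \<in> pf I" and pq: "\<forall>s\<in>T k. p s * q s = 0"
      and neg: "\<not> ((\<forall>s\<in>T k. p s = 0) \<or> (\<forall>s\<in>T k. q s = 0))"
    obtain s t where s: "s \<in> Par k" "p (\<lambda>v. to_ac (\<phi> s v)) \<noteq> 0"
      and t: "t \<in> Par k" "q (\<lambda>v. to_ac (\<phi> t v)) \<noteq> 0"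
      using neg by (auto simp: T_def)
    obtain p' where p': "p' \<in> pf I"
      "\<forall>t. G t \<noteq> 0 \<longrightarrow> (p (\<lambda>v. to_ac (\<phi> t v)) = 0 \<longleftrightarrow> p' (\<lambda>v. to_ac (t v)) = 0)"
      using clear[OF p] by blast
    obtain q' where q': "q' \<in> pf I"
      "\<forall>t. G t \<noteq> 0 \<longrightarrow> (q (\<lambda>v. to_ac (\<phi> t v)) = 0 \<longleftrightarrow> q' (\<lambda>v. to_ac (t v)) = 0)"
      using clear[OF q] by blast
    define pt where "pt l = (\<lambda>v. s v + l * (t v - s v))" for l
    obtain P where P: "\<And>l. p' (\<lambda>v. to_ac (pt l v)) = poly P (to_ac l)"
      using line[OF p'(1)] unfolding pt_def by blast
    obtain Q where Q: "\<And>l. q' (\<lambda>v. to_ac (pt l v)) = poly Q (to_ac l)"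
      using line[OF q'(1)] unfolding pt_def by blast
    obtain R where R: "\<And>l. G' (\<lambda>v. to_ac (pt l v)) = poly R (to_ac l)"
      using line[OF G'(1)] unfolding pt_def by blast
    have pt: "pt 0 = s" "pt 1 = t" by (auto simp: pt_def)
    have "P \<noteq> 0" using P[of 0] s p' by (auto simp: pt Par_def)
    moreover have "Q \<noteq> 0" using Q[of 1] t q' by (auto simp: pt Par_def)
    moreover have "R \<noteq> 0" using R[of 0] s G' by (auto simp: pt Par_def)
    \<comment> \<open>A point of the line where \<open>p\<close>, \<open>q\<close> and the
      denominator are all nonzero contradicts \<open>pq\<close>.\<close>
    ultimately obtain l where l: "poly (P * Q * R) (to_ac l) \<noteq> 0"
      using avoid[of "P * Q * R"] by auto
    have Gl: "G (pt l) \<noteq> 0" using l R[of l] G'(2)[of "pt l"] by auto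
    moreover have "pt l \<in> Par k"
      using s t Gl by (auto simp: Par_def pt_def)
    ultimately show False
      using l P[of l] Q[of l] p' q' pq by (auto simp: T_def)
  qed
  have "vcl I (T k) \<subset> vcl I (T (Suc k))" if k: "k < card J" for k
  proof -
    have ekJ: "e k \<in> J" using bij_betwE[OF e] k by auto
    have ek: "e k \<notin> e ` {..<k}"
      using bij_betw_imp_inj_on[OF e] k by (fastforce dest: inj_onD)
    have "T k \<subseteq> T (Suc k)"
      unfolding T_def by (rule image_mono) (auto simp: Par_def lessThan_Suc)
    then have sub: "vcl I (T k) \<subseteq> vcl I (T (Suc k))" by (rule vcl_mono)
    \<comment> \<open>Only the coordinate \<open>e k\<close> moves, by \<open>l\<close>. A nonzero
      \<open>l\<close> with nonzero denominator gives a point of the next set off the hyperplane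
      where that coordinate equals \<open>t0 (e k)\<close>.\<close>
    define pt where "pt l = (\<lambda>v. t0 v + l * ((t0(e k := t0 (e k) + 1)) v - t0 v))" for l
    obtain R where R: "\<And>l. G' (\<lambda>v. to_ac (pt l v)) = poly R (to_ac l)"
      using line[OF G'(1)] unfolding pt_def by blast
    have "pt 0 = t0" by (auto simp: pt_def)
    then have "R \<noteq> 0" using R[of 0] G G'(2)[of t0] by auto
    then obtain l where l: "l \<noteq> 0" "poly R (to_ac l) \<noteq> 0" using avoid by blast
    have "G (pt l) \<noteq> 0" using l R[of l] G'(2)[of "pt l"] by auto
    then have ptP: "pt l \<in> Par (Suc k)" by (auto simp: Par_def pt_def)
    have \<phi>J: "\<phi> t (e k) = t (e k)" if "G t \<noteq> 0" for t
      using that uJ[OF ekJ] ekJ J by (auto simp: \<phi>_def)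
    let ?p = "\<lambda>y. y (e k) - to_ac (t0 (e k))"
    have "?p \<in> pf I" using ekJ J by (intro pf_diff pf_var pf_const) auto
    moreover have "\<forall>s\<in>T k. ?p s = 0"
      using ek \<phi>J by (auto simp: T_def Par_def)
    moreover have "?p (\<lambda>v. to_ac (\<phi> (pt l) v)) \<noteq> 0"
      using \<phi>J ptP l(1) by (auto simp: Par_def pt_def)
    ultimately have "(\<lambda>v. to_ac (\<phi> (pt l) v)) \<notin> vcl I (T k)"
      using vcl_pf_zero by blast
    moreover have "(\<lambda>v. to_ac (\<phi> (pt l) v)) \<in> vcl I (T (Suc k))"
      using vcl_superset[OF Taff] ptP by (auto simp: T_def)
    ultimately show ?thesis using sub by blast
  qed
  then show ?thesis
    using irr vcl_subset_closure_K[OF TS] by (intro exI[of _ "\<lambda>k. vcl I (T k)"]) auto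
qed


section \<open>Solving multilinear equations slot by slot\<close>

text \<open>An equation is charged to the largest argument it involves. Once the earlier arguments
  are solved for, it is linear in that one, and \<open>pf_elimination\<close> applies with at most
  one pivot per equation. \<open>c i\<close> is the denominator produced for argument
  \<open>i\<close>; \<open>P\<close> collects the pivots.\<close>

lemma multilinear_tower:
  fixes g :: "nat \<Rightarrow> (nat \<Rightarrow> nat \<Rightarrow> 'k::field) \<Rightarrow> 'k"
  assumes inf: "infinite (UNIV :: 'k set)"
    and slots: "\<forall>k<r. A k \<noteq> {} \<and> finite (A k) \<and> multilinear_on (A k) n (g k)"
  shows "\<exists>P Y c. P \<subseteq> Sigma {..<m} (\<lambda>i. {..<n i}) \<and> card P \<le> card {k. k < r \<and> Max (A k) < m} \<and>
    (\<forall>i<m. c i \<in> pf (Sigma {..<m} (\<lambda>i. {..<n i})) \<and> (\<exists>t. c i t \<noteq> 0)) \<and>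
    (\<forall>v\<in>Sigma {..<m} (\<lambda>i. {..<n i}). Y v \<in> pf (Sigma {..<m} (\<lambda>i. {..<n i}))) \<and>
    (\<forall>(i, j)\<in>Sigma {..<m} (\<lambda>i. {..<n i}) - P. \<forall>t. Y (i, j) t = c i t * t (i, j)) \<and>
    (\<forall>k t. k < r \<longrightarrow> Max (A k) < m \<longrightarrow> g k (\<lambda>i j. Y (i, j) t) = 0)"
proof -
  have A: "A k \<noteq> {} \<and> finite (A k)" and g: "multilinear_on (A k) n (g k)" if "k < r" for k
    using slots that by auto
  show ?thesis
proof (induction m)
  case 0
  then show ?case by (intro exI[of _ "{}"]) auto
next
  case (Suc m)
  let ?I = "Sigma {..<m} (\<lambda>i. {..<n i})" and ?I' = "Sigma {..<Suc m} (\<lambda>i. {..<n i})"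
  obtain P Y c where P: "P \<subseteq> ?I" "card P \<le> card {k. k < r \<and> Max (A k) < m}"
    and c: "\<forall>i<m. c i \<in> pf ?I \<and> (\<exists>t. c i t \<noteq> 0)" and Y: "\<forall>v\<in>?I. Y v \<in> pf ?I"
    and Xc: "\<forall>(i, j)\<in>?I - P. \<forall>t. Y (i, j) t = c i t * t (i, j)"
    and gX: "\<forall>k t. k < r \<longrightarrow> Max (A k) < m \<longrightarrow> g k (\<lambda>i j. Y (i, j) t) = 0"
    using Suc.IH by (elim exE conjE) (rule that)
  define Rw where "Rw = {k. k < r \<and> Max (A k) = m}"
  \<comment> \<open>Coefficient of coordinate \<open>j\<close> of argument \<open>m\<close> in
    equation \<open>k\<close>, with the earlier arguments already substituted.\<close>
  define a where "a = (\<lambda>k j t. g k ((\<lambda>i j. Y (i, j) t)(m := unit_vec j)))"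
  have II': "?I \<subseteq> ?I'" by auto
  have a: "a k j \<in> pf ?I'" if "k \<in> Rw" "j \<in> {..<n m}" for k j
    unfolding a_def
  proof (rule multilinear_on_pf[OF g])
    show "k < r" "finite (A k)" using that A by (auto simp: Rw_def)
    fix i j' assume ij: "i \<in> A k" "j' < n i"
    then have "i \<le> m" using that A by (metis (mono_tags, lifting) Max_ge Rw_def mem_Collect_eq)
    show "(\<lambda>t. ((\<lambda>i j. Y (i, j) t)(m := unit_vec j)) i j') \<in> pf ?I'"
    proof (cases "i = m")
      case True
      then show ?thesis by (simp add: pf_const)
    next
      case False
      then have "Y (i, j') \<in> pf ?I" using Y ij \<open>i \<le> m\<close> by auto
      then show ?thesis using False pf_mono[OF _ II'] by simp
    qed
  qed
  have fRw: "finite Rw" by (simp add: Rw_def)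
  have a': "\<forall>k\<in>Rw. \<forall>j\<in>{..<n m}. a k j \<in> pf ?I'" using a by blast
  obtain Q b s where Q: "Q \<subseteq> {..<n m}" "card Q \<le> card Rw" "b \<in> pf ?I'" and
    x: "\<forall>u. (\<forall>j\<in>{..<n m}. u j \<in> pf ?I') \<longrightarrow> (\<exists>x. (\<forall>j\<in>{..<n m}. x j \<in> pf ?I') \<and>
      (\<forall>j\<in>{..<n m} - Q. \<forall>t. x j t = b t * u j t) \<and> (\<forall>i\<in>Rw. \<forall>t. (\<Sum>j\<in>{..<n m}. a i j t * x j t) = 0))"
    and b: "b s \<noteq> 0"
    using pf_elimination[OF inf fRw finite_lessThan[of "n m"] a'] by (elim exE conjE) (rule that)
  \<comment> \<open>The free entries of argument \<open>m\<close> are new parameters, named after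
    the coordinates themselves.\<close>
  have "\<forall>j\<in>{..<n m}. (\<lambda>t. t (m, j)) \<in> pf ?I'" by (auto intro: pf_var)
  then obtain x where x: "\<forall>j<n m. x j \<in> pf ?I'" "\<forall>j\<in>{..<n m} - Q. \<forall>t. x j t = b t * t (m, j)"
     "\<forall>i\<in>Rw. \<forall>t. (\<Sum>j\<in>{..<n m}. a i j t * x j t) = 0"
    using spec[OF x, of "\<lambda>j t. t (m, j)"] by auto
  define Y' where "Y' = (\<lambda>(i, j). if i = m then x j else Y (i, j))"
  define P' where "P' = P \<union> Pair m ` Q"
  have Y'_eq: "(\<lambda>i j. Y' (i, j) t) = (\<lambda>i j. Y (i, j) t)(m := (\<lambda>j. x j t))" for t
    by (auto simp: Y'_def fun_eq_iff)
  have fQ: "finite Q" using Q finite_subset by blast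
  have "card P' \<le> card P + card Q"
    unfolding P'_def using card_Un_le[of P "Pair m ` Q"] card_image_le[OF fQ, of "Pair m"] by linarith
  also have "\<dots> \<le> card {k. k < r \<and> Max (A k) < m} + card Rw" using P Q by simp
  also have "\<dots> = card ({k. k < r \<and> Max (A k) < m} \<union> Rw)"
    by (rule card_Un_disjoint[symmetric]) (auto simp: Rw_def)
  also have "{k. k < r \<and> Max (A k) < m} \<union> Rw = {k. k < r \<and> Max (A k) < Suc m}"
    by (auto simp: Rw_def)
  finally have r2: "card P' \<le> card {k. k < r \<and> Max (A k) < Suc m}" .
  have r1: "P' \<subseteq> ?I'" using P Q II' by (auto simp: P'_def)
  have r3: "\<forall>i<Suc m. (c(m := b)) i \<in> pf ?I' \<and> (\<exists>t. (c(m := b)) i t \<noteq> 0)"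
    using c Q(3) b pf_mono[OF _ II'] by (auto simp: less_Suc_eq)
  have r4: "\<forall>v\<in>?I'. Y' v \<in> pf ?I'"
  proof (rule ballI)
    fix v assume "v \<in> ?I'"
    then obtain i j where v: "v = (i, j)" "i \<le> m" "j < n i" by auto
    show "Y' v \<in> pf ?I'"
    proof (cases "i = m")
      case True
      then show ?thesis using x(1) v by (simp add: Y'_def)
    next
      case False
      then have "Y v \<in> pf ?I" using v by (intro bspec[OF Y]) simp
      then have "Y v \<in> pf ?I'" using pf_mono[OF _ II'] by blast
      then show ?thesis using False v by (simp add: Y'_def)
    qed
  qed
  have r5: "\<forall>(i, j)\<in>?I' - P'. \<forall>t. Y' (i, j) t = (c(m := b)) i t * t (i, j)"
    using Xc x(2) by (force simp: Y'_def P'_def less_Suc_eq)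
  have r6: "g k (\<lambda>i j. Y' (i, j) t) = 0" if k: "k < r" "Max (A k) < Suc m" for k t
  proof (cases "Max (A k) = m")
    case True
    then have "m \<in> A k" using A[OF k(1)] Max_in by metis
    then have "g k (\<lambda>i j. Y' (i, j) t) = (\<Sum>j<n m. x j t * a k j t)"
      unfolding Y'_eq a_def by (intro multilinear_on_slot[OF g[OF k(1)]])
    then show ?thesis using x(3) True k by (simp add: Rw_def mult.commute)
  next
    case False
    then have "m \<notin> A k" using A[OF k(1)] k Max_ge by (metis less_Suc_eq not_less)
    then have "g k (\<lambda>i j. Y' (i, j) t) = g k (\<lambda>i j. Y (i, j) t)"
      unfolding Y'_eq by (intro multilinear_on_cong[OF g[OF k(1)]]) auto
    then show ?thesis using gX k False by simp
  qed
  from r6 have r7: "\<forall>k t. k < r \<longrightarrow> Max (A k) < Suc m \<longrightarrow> g k (\<lambda>i j. Y' (i, j) t) = 0" by blast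
  show ?case
    by (intro exI[of _ P'] exI[of _ Y'] exI[of _ "c(m := b)"] conjI) (fact r1 r2 r3 r4 r5 r7)+
qed
qed

section \<open>The chain obtained from a partition rank decomposition\<close>

lemma finite_ar_index: "finite (ar_index d n)"
  by (simp add: ar_index_def)

text \<open>The last argument belongs to only one of the two complementary sets; the factor on the
  other set is kept.\<close>

lemma pr_one_factor:
  assumes "pr_one d n f" "d \<ge> 1"
  shows "\<exists>A g h. A \<noteq> {} \<and> A \<subseteq> {..<d-1} \<and> multilinear_on A n g \<and> f = (\<lambda>x. g x * h x)"
proof -
  obtain A g h where A: "A \<noteq> {}" "A \<subset> {..<d}" "multilinear_on A n g"
    "multilinear_on ({..<d} - A) n h" "f = (\<lambda>x. g x * h x)"
    using assms unfolding pr_one_def by blast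
  show ?thesis
  proof (cases "d - 1 \<in> A")
    case True
    have "x < d - 1" if "x < d" "x \<notin> A" for x
      using that True by (cases "x = d - 1") auto
    then have "{..<d} - A \<subseteq> {..<d-1}" by auto
    moreover have "{..<d} - A \<noteq> {}" using A by blast
    moreover have "f = (\<lambda>x. h x * g x)" using A(5) by (simp add: mult.commute)
    ultimately show ?thesis using A(4) by metis
  next
    case False
    have "x < d - 1" if "x \<in> A" for x
      using that False A(2) by (cases "x = d - 1") auto
    then show ?thesis using A by (metis lessThan_iff subsetI)
  qed
qed

text \<open>\<open>f\<close> vanishes wherever one chosen factor of every summand does. These are
  \<open>length gs\<close> multilinear equations in the first \<open>d - 1\<close> arguments, and
  solving them costs at most that many coordinates.\<close>

lemma partition_chain:
  fixes f :: "(nat \<Rightarrow> nat \<Rightarrow> 'k::field) \<Rightarrow> 'k"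
  assumes d: "d \<ge> 1" and inf: "infinite (UNIV :: 'k set)"
    and gs: "\<forall>g\<in>set gs. pr_one d n g" and f: "f = (\<lambda>x. \<Sum>g\<leftarrow>gs. g x)"
  shows "\<exists>C m. card (ar_index d n) - length gs \<le> m \<and>
    (\<forall>i\<le>m. zariski_irreducible (ar_index d n) (C i) \<and>
        C i \<subseteq> zariski_closure_K (ar_index d n) (Z_F d n f)) \<and> (\<forall>i<m. C i \<subset> C (Suc i))"
proof -
  let ?I = "ar_index d n" and ?r = "length gs"
  have "\<forall>k<?r. \<exists>A g h. A \<noteq> {} \<and> A \<subseteq> {..<d-1} \<and> multilinear_on A n g \<and> gs ! k = (\<lambda>x. g x * h x)"
    using gs nth_mem by (intro allI impI pr_one_factor[OF _ d]) blast
  then obtain A g h where *: "\<forall>k<?r. A k \<noteq> {} \<and> A k \<subseteq> {..<d-1} \<and>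
      multilinear_on (A k) n (g k) \<and> gs ! k = (\<lambda>x. g k x * h k x)"
    unfolding choice_iff' by (elim exE) (rule that)
  have A: "A k \<noteq> {} \<and> A k \<subseteq> {..<d-1}" and g: "multilinear_on (A k) n (g k)"
    and gh: "gs ! k = (\<lambda>x. g k x * h k x)" if "k < ?r" for k
    using spec[OF *, of k] that by (elim impE conjE; blast)+
  have A': "A k \<noteq> {} \<and> finite (A k)" if "k < ?r" for k
    using A[OF that] finite_subset by auto
  have slots: "\<forall>k<?r. A k \<noteq> {} \<and> finite (A k) \<and> multilinear_on (A k) n (g k)"
    using A' g by blast
  have mx: "Max (A k) < d - 1" if "k < ?r" for k
    using A[OF that] A'[OF that] Max_in by blast
  obtain P Y c where P: "P \<subseteq> ?I" "card P \<le> card {k. k < ?r \<and> Max (A k) < d - 1}"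
    and c: "\<forall>i<d-1. c i \<in> pf ?I \<and> (\<exists>t. c i t \<noteq> 0)" and Y: "\<forall>v\<in>?I. Y v \<in> pf ?I"
    and Xc: "\<forall>(i, j)\<in>?I - P. \<forall>t. Y (i, j) t = c i t * t (i, j)"
    and gX: "\<forall>k t. k < ?r \<longrightarrow> Max (A k) < d - 1 \<longrightarrow> g k (\<lambda>i j. Y (i, j) t) = 0"
    using multilinear_tower[OF inf slots, of "d - 1", folded ar_index_def]
    by (elim exE conjE) (rule that)
  have "{k. k < ?r \<and> Max (A k) < d - 1} = {..<?r}" using mx by auto
  then have cardP: "card P \<le> ?r" using P(2) by simp
  define G where "G = (\<lambda>t. \<Prod>i<d-1. c i t)"
  have G: "G \<in> pf ?I" unfolding G_def using c by (intro pf_prod) auto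
  have "\<exists>t. (\<Prod>i<m. c i t) \<noteq> 0" if "m \<le> d - 1" for m
    using that
  proof (induction m)
    case (Suc m)
    then have m: "m < d - 1" by simp
    have Q: "(\<lambda>t. \<Prod>i<m. c i t) \<in> pf ?I" using c m by (intro pf_prod) auto
    obtain s where "(\<Prod>i<m. c i s) \<noteq> 0" using Suc by auto
    moreover obtain t where "c m t \<noteq> 0" using c m by blast
    moreover have "c m \<in> pf ?I" using c m by blast
    ultimately show ?case
      using pf_no_zero_divisors[OF inf Q] by (simp only: prod.lessThan_Suc mult_eq_0_iff de_Morgan_disj)
  qed auto
  then obtain t0 where t0: "G t0 \<noteq> 0" unfolding G_def by blast
  \<comment> \<open>Argument \<open>i\<close> has denominator \<open>c i\<close>; multiplying by the
    other denominators gives the common denominator \<open>G\<close> that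
    \<open>rational_parametrization_chain\<close> expects.\<close>
  define u where "u = (\<lambda>(i, j) t. Y (i, j) t * (\<Prod>i'\<in>{..<d-1} - {i}. c i' t))"
  have Gi: "G t = c i t * (\<Prod>i'\<in>{..<d-1} - {i}. c i' t)" if "i < d - 1" for i t
    unfolding G_def using that by (intro prod.remove) auto
  have u: "u v \<in> pf ?I" if "v \<in> ?I" for v
    using that Y c by (cases v) (auto simp: u_def intro!: pf_mult pf_prod)
  have uG: "u v t = G t * t v" if vP: "v \<in> ?I - P" for v t
  proof -
    obtain i j where v: "v = (i, j)" "i < d - 1" using vP by (cases v) (auto simp: ar_index_def)
    then have "Y (i, j) t = c i t * t (i, j)" using bspec[OF Xc vP] by simp
    then show ?thesis using Gi[of i t] v by (simp add: u_def)
  qed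
  have Z: "(\<lambda>v. if v \<in> ?I then u v t / G t else 0) \<in> Z_F d n f" if t: "G t \<noteq> 0" for t
  proof -
    let ?\<phi> = "\<lambda>v. if v \<in> ?I then u v t / G t else 0"
    have "f (\<lambda>i j. if i = d - 1 then w j else ?\<phi> (i, j)) = 0" for w
    proof -
      let ?y = "\<lambda>i j. if i = d - 1 then w j else ?\<phi> (i, j)"
      have "g k ?y = 0" if k: "k < ?r" for k
      proof -
        \<comment> \<open>Dividing argument \<open>i\<close> by \<open>c i\<close> only multiplies
          the value of a multilinear function by a constant, so it stays zero.\<close>
        have "g k ?y = g k (\<lambda>i j. inverse (c i t) * Y (i, j) t)"
        proof (rule multilinear_on_cong[OF g[OF k]])
          fix i j assume ij: "i \<in> A k" "j < n i"
          then have "i < d - 1" using A[OF k] by auto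
          moreover have "(\<Prod>i'\<in>{..<d-1} - {i}. c i' t) \<noteq> 0" "c i t \<noteq> 0"
            using t Gi[of i t] calculation by auto
          ultimately show "?y i j = inverse (c i t) * Y (i, j) t"
            using ij Gi[of i t] by (auto simp: ar_index_def u_def field_simps)
        qed
        also have "\<dots> = (\<Prod>i\<in>A k. inverse (c i t)) * g k (\<lambda>i j. Y (i, j) t)"
          using A'[OF k] by (intro multilinear_on_scale[OF g[OF k]]) auto
        also have "\<dots> = 0" using gX k mx[OF k] by simp
        finally show ?thesis .
      qed
      moreover define y where "y = ?y"
      ultimately have gy: "(gs ! k) y = 0" if "k < ?r" for k using that gh by simp
      have "(\<Sum>g\<leftarrow>gs. g y) = (\<Sum>k<?r. (gs ! k) y)"
        by (simp add: sum_list_sum_nth atLeast0LessThan)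
      also have "\<dots> = 0" using gy by simp
      finally have "f y = 0" unfolding f .
      then show ?thesis unfolding y_def .
    qed
    then show ?thesis unfolding Z_F_def aff_def by auto
  qed
  have "\<exists>C. (\<forall>i\<le>card (?I - P). zariski_irreducible ?I (C i) \<and> C i \<subseteq> zariski_closure_K ?I (Z_F d n f)) \<and>
             (\<forall>i<card (?I - P). C i \<subset> C (Suc i))"
    by (rule rational_parametrization_chain[OF inf _ _ G t0 u uG Z]) (auto simp: finite_ar_index)
  moreover have "card ?I - ?r \<le> card (?I - P)"
    using P(1) cardP finite_ar_index by (metis card_Diff_subset diff_le_mono2 finite_subset)
  ultimately show ?thesis by blast
qed

section \<open>Chains of irreducible sets yield free coordinates\<close>

text \<open>Algebraic independence of the coordinates \<open>J\<close> on \<open>S\<close>: the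
  projection of \<open>S\<close> to them is Zariski dense.\<close>

definition free_on :: "'v set \<Rightarrow> ('v \<Rightarrow> 'k::field) set \<Rightarrow> bool" where
  "free_on J S \<longleftrightarrow> (\<forall>q\<in>pf J. (\<forall>s\<in>S. q s = 0) \<longrightarrow> (\<forall>y. q y = 0))"

section \<open>Standard monomials and the Hilbert function\<close>

text \<open>Degree comes first so that reduction never raises it. Ties are broken by the order on
  exponent maps, which is compatible with addition.\<close>

definition deglex_less :: "('v::linorder \<Rightarrow>\<^sub>0 nat) \<Rightarrow> ('v \<Rightarrow>\<^sub>0 nat) \<Rightarrow> bool" where
  "deglex_less a b \<longleftrightarrow> (mdeg a, a) < (mdeg b, b)"

text \<open>The monomials that are not leading monomials of the vanishing ideal of \<open>S\<close>,
  as in the theory of Groebner bases.\<close>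

definition standard :: "'v::linorder set \<Rightarrow> ('v \<Rightarrow> 'k::field) set \<Rightarrow> ('v \<Rightarrow>\<^sub>0 nat) \<Rightarrow> bool" where
  "standard I S a \<longleftrightarrow> \<not> (\<exists>A c. finite A \<and> (\<forall>b\<in>A. deglex_less b a \<and> Poly_Mapping.keys b \<subseteq> I) \<and>
      (\<forall>s\<in>S. mon a s = (\<Sum>b\<in>A. c b * mon b s)))"

definition monoms :: "'v set \<Rightarrow> nat \<Rightarrow> ('v \<Rightarrow>\<^sub>0 nat) set" where
  "monoms I E = {a. Poly_Mapping.keys a \<subseteq> I \<and> mdeg a \<le> E}"

text \<open>For finite \<open>I\<close> the cardinality is the affine Hilbert function of
  \<open>S\<close> at \<open>E\<close>.\<close>

definition std_monoms :: "'v::linorder set \<Rightarrow> ('v \<Rightarrow> 'k::field) set \<Rightarrow> nat \<Rightarrow> ('v \<Rightarrow>\<^sub>0 nat) set" where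
  "std_monoms I S E = {a \<in> monoms I E. standard I S a}"

lemma lookup_le_mdeg: "Poly_Mapping.lookup a v \<le> mdeg a"
proof (cases "v \<in> Poly_Mapping.keys a")
  case True
  then show ?thesis unfolding mdeg_def by (intro member_le_sum) auto
qed (simp add: in_keys_iff)

lemma restrict_lookup_inj: "inj_on (\<lambda>a. restrict (Poly_Mapping.lookup a) I) {a. Poly_Mapping.keys a \<subseteq> I}"
proof (rule inj_onI, rule poly_mapping_eqI)
  fix a b :: "'a \<Rightarrow>\<^sub>0 'b" and v
  assume *: "a \<in> {a. Poly_Mapping.keys a \<subseteq> I}" "b \<in> {a. Poly_Mapping.keys a \<subseteq> I}"
    "restrict (Poly_Mapping.lookup a) I = restrict (Poly_Mapping.lookup b) I"
  show "Poly_Mapping.lookup a v = Poly_Mapping.lookup b v"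
  proof (cases "v \<in> I")
    case True
    then show ?thesis using fun_cong[OF *(3), of v] by simp
  next
    case False
    then have "v \<notin> Poly_Mapping.keys a" "v \<notin> Poly_Mapping.keys b" using * by auto
    then show ?thesis by (simp add: in_keys_iff)
  qed
qed

lemma finite_monoms:
  assumes "finite I"
  shows "finite (monoms I E)"
proof -
  have "(\<lambda>a. restrict (Poly_Mapping.lookup a) I) ` monoms I E \<subseteq> PiE I (\<lambda>_. {..E})"
    by (auto simp: monoms_def intro: order_trans[OF lookup_le_mdeg])
  then have "finite ((\<lambda>a. restrict (Poly_Mapping.lookup a) I) ` monoms I E)"
    using finite_subset finite_PiE[OF assms, of "\<lambda>_. {..E}"] by blast
  then show ?thesis
    by (rule finite_imageD) (rule inj_on_subset[OF restrict_lookup_inj], auto simp: monoms_def)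
qed

lemma deglex_less_add: "deglex_less a b \<Longrightarrow> deglex_less (a + c) (b + c)"
  by (auto simp: deglex_less_def mdeg_add intro: add_strict_right_mono)

lemma deglex_less_mdeg: "deglex_less a b \<Longrightarrow> mdeg a \<le> mdeg b"
  by (auto simp: deglex_less_def)

text \<open>Leading monomials form an ideal: a relation may be multiplied by the monomial
  \<open>b\<close>.\<close>

lemma not_standard_add:
  assumes "\<not> standard I S a" "Poly_Mapping.keys b \<subseteq> I"
  shows "\<not> standard I S (a + b)"
proof -
  obtain A c where A: "finite A" "\<forall>x\<in>A. deglex_less x a \<and> Poly_Mapping.keys x \<subseteq> I"
    "\<forall>s\<in>S. mon a s = (\<Sum>x\<in>A. c x * mon x s)"
    using assms(1) unfolding standard_def by blast
  have inj: "inj_on (\<lambda>x. x + b) A" by (auto simp: inj_on_def)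
  have "mon (a + b) s = (\<Sum>x\<in>(\<lambda>x. x + b) ` A. c (x - b) * mon x s)" if "s \<in> S" for s
    using A(3) that by (simp add: sum.reindex[OF inj] mon_add sum_distrib_right mult.assoc)
  moreover have "\<forall>x\<in>(\<lambda>x. x + b) ` A. deglex_less x (a + b) \<and> Poly_Mapping.keys x \<subseteq> I"
    using A(2) assms(2) deglex_less_add by (force dest!: subsetD[OF keys_add])
  ultimately show ?thesis
    unfolding standard_def not_not using A(1)
    by (intro exI[of _ "(\<lambda>x. x + b) ` A"] exI[of _ "\<lambda>x. c (x - b)"]) simp
qed

text \<open>A nonzero polynomial relation in the variables \<open>J\<close> is solved for its
  leading monomial.\<close>

lemma not_free_imp_not_standard:
  assumes "\<not> free_on J S" "J \<subseteq> I"
  shows "\<exists>a. Poly_Mapping.keys a \<subseteq> J \<and> \<not> standard I S a"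
proof -
  obtain q y where q: "q \<in> pf J" "\<forall>s\<in>S. q s = 0" "q y \<noteq> 0"
    using assms(1) unfolding free_on_def by blast
  obtain p where p: "poly_vars_in J p" "peval id p = q" using pf_formal[OF q(1)] by blast
  let ?K = "Poly_Mapping.keys p"
  have q_eq: "q x = (\<Sum>m\<in>?K. Poly_Mapping.lookup p m * mon m x)" for x
    using p(2) peval_mon[of id p x] by simp
  have "?K \<noteq> {}" using q(3) q_eq[of y] by auto
  then have "Max ((\<lambda>a. (mdeg a, a)) ` ?K) \<in> (\<lambda>a. (mdeg a, a)) ` ?K"
    by (intro Max_in) auto
  then obtain a where a: "a \<in> ?K" "(mdeg a, a) = Max ((\<lambda>a. (mdeg a, a)) ` ?K)" by force
  have less: "deglex_less b a" if "b \<in> ?K - {a}" for b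
  proof -
    have "(mdeg b, b) \<le> (mdeg a, a)" unfolding a(2) using that by (intro Max_ge) auto
    then show ?thesis using that unfolding deglex_less_def by (auto simp: less_le)
  qed
  let ?la = "Poly_Mapping.lookup p a"
  have la: "?la \<noteq> 0" using a(1) by (simp add: in_keys_iff)
  have "mon a s = (\<Sum>b\<in>?K - {a}. (- Poly_Mapping.lookup p b / ?la) * mon b s)" if "s \<in> S" for s
  proof -
    have "?la * mon a s + (\<Sum>b\<in>?K - {a}. Poly_Mapping.lookup p b * mon b s) = 0"
      using q(2) that q_eq[of s] sum.remove[OF finite_keys a(1), of "\<lambda>m. Poly_Mapping.lookup p m * mon m s"]
      by simp
    then have "mon a s = - (\<Sum>b\<in>?K - {a}. Poly_Mapping.lookup p b * mon b s) / ?la"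
      using la by (simp add: field_simps add_eq_0_iff)
    then show ?thesis by (simp add: sum_negf sum_divide_distrib)
  qed
  moreover have "\<forall>b\<in>?K - {a}. deglex_less b a \<and> Poly_Mapping.keys b \<subseteq> I"
    using less p(1) assms(2) by (auto simp: poly_vars_in_def)
  ultimately have "\<not> standard I S a"
    unfolding standard_def not_not
    by (intro exI[of _ "?K - {a}"] exI[of _ "\<lambda>b. - Poly_Mapping.lookup p b / ?la"]) simp
  then show ?thesis using p(1) a(1) by (auto simp: poly_vars_in_def)
qed

text \<open>Rewriting by smaller monomials terminates because the finite number of smaller monomials
  of degree at most \<open>E\<close> drops.\<close>

lemma mon_reduce:
  fixes S :: "('v::linorder \<Rightarrow> 'k::field) set"
  assumes I: "finite I"
  shows "a \<in> monoms I E \<Longrightarrow> \<exists>c. \<forall>s\<in>S. mon a s = (\<Sum>b\<in>std_monoms I S E. c b * mon b s)"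
proof (induction "card {b \<in> monoms I E. deglex_less b a}" arbitrary: a rule: less_induct)
  case less
  have fin: "finite (std_monoms I S E)"
    using finite_monoms[OF I] by (simp add: std_monoms_def)
  show ?case
  proof (cases "standard I S a")
    case True
    then have a: "a \<in> std_monoms I S E" using less by (simp add: std_monoms_def)
    have "mon a s = (\<Sum>b\<in>std_monoms I S E. (if b = a then 1 else 0) * mon b s)" for s :: "'v \<Rightarrow> 'k"
      using sum.delta[OF fin, of a "\<lambda>b. mon b s"] a by (simp add: if_distrib[of "\<lambda>x. x * _"] cong: if_cong)
    then show ?thesis by (intro exI[of _ "\<lambda>b. if b = a then 1 else 0"] ballI)
  next
    case False
    then obtain A c where A: "finite A" "\<forall>x\<in>A. deglex_less x a \<and> Poly_Mapping.keys x \<subseteq> I"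
      "\<forall>s\<in>S. mon a s = (\<Sum>x\<in>A. c x * mon x s)"
      unfolding standard_def by blast
    have "\<exists>e. \<forall>s\<in>S. mon x s = (\<Sum>b\<in>std_monoms I S E. e b * mon b s)" if x: "x \<in> A" for x
    proof (rule less.hyps)
      have x': "deglex_less x a" "Poly_Mapping.keys x \<subseteq> I" using A x by auto
      show xm: "x \<in> monoms I E"
        using x' less.prems deglex_less_mdeg[OF x'(1)] by (auto simp: monoms_def)
      have "{b \<in> monoms I E. deglex_less b x} \<subset> {b \<in> monoms I E. deglex_less b a}"
        using x' xm unfolding deglex_less_def by (auto simp del: less_prod_simp intro: less_trans)
      then show "card {b \<in> monoms I E. deglex_less b x} < card {b \<in> monoms I E. deglex_less b a}"
        using finite_monoms[OF I] by (intro psubset_card_mono) auto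
    qed
    then have "\<forall>x\<in>A. \<exists>e. \<forall>s\<in>S. mon x s = (\<Sum>b\<in>std_monoms I S E. e b * mon b s)" by blast
    then obtain e where e: "\<forall>x\<in>A. \<forall>s\<in>S. mon x s = (\<Sum>b\<in>std_monoms I S E. e x b * mon b s)"
      by (elim bchoice[THEN exE])
    have "mon a s = (\<Sum>b\<in>std_monoms I S E. (\<Sum>x\<in>A. c x * e x b) * mon b s)" if "s \<in> S" for s
    proof -
      have "mon a s = (\<Sum>x\<in>A. c x * (\<Sum>b\<in>std_monoms I S E. e x b * mon b s))"
        using A(3) that e by simp
      also have "\<dots> = (\<Sum>x\<in>A. \<Sum>b\<in>std_monoms I S E. c x * e x b * mon b s)"
        by (simp add: sum_distrib_left mult.assoc)
      also have "\<dots> = (\<Sum>b\<in>std_monoms I S E. \<Sum>x\<in>A. c x * e x b * mon b s)"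
        by (rule sum.swap)
      finally show ?thesis by (simp add: sum_distrib_right)
    qed
    then show ?thesis by (intro exI[of _ "\<lambda>b. \<Sum>x\<in>A. c x * e x b"] ballI)
  qed
qed

text \<open>The relation has coefficients in the small field and is therefore one of the equations
  that define the closure.\<close>

lemma closure_relation:
  assumes y: "y \<in> zariski_closure_K I S" and A: "finite A" "\<forall>b\<in>A. Poly_Mapping.keys b \<subseteq> I"
    and rel: "\<forall>s\<in>S. (\<Sum>b\<in>A. c b * mon b s) = 0"
  shows "(\<Sum>b\<in>A. to_ac (c b) * mon b y) = 0"
proof -
  define p where "p = (\<Sum>b\<in>A. Poly_Mapping.single b (c b))"
  have peval_p: "peval \<phi> p x = (\<Sum>b\<in>A. \<phi> (c b) * mon b x)"
    if "\<phi> 0 = 0" "\<And>a b. \<phi> (a + b) = \<phi> a + \<phi> b" for \<phi> :: "'b \<Rightarrow> 'c::field" and x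
    unfolding p_def using A(1)
    by (induction A rule: finite_induct) (simp_all add: that peval_add[of \<phi>] peval_single, simp add: peval_def)
  have "poly_vars_in I p"
    unfolding p_def using A
    by (induction A rule: finite_induct) (auto simp: poly_vars_in_def dest!: subsetD[OF keys_add] split: if_splits)
  moreover have "\<forall>s\<in>S. peval id p s = 0"
    using rel peval_p[of id] by simp
  ultimately have "peval to_ac p y = 0"
    using y by (auto simp: zariski_closure_K_def)
  then show ?thesis using peval_p[of to_ac] by simp
qed

text \<open>The coefficients of \<open>q\<close> lie in the algebraic closure, but each monomial is
  reduced by relations over the small field. Hence the Hilbert function of \<open>S\<close> also
  bounds the functions on the closure.\<close>

lemma pfd_reduce_on_closure:
  assumes I: "finite I" and "q \<in> pfd I E"
  shows "\<exists>c. \<forall>y\<in>zariski_closure_K I S. q y = (\<Sum>b\<in>std_monoms I S E. c b * mon b y)"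
  using assms(2)
proof (induction rule: pfd.induct)
  case (mon a d)
  have fin: "finite (monoms I E)" using finite_monoms[OF I] .
  have sub: "std_monoms I S E \<subseteq> monoms I E" by (auto simp: std_monoms_def)
  have a: "a \<in> monoms I E" using mon by (simp add: monoms_def)
  then obtain c where c: "\<forall>s\<in>S. mon a s = (\<Sum>b\<in>std_monoms I S E. c b * mon b s)"
    using mon_reduce[OF I] by blast
  \<comment> \<open>The reduction of \<open>mon a\<close>, rewritten as a relation with coefficients
    on all of \<open>monoms I E\<close>, so that \<open>split\<close> can evaluate it over both
    fields.\<close>
  define c' where "c' b = (if b = a then 1 else 0) - (if b \<in> std_monoms I S E then c b else 0)" for b
  have split: "(\<Sum>b\<in>monoms I E. \<phi> (c' b) * mon b x) = mon a x - (\<Sum>b\<in>std_monoms I S E. \<phi> (c b) * mon b x)"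
    if \<phi>: "\<And>a b. \<phi> (a - b) = \<phi> a - \<phi> b" "\<phi> 1 = 1" for \<phi> :: "'b \<Rightarrow> 'd::field" and x
  proof -
    have \<phi>0: "\<phi> 0 = 0" using \<phi>(1)[of 0 0] by simp
    have "(\<Sum>b\<in>monoms I E. \<phi> (c' b) * mon b x) =
        (\<Sum>b\<in>monoms I E. (if b = a then mon b x else 0) - (if b \<in> std_monoms I S E then \<phi> (c b) * mon b x else 0))"
      by (intro sum.cong) (auto simp: c'_def \<phi> \<phi>0 algebra_simps)
    also have "\<dots> = mon a x - (\<Sum>b\<in>monoms I E. if b \<in> std_monoms I S E then \<phi> (c b) * mon b x else 0)"
      using fin a by (simp add: sum_subtractf)
    also have "(\<Sum>b\<in>monoms I E. if b \<in> std_monoms I S E then \<phi> (c b) * mon b x else 0) =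
        (\<Sum>b\<in>std_monoms I S E. \<phi> (c b) * mon b x)"
      using fin sub by (simp add: sum.inter_restrict[symmetric] Int_absorb1)
    finally show ?thesis .
  qed
  have rel: "\<forall>s\<in>S. (\<Sum>b\<in>monoms I E. c' b * mon b s) = 0"
    using split[of "\<lambda>x. x"] c by simp
  have kI: "\<forall>b\<in>monoms I E. Poly_Mapping.keys b \<subseteq> I" by (auto simp: monoms_def)
  have "d * mon a y = (\<Sum>b\<in>std_monoms I S E. (d * to_ac (c b)) * mon b y)"
    if "y \<in> zariski_closure_K I S" for y
    using closure_relation[OF that fin kI rel] split[of to_ac y]
    by (simp add: sum_distrib_left mult.assoc)
  then show ?case by (intro exI[of _ "\<lambda>b. d * to_ac (c b)"] ballI)
next
  case (add p q)
  then obtain c d where "\<forall>y\<in>zariski_closure_K I S. p y = (\<Sum>b\<in>std_monoms I S E. c b * mon b y)"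
    "\<forall>y\<in>zariski_closure_K I S. q y = (\<Sum>b\<in>std_monoms I S E. d b * mon b y)" by blast
  then show ?case
    by (intro exI[of _ "\<lambda>b. c b + d b"]) (simp add: algebra_simps sum.distrib)
qed

text \<open>Each \<open>m\<close>-subset of the coordinates carries a nonstandard monomial, and
  \<open>b\<close> exceeds all exponents of these monomials. None of them divides a standard
  monomial, so fewer than \<open>m\<close> exponents of the latter reach \<open>b\<close>. Thus at
  most \<open>m - 1\<close> exponents range up to \<open>E\<close> and the others are
  bounded.\<close>

lemma card_std_monoms:
  fixes S :: "('v::linorder \<Rightarrow> 'k::field) set"
  assumes I: "finite I" and m: "m > 0" and nf: "\<And>J. J \<subseteq> I \<Longrightarrow> card J = m \<Longrightarrow> \<not> free_on J S"
  shows "\<exists>B. \<forall>E. card (std_monoms I S E) \<le> B * (E + 1) ^ (m - 1)"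
proof -
  let ?Js = "{J. J \<subseteq> I \<and> card J = m}"
  have fJs: "finite ?Js" using I by simp
  have "\<forall>J\<in>?Js. \<exists>a. Poly_Mapping.keys a \<subseteq> J \<and> \<not> standard I S a"
    using nf not_free_imp_not_standard by blast
  then obtain a where a: "\<forall>J\<in>?Js. Poly_Mapping.keys (a J) \<subseteq> J \<and> \<not> standard I S (a J)"
    by (elim bchoice[THEN exE])
  define b where "b = Suc (\<Sum>J\<in>?Js. mdeg (a J))"
  have ab: "Poly_Mapping.lookup (a J) v < b" if "J \<in> ?Js" for J v
  proof -
    have "mdeg (a J) \<le> (\<Sum>J\<in>?Js. mdeg (a J))" using that fJs by (intro member_le_sum) auto
    then show ?thesis using lookup_le_mdeg[of "a J" v] by (simp add: b_def)
  qed
  have few: "card {v\<in>I. b \<le> Poly_Mapping.lookup x v} < m"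
    if x: "standard I S x" "Poly_Mapping.keys x \<subseteq> I" for x
  proof (rule ccontr)
    assume "\<not> ?thesis"
    then have "m \<le> card {v\<in>I. b \<le> Poly_Mapping.lookup x v}" by simp
    then obtain J where J: "J \<subseteq> {v\<in>I. b \<le> Poly_Mapping.lookup x v}" "card J = m"
      by (rule obtain_subset_with_card_n)
    then have JJ: "J \<in> ?Js" by auto
    have le: "Poly_Mapping.lookup (a J) v \<le> Poly_Mapping.lookup x v" for v
    proof (cases "v \<in> J")
      case True
      then have "b \<le> Poly_Mapping.lookup x v" using J by auto
      then show ?thesis using ab[OF JJ, of v] by linarith
    next
      case False
      then have "v \<notin> Poly_Mapping.keys (a J)" using a JJ by blast
      then show ?thesis by (simp add: in_keys_iff)
    qed
    \<comment> \<open>\<open>a J\<close> divides \<open>x\<close>: on \<open>J\<close> the exponents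
      of \<open>x\<close> are at least \<open>b\<close>, elsewhere those of \<open>a J\<close> are
      0.\<close>
    have "a J + (x - a J) = x"
      by (rule poly_mapping_eqI) (simp add: lookup_add lookup_minus le)
    moreover have "Poly_Mapping.keys (x - a J) \<subseteq> I"
      using x(2) by (auto simp: in_keys_iff lookup_minus)
    ultimately show False
      using not_standard_add[of I S "a J" "x - a J"] a JJ x(1) by auto
  qed
  define B where "B = card (Pow I) * b ^ card I"
  have "card (std_monoms I S E) \<le> B * (E + 1) ^ (m - 1)" for E
  proof -
    \<comment> \<open>\<open>Q\<close> records the positions of the large exponents.\<close>
    let ?F = "\<lambda>Q. PiE I (\<lambda>v. if v \<in> Q then {..E} else {..<b})"
    let ?Qs = "{Q. Q \<subseteq> I \<and> card Q < m}"
    have fQs: "finite ?Qs" using I by simp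
    have "(\<lambda>x. restrict (Poly_Mapping.lookup x) I) ` std_monoms I S E \<subseteq> (\<Union>Q\<in>?Qs. ?F Q)"
    proof
      fix g assume "g \<in> (\<lambda>x. restrict (Poly_Mapping.lookup x) I) ` std_monoms I S E"
      then obtain x where x: "x \<in> std_monoms I S E" "g = restrict (Poly_Mapping.lookup x) I" by blast
      let ?Q = "{v\<in>I. b \<le> Poly_Mapping.lookup x v}"
      have "mdeg x \<le> E" using x by (simp add: std_monoms_def monoms_def)
      then have "Poly_Mapping.lookup x v \<le> E" for v
        by (rule order_trans[OF lookup_le_mdeg])
      then have gF: "g \<in> ?F ?Q"
        unfolding x(2) by (auto simp: not_le)
      have "card ?Q < m"
        by (rule few) (use x in \<open>auto simp: std_monoms_def monoms_def\<close>)
      then have "?Q \<in> ?Qs" by auto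
      then show "g \<in> (\<Union>Q\<in>?Qs. ?F Q)" using gF by (rule UN_I)
    qed
    then have "card ((\<lambda>x. restrict (Poly_Mapping.lookup x) I) ` std_monoms I S E) \<le> card (\<Union>Q\<in>?Qs. ?F Q)"
      using fQs I by (intro card_mono) (auto intro!: finite_PiE)
    moreover have "card ((\<lambda>x. restrict (Poly_Mapping.lookup x) I) ` std_monoms I S E) = card (std_monoms I S E)"
      by (rule card_image, rule inj_on_subset[OF restrict_lookup_inj]) (auto simp: std_monoms_def monoms_def)
    moreover have "card (\<Union>Q\<in>?Qs. ?F Q) \<le> (\<Sum>Q\<in>?Qs. card (?F Q))"
      by (rule card_UN_le[OF fQs])
    moreover have "card (?F Q) \<le> b ^ card I * (E + 1) ^ (m - 1)" if "Q \<in> ?Qs" for Q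
    proof -
      have Q: "Q \<subseteq> I" "card Q \<le> m - 1" using that by auto
      have b1: "1 \<le> b" by (simp add: b_def)
      have "card (?F Q) = (\<Prod>v\<in>I. if v \<in> Q then E + 1 else b)"
        using I by (subst card_PiE) (auto intro!: prod.cong)
      also have "\<dots> = (\<Prod>v\<in>Q. E + 1) * (\<Prod>v\<in>I - Q. b)"
        using prod.subset_diff[OF Q(1) I, of "\<lambda>v. if v \<in> Q then E + 1 else b"]
        by (simp add: mult.commute)
      also have "\<dots> = (E + 1) ^ card Q * b ^ card (I - Q)" by simp
      also have "\<dots> \<le> (E + 1) ^ (m - 1) * b ^ card I"
        using Q I b1 by (intro mult_mono power_increasing card_mono) auto
      finally show ?thesis by (simp add: mult.commute)
    qed
    then have "(\<Sum>Q\<in>?Qs. card (?F Q)) \<le> card ?Qs * (b ^ card I * (E + 1) ^ (m - 1))"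
      using sum_bounded_above[of ?Qs "\<lambda>Q. card (?F Q)" "b ^ card I * (E + 1) ^ (m - 1)"] by simp
    moreover have "card ?Qs \<le> card (Pow I)" using I by (intro card_mono) auto
    then have "card ?Qs * (b ^ card I * (E + 1) ^ (m - 1)) \<le> B * (E + 1) ^ (m - 1)"
      unfolding B_def by (simp add: mult.assoc mult_le_mono1)
    ultimately show ?thesis by linarith
  qed
  then show ?thesis by blast
qed

section \<open>Independent products of powers along a chain\<close>

text \<open>The list holds exponents in descending order of index: its head belongs to the
  \<open>q\<close> numbered by the length of the tail, so prepending an exponent brings in the next
  function.\<close>

fun power_product :: "(nat \<Rightarrow> ('v \<Rightarrow> 'b::comm_ring_1) \<Rightarrow> 'b) \<Rightarrow> nat list \<Rightarrow> ('v \<Rightarrow> 'b) \<Rightarrow> 'b" where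
  "power_product q [] y = 1"
| "power_product q (l # ls) y = q (length ls) y ^ l * power_product q ls y"

abbreviation exponents :: "nat \<Rightarrow> nat \<Rightarrow> nat list set" where
  "exponents D i \<equiv> {ls. set ls \<subseteq> {..<D} \<and> length ls = i}"

lemma exponents_Suc: "exponents D (Suc i) = (\<lambda>(l, ls). l # ls) ` ({..<D} \<times> exponents D i)"
  by (auto simp: length_Suc_conv image_iff)

lemma power_product_pfd:
  assumes "\<And>i. i < length ls \<Longrightarrow> q i \<in> pfd I e" "set ls \<subseteq> {..<D}"
  shows "power_product q ls \<in> pfd I (length ls * (D * e))"
  using assms
proof (induction ls)
  case Nil
  then show ?case using pfd_const[of 1 I 0] by (simp add: fun_eq_iff[symmetric] flip: power_product.simps(1)[of q])
next
  case (Cons l ls)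
  have "(\<lambda>y. q (length ls) y ^ l) \<in> pfd I (l * e)" using Cons.prems by (intro pfd_power) auto
  then have "(\<lambda>y. q (length ls) y ^ l) \<in> pfd I (D * e)"
    using Cons.prems by (elim pfd_mono) (auto intro: mult_le_mono1)
  then have "(\<lambda>y. q (length ls) y ^ l * power_product q ls y) \<in> pfd I (D * e + length ls * (D * e))"
    using Cons by (intro pfd_mult) auto
  then show ?case by (simp add: power_product.simps(2)[abs_def] fun_eq_iff[symmetric])
qed

text \<open>Each \<^term>\<open>q i\<close> vanishes on \<^term>\<open>C i\<close> but not on \<^term>\<open>C (Suc i)\<close>. Dividing a relation on
  \<^term>\<open>C (Suc i)\<close> by the largest possible power of \<^term>\<open>q i\<close> and restricting it to \<^term>\<open>C i\<close>
  gives a relation between the earlier functions.\<close>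

lemma power_product_independent:
  fixes C :: "nat \<Rightarrow> ('v \<Rightarrow> 'L::field) set"
  assumes irr: "\<And>i. i \<le> m \<Longrightarrow> zariski_irreducible I (C i)" and sub: "\<And>i. i < m \<Longrightarrow> C i \<subseteq> C (Suc i)"
    and q: "\<And>i. i < m \<Longrightarrow> q i \<in> pf I \<and> (\<forall>y\<in>C i. q i y = 0) \<and> (\<exists>y\<in>C (Suc i). q i y \<noteq> 0)"
  shows "i \<le> m \<Longrightarrow> \<forall>y\<in>C i. (\<Sum>ls\<in>exponents D i. c ls * power_product q ls y) = 0 \<Longrightarrow>
    \<forall>ls\<in>exponents D i. c ls = 0"
proof (induction i arbitrary: c)
  case 0
  obtain y where "y \<in> C 0" using irr[of 0] unfolding zariski_irreducible_def by auto
  moreover have "exponents D 0 = {[]}" by auto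
  ultimately show ?case using 0 by auto
next
  case (Suc i)
  have i: "i < m" using Suc by simp
  have inj: "inj_on (\<lambda>(l, ls). l # ls) ({..<D} \<times> exponents D i)" by (auto simp: inj_on_def)
  have fin: "finite (exponents D i)" by (rule finite_lists_length_eq) simp
  \<comment> \<open>The relation is sorted by the exponent of the last function \<open>q i\<close>;
    \<open>G l\<close> is the coefficient of its \<open>l\<close>-th power.\<close>
  define G where "G l y = (\<Sum>ls\<in>exponents D i. c (l # ls) * power_product q ls y)" for l y
  have rel: "(\<Sum>l<D. q i y ^ l * G l y) = 0" if "y \<in> C (Suc i)" for y
  proof -
    have "0 = (\<Sum>ls\<in>exponents D (Suc i). c ls * power_product q ls y)" using Suc.prems that by simp
    also have "\<dots> = (\<Sum>(l, ls)\<in>{..<D} \<times> exponents D i. c (l # ls) * power_product q (l # ls) y)"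
      unfolding exponents_Suc by (subst sum.reindex[OF inj]) (simp add: case_prod_unfold comp_def del: power_product.simps)
    also have "\<dots> = (\<Sum>l<D. \<Sum>ls\<in>exponents D i. c (l # ls) * power_product q (l # ls) y)"
      by (simp only: sum.cartesian_product)
    also have "\<dots> = (\<Sum>l<D. q i y ^ l * G l y)"
      unfolding G_def sum_distrib_left by (intro sum.cong) auto
    finally show ?thesis by simp
  qed
  have Gpf: "G l \<in> pf I" for l
  proof -
    have "power_product q ls \<in> pf I" if ls: "length ls \<le> i" for ls
      using ls
    proof (induction ls)
      case Nil
      then show ?case using pf_const[of 1 I] by (simp add: fun_eq_iff[symmetric] flip: power_product.simps(1)[of q])
    next
      case (Cons l ls)
      then have "(\<lambda>y. q (length ls) y ^ l * power_product q ls y) \<in> pf I"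
        using q i by (intro pf_mult pf_power) auto
      then show ?case by (simp add: power_product.simps(2)[abs_def] fun_eq_iff[symmetric])
    qed
    then have "(\<lambda>y. \<Sum>ls\<in>exponents D i. c (l # ls) * power_product q ls y) \<in> pf I"
      by (intro pf_sum pf_cmult) auto
    then show ?thesis by (simp add: G_def[abs_def])
  qed
  have zero: "\<forall>ls\<in>exponents D i. c (l # ls) = 0" if "l < D" for l
    using that
  proof (induction l rule: less_induct)
    case (less l)
    define F where "F y = (\<Sum>k\<in>{l..<D}. q i y ^ (k - l) * G k y)" for y
    have "q i y ^ l * F y = 0" if y: "y \<in> C (Suc i)" for y
    proof -
      have "(\<Sum>k<l. q i y ^ k * G k y) = 0"
        using less unfolding G_def by (intro sum.neutral) auto
      moreover have "(\<Sum>k<D. q i y ^ k * G k y) =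
          (\<Sum>k<l. q i y ^ k * G k y) + (\<Sum>k\<in>{l..<D}. q i y ^ k * G k y)"
        using less.prems sum.atLeastLessThan_concat[of 0 l D "\<lambda>k. q i y ^ k * G k y"]
        by (simp add: atLeast0LessThan)
      moreover have "(\<Sum>k\<in>{l..<D}. q i y ^ k * G k y) = q i y ^ l * F y"
        unfolding F_def sum_distrib_left
        by (intro sum.cong) (auto simp: mult.assoc[symmetric] simp flip: power_add)
      ultimately show ?thesis using rel[OF y] by simp
    qed
    moreover have "(\<lambda>y. q i y ^ l) \<in> pf I" using q[OF i] by (intro pf_power) auto
    moreover have "F \<in> pf I"
      unfolding F_def[abs_def] using q[OF i] Gpf by (intro pf_sum pf_mult pf_power) auto
    \<comment> \<open>Irreducibility permits cancelling \<open>q i ^ l\<close>, which is not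
      identically zero on \<open>C (Suc i)\<close>.\<close>
    ultimately have "(\<forall>y\<in>C (Suc i). q i y ^ l = 0) \<or> (\<forall>y\<in>C (Suc i). F y = 0)"
      using irr[OF Suc.prems(1)] by (intro zariski_irreducible_prime) auto
    then have F0: "F y = 0" if "y \<in> C (Suc i)" for y
      using q[OF i] that by auto
    have "G l y = 0" if y: "y \<in> C i" for y
    proof -
      \<comment> \<open>On \<open>C i\<close> only the term \<open>k = l\<close> survives, where the
        exponent of \<open>q i\<close> is 0.\<close>
      have "F y = (\<Sum>k\<in>{l..<D}. if k = l then G l y else 0)"
        unfolding F_def using q[OF i] y by (intro sum.cong) auto
      also have "\<dots> = G l y" using less.prems by simp
      finally show ?thesis using F0 sub[OF i] y by auto
    qed
    then show ?case unfolding G_def using i by (intro Suc.IH[of "\<lambda>ls. c (l # ls)"]) auto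
  qed
  then show ?case unfolding exponents_Suc by auto
qed

text \<open>A chain of length \<open>m\<close> provides \<open>D ^ m\<close> linearly independent
  power products, of degree linear in \<open>D\<close>. Without \<open>m\<close> free coordinates
  the functions of degree at most \<open>E\<close> on the closure span a space of dimension at most
  a constant times \<open>(E + 1) ^ (m - 1)\<close>, which is too small for large
  \<open>D\<close>.\<close>

theorem chain_imp_free:
  fixes S :: "('v::linorder \<Rightarrow> 'k::field) set"
  assumes inf: "infinite (UNIV :: 'k set)" and I: "finite I"
    and C: "\<forall>i\<le>m. zariski_irreducible I (C i) \<and> C i \<subseteq> zariski_closure_K I S" "\<forall>i<m. C i \<subset> C (Suc i)"
  shows "\<exists>J\<subseteq>I. card J = m \<and> free_on J S"
proof (cases "m = 0")
  case True
  obtain y where y: "y \<in> zariski_closure_K I S"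
    using C(1) unfolding zariski_irreducible_def by blast
  \<comment> \<open>A chain with a single member still has a point in the closure; for empty
    \<open>S\<close> this point would satisfy the equation 1 = 0.\<close>
  have "S \<noteq> {}"
  proof
    assume "S = {}"
    then have "\<forall>s\<in>S. (\<Sum>b\<in>{0}. 1 * mon b s) = 0" by simp
    from closure_relation[OF y _ _ this] show False by simp
  qed
  then have "free_on {} S"
    unfolding free_on_def using pf_cong[of _ "{}"] by (metis all_not_in_conv)
  then show ?thesis using True by (intro exI[of _ "{}"]) auto
next
  case False
  show ?thesis
  proof (rule ccontr)
    assume "\<not> ?thesis"
    then obtain B where B: "\<And>E. card (std_monoms I S E) \<le> B * (E + 1) ^ (m - 1)"
      using card_std_monoms[OF I, of m S] False by auto
    have "\<forall>i<m. \<exists>q e. q \<in> pfd I e \<and> (\<forall>y\<in>C i. q y = 0) \<and> (\<exists>y\<in>C (Suc i). q y \<noteq> 0)"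
      (is "\<forall>i<m. ?P i")
    proof (intro allI impI)
      fix i assume i: "i < m"
      have "zariski_closed I (C i)" using C(1) i unfolding zariski_irreducible_def by auto
      then obtain Ps where Ps: "\<forall>p\<in>Ps. poly_vars_in I p" "C i = {y \<in> aff I. \<forall>p\<in>Ps. peval id p y = 0}"
        unfolding zariski_closed_def by blast
      obtain y where y: "y \<in> C (Suc i)" "y \<notin> C i" using C(2) i by blast
      have "C (Suc i) \<subseteq> zariski_closure_K I S" using C(1) i by auto
      then have "y \<in> aff I" using y(1) by (auto simp: zariski_closure_K_def)
      then obtain p where p: "p \<in> Ps" "peval id p y \<noteq> 0" using y Ps by auto
      have "peval id p \<in> pf I" using Ps(1) p(1) by (intro peval_pf) blast
      then obtain e where "peval id p \<in> pfd I e" by (rule pfE)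
      then show "?P i" using p y Ps by (intro exI[of _ "peval id p"] exI[of _ e]) auto
    qed
    then obtain q e where qe: "\<forall>i<m. q i \<in> pfd I (e i) \<and> (\<forall>y\<in>C i. q i y = 0) \<and> (\<exists>y\<in>C (Suc i). q i y \<noteq> 0)"
      unfolding choice_iff' by (elim exE) (rule that)
    define e' where "e' = (\<Sum>i<m. e i)"
    have "e i \<le> e'" if "i < m" for i
      unfolding e'_def using that by (intro member_le_sum) auto
    then have q: "q i \<in> pfd I e'" if "i < m" for i using qe that by (auto elim!: pfd_mono)
    \<comment> \<open>Since \<open>E + 1 \<le> D * (m * e' + 1)\<close>, there are at most
      \<open>D ^ (m - 1) * (B * (m * e' + 1) ^ (m - 1))\<close> standard monomials; the summand 1
      makes \<open>D\<close> exceed the last factor.\<close>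
    define D where "D = B * (m * e' + 1) ^ (m - 1) + 1"
    define E where "E = m * (D * e')"
    let ?X = "exponents D m"
    have fX: "finite ?X" and cX: "card ?X = D ^ m"
      using finite_lists_length_eq[of "{..<D}" m] card_lists_length_eq[of "{..<D}" m] by auto
    have "E + 1 \<le> D * (m * e' + 1)" by (simp add: E_def D_def algebra_simps)
    then have "(E + 1) ^ (m - 1) \<le> D ^ (m - 1) * (m * e' + 1) ^ (m - 1)"
      by (metis power_mono power_mult_distrib zero_le)
    then have "B * (E + 1) ^ (m - 1) \<le> D ^ (m - 1) * (B * (m * e' + 1) ^ (m - 1))"
      by (simp add: mult.left_commute)
    also have "\<dots> < D ^ (m - 1) * D" by (simp add: D_def)
    also have "\<dots> = D ^ m" using False by (simp add: power_eq_if)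
    finally have lt: "card (std_monoms I S E) < card ?X" using B[of E] cX by simp
    have fstd: "finite (std_monoms I S E)" using finite_monoms[OF I] by (simp add: std_monoms_def)
    have "power_product q ls \<in> pfd I E" if "ls \<in> ?X" for ls
      using that power_product_pfd[of ls q I e' D] q by (auto simp: E_def)
    then have "\<forall>ls\<in>?X. \<exists>t. \<forall>y\<in>zariski_closure_K I S.
        power_product q ls y = (\<Sum>b\<in>std_monoms I S E. t b * mon b y)"
      using pfd_reduce_on_closure[OF I] by blast
    then obtain t where t: "\<forall>ls\<in>?X. \<forall>y\<in>zariski_closure_K I S.
        power_product q ls y = (\<Sum>b\<in>std_monoms I S E. t ls b * mon b y)"
      by (elim bchoice[THEN exE])
    \<comment> \<open>One equation per standard monomial and one unknown per power product: a
      nonzero solution is a relation between power products on the closure.\<close>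
    obtain x where x: "\<exists>ls\<in>?X. x ls \<noteq> 0" "\<forall>b\<in>std_monoms I S E. (\<Sum>ls\<in>?X. t ls b * x ls) = 0"
      using homogeneous_system_nontrivial[OF infinite_to_ac[OF inf] fstd fX lt, of "\<lambda>b ls. t ls b"] by blast
    have rel: "\<forall>y\<in>C m. (\<Sum>ls\<in>?X. x ls * power_product q ls y) = 0"
    proof
      fix y assume "y \<in> C m"
      then have y: "y \<in> zariski_closure_K I S" using C by auto
      have "(\<Sum>ls\<in>?X. x ls * power_product q ls y) = (\<Sum>ls\<in>?X. \<Sum>b\<in>std_monoms I S E. t ls b * x ls * mon b y)"
        using t y by (intro sum.cong) (auto simp: sum_distrib_left algebra_simps)
      also have "\<dots> = (\<Sum>b\<in>std_monoms I S E. (\<Sum>ls\<in>?X. t ls b * x ls) * mon b y)"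
        by (subst sum.swap) (simp add: sum_distrib_right)
      also have "\<dots> = 0" using x(2) by simp
      finally show "(\<Sum>ls\<in>?X. x ls * power_product q ls y) = 0" .
    qed
    have "\<forall>ls\<in>?X. x ls = 0"
    proof (rule power_product_independent[where m = m and i = m and I = I and C = C and q = q and D = D and c = x])
      show "m \<le> m" by simp
      show "\<forall>y\<in>C m. (\<Sum>ls\<in>?X. x ls * power_product q ls y) = 0" by (rule rel)
      show "zariski_irreducible I (C i)" if "i \<le> m" for i using C(1) that by simp
      show "C i \<subseteq> C (Suc i)" if "i < m" for i using C(2) that by auto
      show "q i \<in> pf I \<and> (\<forall>y\<in>C i. q i y = 0) \<and> (\<exists>y\<in>C (Suc i). q i y \<noteq> 0)" if "i < m" for i
        using spec[OF qe, of i] that q[OF that] pfI[of "q i" I e'] by simp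
    qed
    then show False using x(1) by simp
  qed
qed

section \<open>An ultrapower with generic points\<close>

definition ultra :: "'a filter \<Rightarrow> bool" where
  "ultra U \<longleftrightarrow> U \<noteq> bot \<and> (\<forall>P. eventually P U \<or> eventually (\<lambda>x. \<not> P x) U)"

text \<open>Zorn's lemma for the proper filters below \<open>F\<close>; smaller in the order of
  filters means finer.\<close>

lemma ultra_exists:
  assumes "F \<noteq> bot"
  shows "\<exists>U\<le>F. ultra U"
proof -
  let ?A = "{G. G \<le> F \<and> G \<noteq> bot}" and ?le = "\<lambda>G H :: 'a filter. H \<le> G"
  have "\<exists>m\<in>?A. \<forall>a\<in>?A. a \<le> m \<longrightarrow> a = m"
  proof (rule predicate_Zorn)
    show "partial_order_on ?A (relation_of ?le ?A)"
      by (rule partial_order_on_relation_ofI) auto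
    fix C assume "C \<in> Chains (relation_of ?le ?A)"
    then have C: "C \<subseteq> ?A" "\<And>G H. G \<in> C \<Longrightarrow> H \<in> C \<Longrightarrow> G \<le> H \<or> H \<le> G"
      by (auto simp: Chains_def relation_of_def)
    show "\<exists>u\<in>?A. \<forall>a\<in>C. u \<le> a"
    proof (cases "C = {}")
      case True
      then show ?thesis using assms by auto
    next
      case False
      have "\<exists>x\<in>C. x \<le> inf G H" if "G \<in> C" "H \<in> C" for G H
        using C(2)[OF that] that by (metis inf.absorb1 inf.absorb2 order_refl)
      then have ev: "eventually P (Inf C) \<longleftrightarrow> (\<exists>b\<in>C. eventually P b)" for P
        using False by (rule eventually_Inf_base[rotated])
      have "Inf C \<noteq> bot"
        using ev[of "\<lambda>_. False"] C(1) by (auto simp: trivial_limit_def)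
      moreover have "Inf C \<le> F" using False C(1) by (auto intro: Inf_lower2)
      ultimately show ?thesis by (auto intro: Inf_lower)
    qed
  qed
  then obtain m where m: "m \<le> F" "m \<noteq> bot" "\<And>a. a \<le> F \<Longrightarrow> a \<noteq> bot \<Longrightarrow> a \<le> m \<Longrightarrow> a = m" by auto
  \<comment> \<open>Refining \<open>m\<close> by \<open>P\<close> keeps it proper, so by maximality
    nothing changes.\<close>
  have "eventually P m" if "\<not> eventually (\<lambda>x. \<not> P x) m" for P
  proof -
    have "inf m (principal {x. P x}) \<noteq> bot"
      using that by (simp add: trivial_limit_def eventually_inf_principal)
    then have eq: "inf m (principal {x. P x}) = m"
      using m(1) by (intro m(3)) (auto intro: le_infI1)
    have "eventually P (inf m (principal {x. P x}))" by (simp add: eventually_inf_principal)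
    then show ?thesis unfolding eq .
  qed
  then show ?thesis using m unfolding ultra_def by blast
qed

text \<open>The index set consists of functions choosing a point for every filter, so that a single
  ultrafilter, and hence a single type, provides a generic point for every proper filter.\<close>

definition pick_filter :: "('p filter \<Rightarrow> 'p) filter" where
  "pick_filter = (INF F\<in>{F. F \<noteq> bot}. filtercomap (\<lambda>h. h F) F)"

text \<open>Conditions at finitely many filters are compatible because a choice function may take
  its values at different filters independently.\<close>

lemma pick_filter_not_bot: "(pick_filter :: ('p filter \<Rightarrow> 'p) filter) \<noteq> bot"
  unfolding pick_filter_def
proof (rule INF_filter_not_bot)
  fix A :: "'p filter set" assume A: "A \<subseteq> {F. F \<noteq> bot}" "finite A"
  show "(INF F\<in>A. filtercomap (\<lambda>h. h F) F) \<noteq> bot"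
    unfolding trivial_limit_def
  proof
    assume "eventually (\<lambda>_. False) (INF F\<in>A. filtercomap (\<lambda>h. h F) F)"
    then obtain Q where Q: "\<forall>F\<in>A. eventually (Q F) (filtercomap (\<lambda>h. h F) F)"
      "\<forall>h. \<not> (\<forall>F\<in>A. Q F h)"
      unfolding eventually_INF_finite[OF A(2)] by blast
    have "\<exists>p. \<forall>h. h F = p \<longrightarrow> Q F h" if F: "F \<in> A" for F
    proof -
      have "eventually (Q F) (filtercomap (\<lambda>h. h F) F)" using Q(1) F by blast
      then obtain R where "eventually R F" "\<forall>h. R (h F) \<longrightarrow> Q F h"
        unfolding eventually_filtercomap by blast
      moreover have "F \<noteq> bot" using A F by blast
      ultimately obtain p where "R p" by (metis eventually_happens' )
      then show ?thesis using \<open>\<forall>h. R (h F) \<longrightarrow> Q F h\<close> by (intro exI[of _ p]) simp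
    qed
    then obtain p where "\<forall>F\<in>A. \<forall>h. h F = p F \<longrightarrow> Q F h" by metis
    then show False using Q(2) by blast
  qed
qed

definition pick_ultra :: "('p filter \<Rightarrow> 'p) filter" where
  "pick_ultra = (SOME U. U \<le> pick_filter \<and> ultra U)"

lemma pick_ultra: "(pick_ultra :: ('p filter \<Rightarrow> 'p) filter) \<le> pick_filter" "ultra (pick_ultra :: ('p filter \<Rightarrow> 'p) filter)"
proof -
  have "\<exists>U. U \<le> (pick_filter :: ('p filter \<Rightarrow> 'p) filter) \<and> ultra U"
    using ultra_exists[OF pick_filter_not_bot] by blast
  from someI_ex[OF this] show "(pick_ultra :: ('p filter \<Rightarrow> 'p) filter) \<le> pick_filter"
    "ultra (pick_ultra :: ('p filter \<Rightarrow> 'p) filter)"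
    unfolding pick_ultra_def by auto
qed

lemma pick_ultra_not_eventually: "\<not> eventually P pick_ultra \<longleftrightarrow> eventually (\<lambda>h. \<not> P h) pick_ultra"
proof -
  have "eventually P pick_ultra \<Longrightarrow> \<not> eventually (\<lambda>h. \<not> P h) pick_ultra"
    using pick_ultra(2) eventually_conj[of P pick_ultra "\<lambda>h. \<not> P h"]
    by (auto simp: ultra_def trivial_limit_def)
  then show ?thesis using pick_ultra(2) unfolding ultra_def by blast
qed

lemma eventually_pick_ultra:
  assumes "F \<noteq> bot" "eventually P F"
  shows "eventually (\<lambda>h. P (h F)) pick_ultra"
proof -
  have "pick_filter \<le> filtercomap (\<lambda>h. h F) F"
    unfolding pick_filter_def using assms(1) by (intro INF_lower) auto
  moreover have "eventually (\<lambda>h. P (h F)) (filtercomap (\<lambda>h. h F) F)"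
    using assms(2) by (rule eventually_filtercomapI)
  ultimately show ?thesis using pick_ultra(1) by (meson filter_leD)
qed

quotient_type ('p, 'k) upow = "('p filter \<Rightarrow> 'p) \<Rightarrow> 'k" / "\<lambda>f g. eventually (\<lambda>h. f h = g h) pick_ultra"
proof (rule equivpI)
  show "reflp (\<lambda>f g. eventually (\<lambda>h. f h = g h) pick_ultra)" by (rule reflpI) simp
  show "symp (\<lambda>f g. eventually (\<lambda>h. f h = g h) pick_ultra)" by (rule sympI) (simp add: eq_commute)
  show "transp (\<lambda>f g. eventually (\<lambda>h. f h = g h) pick_ultra)"
    by (rule transpI) (auto elim: eventually_elim2)
qed

instantiation upow :: (type, field) comm_ring_1
begin

lift_definition zero_upow :: "('a, 'b) upow" is "\<lambda>_. 0" .
lift_definition one_upow :: "('a, 'b) upow" is "\<lambda>_. 1" .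
lift_definition plus_upow :: "('a, 'b) upow \<Rightarrow> ('a, 'b) upow \<Rightarrow> ('a, 'b) upow" is "\<lambda>f g h. f h + g h"
  by (auto elim: eventually_elim2)
lift_definition minus_upow :: "('a, 'b) upow \<Rightarrow> ('a, 'b) upow \<Rightarrow> ('a, 'b) upow" is "\<lambda>f g h. f h - g h"
  by (auto elim: eventually_elim2)
lift_definition times_upow :: "('a, 'b) upow \<Rightarrow> ('a, 'b) upow \<Rightarrow> ('a, 'b) upow" is "\<lambda>f g h. f h * g h"
  by (auto elim: eventually_elim2)
lift_definition uminus_upow :: "('a, 'b) upow \<Rightarrow> ('a, 'b) upow" is "\<lambda>f h. - f h"
  by (auto elim: eventually_mono)

instance
proof
  fix a b c :: "('a, 'b) upow"
  show "a + b + c = a + (b + c)" by transfer (simp add: algebra_simps)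
  show "a + b = b + a" by transfer (simp add: algebra_simps)
  show "0 + a = a" by transfer simp
  show "- a + a = 0" by transfer simp
  show "a - b = a + - b" by transfer simp
  show "a * b * c = a * (b * c)" by transfer (simp add: algebra_simps)
  show "a * b = b * a" by transfer (simp add: algebra_simps)
  show "1 * a = a" by transfer simp
  show "(a + b) * c = a * c + b * c" by transfer (simp add: algebra_simps)
  show "(0 :: ('a, 'b) upow) \<noteq> 1"
    by transfer (simp add: pick_ultra_not_eventually)
qed

end

lift_definition upow_inverse :: "('a, 'b::field) upow \<Rightarrow> ('a, 'b) upow" is "\<lambda>f h. inverse (f h)"
  by (auto elim: eventually_mono)

text \<open>The ultrafilter property makes the quotient a field: an element that is not almost
  everywhere 0 is almost everywhere nonzero.\<close>

lemma upow_inverse: "a \<noteq> 0 \<Longrightarrow> upow_inverse a * a = 1" "upow_inverse 0 = 0"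
  by (transfer; auto simp: pick_ultra_not_eventually elim: eventually_mono)+

instantiation upow :: (type, field) field
begin

definition inverse_upow :: "('a, 'b) upow \<Rightarrow> ('a, 'b) upow" where
  "inverse_upow = upow_inverse"

definition divide_upow :: "('a, 'b) upow \<Rightarrow> ('a, 'b) upow \<Rightarrow> ('a, 'b) upow" where
  "divide_upow a b = a * upow_inverse b"

instance
  by standard (simp_all add: inverse_upow_def divide_upow_def upow_inverse)

end

definition emb :: "'k \<Rightarrow> ('p, 'k) upow" where
  "emb c = abs_upow (\<lambda>_. c)"

text \<open>Evaluation at the point of the ultrapower that \<open>F\<close> singles out, represented
  by the values of the choice functions at \<open>F\<close>.\<close>

definition at_point :: "'p filter \<Rightarrow> ('p \<Rightarrow> 'k) \<Rightarrow> ('p, 'k) upow" where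
  "at_point F q = abs_upow (\<lambda>h. q (h F))"

lemma abs_upow_eq_iff: "abs_upow f = abs_upow g \<longleftrightarrow> eventually (\<lambda>h. f h = g h) pick_ultra"
  by (rule upow.abs_eq_iff)

lemma abs_upow_add: "abs_upow (\<lambda>h. f h + g h) = abs_upow f + abs_upow g"
  and abs_upow_mult: "abs_upow (\<lambda>h. f h * g h) = abs_upow f * abs_upow g"
  by (simp_all add: plus_upow.abs_eq times_upow.abs_eq)

lemma at_point_add: "at_point F (\<lambda>s. p s + q s) = at_point F p + at_point F q"
  and at_point_mult: "at_point F (\<lambda>s. p s * q s) = at_point F p * at_point F q"
  and at_point_const: "at_point F (\<lambda>s. c) = emb c"
  by (simp_all add: at_point_def emb_def abs_upow_add abs_upow_mult)

lemma emb_0 [simp]: "emb 0 = 0" and emb_1 [simp]: "emb 1 = 1"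
  by (simp_all add: emb_def zero_upow.abs_eq one_upow.abs_eq)

text \<open>The sets of points of \<open>S\<close> where a nonzero polynomial in \<open>J\<close>
  does not vanish form a filter base: none is empty by freeness, and products of nonzero polynomials
  are nonzero. The point of this filter satisfies every equation of \<open>S\<close> but no
  nontrivial one in the coordinates \<open>J\<close> alone.\<close>

lemma generic_point_exists:
  fixes S :: "('v \<Rightarrow> 'k::field) set"
  assumes inf: "infinite (UNIV :: 'k set)" and free: "free_on J S"
  shows "\<exists>F. (\<forall>q :: ('v \<Rightarrow> 'k) \<Rightarrow> 'k. (\<forall>s\<in>S. q s = 0) \<longrightarrow> at_point F q = 0) \<and>
    (\<forall>q\<in>pf J. at_point F q = 0 \<longrightarrow> (\<forall>y. q y = 0))"
proof -
  let ?B = "{q\<in>pf J. \<exists>y. q y \<noteq> 0}" and ?A = "\<lambda>q. principal {s\<in>S. q s \<noteq> 0}"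
  define F where "F = (INF q\<in>?B. ?A q)"
  have ne: "?B \<noteq> {}" using pf_const[of 1 J] by (auto intro!: exI[of _ "\<lambda>_. 1"])
  have "\<exists>r\<in>?B. ?A r \<le> inf (?A p) (?A q)" if p: "p \<in> ?B" and q: "q \<in> ?B" for p q
  proof (rule bexI)
    show "(\<lambda>y. p y * q y) \<in> ?B"
      using p q pf_no_zero_divisors[OF inf, of p J q] by (auto intro: pf_mult)
  qed auto
  then have ev: "eventually P F \<longleftrightarrow> (\<exists>q\<in>?B. eventually P (?A q))" for P
    unfolding F_def using ne by (rule eventually_INF_base[rotated])
  have "F \<noteq> bot"
    using ev[of "\<lambda>_. False"] free by (auto simp: trivial_limit_def eventually_principal free_on_def)
  note gen = eventually_pick_ultra[OF this]
  have "at_point F q = 0" if q: "\<forall>s\<in>S. q s = 0" for q :: "('v \<Rightarrow> 'k) \<Rightarrow> 'k"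
  proof -
    have "eventually (\<lambda>s. q s = 0) F"
      unfolding ev using ne q by (auto simp: eventually_principal)
    from gen[OF this] show ?thesis by (simp add: at_point_def zero_upow.abs_eq abs_upow_eq_iff)
  qed
  moreover have "q y = 0" if q: "q \<in> pf J" "at_point F q = 0" for q y
  proof (rule ccontr)
    assume "q y \<noteq> 0"
    then have "eventually (\<lambda>s. q s \<noteq> 0) F"
      unfolding ev using q(1) by (auto simp: eventually_principal intro!: bexI[of _ q])
    from gen[OF this] have "\<not> eventually (\<lambda>h. q (h F) = 0) pick_ultra"
      by (simp add: pick_ultra_not_eventually)
    then show False using q(2) by (simp add: at_point_def zero_upow.abs_eq abs_upow_eq_iff)
  qed
  ultimately show ?thesis by blast
qed

section \<open>Extending derivations\<close>

definition is_subfield :: "'l::field set \<Rightarrow> bool" where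
  "is_subfield F \<longleftrightarrow> 0 \<in> F \<and> 1 \<in> F \<and> (\<forall>a\<in>F. \<forall>b\<in>F. a + b \<in> F \<and> a * b \<in> F) \<and>
     (\<forall>a\<in>F. - a \<in> F \<and> inverse a \<in> F)"

definition poly_over :: "'l::field set \<Rightarrow> 'l poly \<Rightarrow> bool" where
  "poly_over F p \<longleftrightarrow> (\<forall>i. coeff p i \<in> F)"

text \<open>The simple extension F(x), for algebraic and transcendental \<open>x\<close>
  alike.\<close>

definition adj :: "'l::field set \<Rightarrow> 'l \<Rightarrow> 'l set" where
  "adj F x = {poly a x / poly b x | a b. poly_over F a \<and> poly_over F b \<and> poly b x \<noteq> 0}"

definition deriv_on :: "'l::field set \<Rightarrow> ('l \<Rightarrow> 'l) \<Rightarrow> bool" where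
  "deriv_on F D \<longleftrightarrow> (\<forall>a\<in>F. \<forall>b\<in>F. D (a + b) = D a + D b \<and> D (a * b) = a * D b + D a * b)"

lemma is_subfieldD:
  assumes "is_subfield F"
  shows "0 \<in> F" "1 \<in> F" "a \<in> F \<Longrightarrow> b \<in> F \<Longrightarrow> a + b \<in> F" "a \<in> F \<Longrightarrow> b \<in> F \<Longrightarrow> a * b \<in> F"
    "a \<in> F \<Longrightarrow> - a \<in> F" "a \<in> F \<Longrightarrow> inverse a \<in> F" "a \<in> F \<Longrightarrow> b \<in> F \<Longrightarrow> a - b \<in> F"
    "a \<in> F \<Longrightarrow> b \<in> F \<Longrightarrow> a / b \<in> F"
proof -
  show *: "0 \<in> F" "1 \<in> F" "a \<in> F \<Longrightarrow> b \<in> F \<Longrightarrow> a + b \<in> F" "a \<in> F \<Longrightarrow> b \<in> F \<Longrightarrow> a * b \<in> F"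
    "a \<in> F \<Longrightarrow> - a \<in> F" "a \<in> F \<Longrightarrow> inverse a \<in> F" for a b
    using assms unfolding is_subfield_def by blast+
  show "a \<in> F \<Longrightarrow> b \<in> F \<Longrightarrow> a - b \<in> F" using *(3)[of a "- b"] *(5)[of b] by simp
  show "a \<in> F \<Longrightarrow> b \<in> F \<Longrightarrow> a / b \<in> F" using *(4)[of a "inverse b"] *(6)[of b] by (simp add: divide_inverse)
qed

lemma subfield_sum: "is_subfield F \<Longrightarrow> (\<And>i. i \<in> A \<Longrightarrow> f i \<in> F) \<Longrightarrow> sum f A \<in> F"
  by (induction A rule: infinite_finite_induct) (auto intro: is_subfieldD)

lemma subfield_power: "is_subfield F \<Longrightarrow> a \<in> F \<Longrightarrow> a ^ k \<in> F"
  by (induction k) (auto intro: is_subfieldD)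

lemma subfield_poly: "is_subfield F \<Longrightarrow> poly_over F p \<Longrightarrow> x \<in> F \<Longrightarrow> poly p x \<in> F"
  unfolding poly_altdef poly_over_def by (intro subfield_sum is_subfieldD subfield_power) auto

context
  fixes F :: "'l::field set"
  assumes F: "is_subfield F"
begin

lemma poly_over_add: "poly_over F p \<Longrightarrow> poly_over F q \<Longrightarrow> poly_over F (p + q)"
  and poly_over_diff: "poly_over F p \<Longrightarrow> poly_over F q \<Longrightarrow> poly_over F (p - q)"
  and poly_over_uminus: "poly_over F p \<Longrightarrow> poly_over F (- p)"
  and poly_over_mult: "poly_over F p \<Longrightarrow> poly_over F q \<Longrightarrow> poly_over F (p * q)"
  by (auto simp: poly_over_def coeff_mult intro!: is_subfieldD[OF F] subfield_sum[OF F])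

lemma poly_over_const: "c \<in> F \<Longrightarrow> poly_over F [:c:]"
  and poly_over_monom: "c \<in> F \<Longrightarrow> poly_over F (monom c k)"
  by (auto simp: poly_over_def coeff_pCons is_subfieldD[OF F] split: nat.split)

lemma subset_adj: "F \<subseteq> adj F x"
proof
  fix c assume c: "c \<in> F"
  show "c \<in> adj F x" unfolding adj_def
    using c is_subfieldD(2)[OF F]
    by (intro CollectI exI[of _ "[:c:]"] exI[of _ "[:1:]"]) (simp add: poly_over_const)
qed

lemma gen_in_adj: "x \<in> adj F x"
  unfolding adj_def using is_subfieldD(2)[OF F]
  by (intro CollectI exI[of _ "monom 1 1"] exI[of _ "[:1:]"])
     (simp add: poly_over_const poly_over_monom poly_monom)

lemma adjE:
  assumes "y \<in> adj F x"
  obtains a b where "poly_over F a" "poly_over F b" "poly b x \<noteq> 0" "y = poly a x / poly b x"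
  using assms unfolding adj_def by blast

lemma adjI: "poly_over F a \<Longrightarrow> poly_over F b \<Longrightarrow> poly b x \<noteq> 0 \<Longrightarrow> y = poly a x / poly b x \<Longrightarrow> y \<in> adj F x"
  unfolding adj_def by blast

lemma subfield_adj: "is_subfield (adj F x)"
proof -
  have "a + b \<in> adj F x \<and> a * b \<in> adj F x" if ab: "a \<in> adj F x" "b \<in> adj F x" for a b
  proof -
    obtain p q where p: "poly_over F p" "poly_over F q" "poly q x \<noteq> 0" "a = poly p x / poly q x"
      using ab(1) by (rule adjE)
    obtain r s where r: "poly_over F r" "poly_over F s" "poly s x \<noteq> 0" "b = poly r x / poly s x"
      using ab(2) by (rule adjE)
    have "a + b \<in> adj F x"
      by (rule adjI[of "p * s + r * q" "q * s"])
         (use p r in \<open>auto intro: poly_over_add poly_over_mult simp: add_frac_eq\<close>)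
    moreover have "a * b \<in> adj F x"
      by (rule adjI[of "p * r" "q * s"])
         (use p r in \<open>auto intro: poly_over_mult\<close>)
    ultimately show ?thesis by blast
  qed
  moreover have "- a \<in> adj F x \<and> inverse a \<in> adj F x" if a: "a \<in> adj F x" for a
  proof -
    obtain p q where p: "poly_over F p" "poly_over F q" "poly q x \<noteq> 0" "a = poly p x / poly q x"
      using a by (rule adjE)
    have "- a \<in> adj F x"
      by (rule adjI[of "- p" q]) (use p in \<open>auto intro: poly_over_uminus\<close>)
    moreover have "inverse a \<in> adj F x"
    proof (cases "poly p x = 0")
      case True
      then show ?thesis using p subset_adj is_subfieldD(1)[OF F] by auto
    next
      case False
      then show ?thesis by (intro adjI[of q p]) (use p in auto)
    qed
    ultimately show ?thesis by blast
  qed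
  ultimately show ?thesis
    unfolding is_subfield_def using subset_adj is_subfieldD(1,2)[OF F] by blast
qed

lemma adj_least:
  assumes "is_subfield F'" "F \<subseteq> F'" "x \<in> F'"
  shows "adj F x \<subseteq> F'"
proof
  fix y assume "y \<in> adj F x"
  then obtain a b where "poly_over F a" "poly_over F b" "y = poly a x / poly b x" by (rule adjE)
  moreover have "poly_over F' p" if "poly_over F p" for p using that assms(2) by (auto simp: poly_over_def)
  ultimately show "y \<in> F'" using assms by (auto intro!: is_subfieldD(8) subfield_poly)
qed

end

text \<open>The value at \<open>poly p x\<close> that the product rule forces on an extension of
  \<open>D\<close> sending \<open>x\<close> to \<open>\<eta>\<close>.\<close>

definition pd :: "('l::field \<Rightarrow> 'l) \<Rightarrow> 'l \<Rightarrow> 'l \<Rightarrow> 'l poly \<Rightarrow> 'l" where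
  "pd D x \<eta> p = poly (map_poly D p) x + poly (pderiv p) x * \<eta>"

context
  fixes F :: "'l::field set" and D :: "'l \<Rightarrow> 'l"
  assumes F: "is_subfield F" and D: "deriv_on F D"
begin

lemma deriv_add: "a \<in> F \<Longrightarrow> b \<in> F \<Longrightarrow> D (a + b) = D a + D b"
  and deriv_mult: "a \<in> F \<Longrightarrow> b \<in> F \<Longrightarrow> D (a * b) = a * D b + D a * b"
  using D unfolding deriv_on_def by blast+

lemma deriv_0: "D 0 = 0"
  using deriv_add[of 0 0] is_subfieldD(1)[OF F] by (metis add_cancel_right_right add_0)

lemma deriv_1: "D 1 = 0"
  using deriv_mult[of 1 1] is_subfieldD(2)[OF F] by (metis add_cancel_right_right mult_1 mult.right_neutral)

lemma deriv_uminus: "a \<in> F \<Longrightarrow> D (- a) = - D a"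
  using deriv_add[of a "- a"] is_subfieldD(5)[OF F] deriv_0 by (simp add: add_eq_0_iff)

lemma deriv_sum: "(\<And>i. i \<in> A \<Longrightarrow> f i \<in> F) \<Longrightarrow> D (sum f A) = (\<Sum>i\<in>A. D (f i))"
  by (induction A rule: infinite_finite_induct) (auto simp: deriv_0 deriv_add subfield_sum[OF F])

lemma map_poly_deriv_add:
  "poly_over F p \<Longrightarrow> poly_over F q \<Longrightarrow> map_poly D (p + q) = map_poly D p + map_poly D q"
  by (rule poly_eqI) (simp add: coeff_map_poly deriv_0 poly_over_def deriv_add)

lemma map_poly_deriv_uminus: "poly_over F p \<Longrightarrow> map_poly D (- p) = - map_poly D p"
  by (rule poly_eqI) (simp add: coeff_map_poly deriv_0 poly_over_def deriv_uminus)

lemma map_poly_deriv_mult: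
  assumes "poly_over F p" "poly_over F q"
  shows "map_poly D (p * q) = p * map_poly D q + map_poly D p * q"
proof (rule poly_eqI)
  fix k
  have "coeff (map_poly D (p * q)) k = (\<Sum>i\<le>k. D (coeff p i * coeff q (k - i)))"
    using assms by (simp add: coeff_map_poly deriv_0 coeff_mult poly_over_def deriv_sum is_subfieldD(4)[OF F])
  also have "\<dots> = (\<Sum>i\<le>k. coeff p i * D (coeff q (k - i)) + D (coeff p i) * coeff q (k - i))"
    using assms by (simp add: poly_over_def deriv_mult)
  also have "\<dots> = coeff (p * map_poly D q + map_poly D p * q) k"
    by (simp add: coeff_mult coeff_map_poly deriv_0 sum.distrib)
  finally show "coeff (map_poly D (p * q)) k = coeff (p * map_poly D q + map_poly D p * q) k" .
qed

lemma pd_add: "poly_over F p \<Longrightarrow> poly_over F q \<Longrightarrow> pd D x \<eta> (p + q) = pd D x \<eta> p + pd D x \<eta> q"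
  by (simp add: pd_def map_poly_deriv_add pderiv_add algebra_simps)

lemma pd_uminus: "poly_over F p \<Longrightarrow> pd D x \<eta> (- p) = - pd D x \<eta> p"
  by (simp add: pd_def map_poly_deriv_uminus pderiv_minus)

lemma pd_diff: "poly_over F p \<Longrightarrow> poly_over F q \<Longrightarrow> pd D x \<eta> (p - q) = pd D x \<eta> p - pd D x \<eta> q"
  using pd_add[of p "- q"] pd_uminus[of q] poly_over_uminus[OF F] by simp

lemma pd_mult:
  "poly_over F p \<Longrightarrow> poly_over F q \<Longrightarrow> pd D x \<eta> (p * q) = poly p x * pd D x \<eta> q + pd D x \<eta> p * poly q x"
  by (simp add: pd_def map_poly_deriv_mult pderiv_mult algebra_simps)

text \<open>The polynomials over \<open>F\<close> vanishing at \<open>x\<close> are the multiples of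
  \<open>\<mu>\<close>, and the product rule passes the condition from \<open>\<mu>\<close> to its
  multiples. The division is carried out one leading term at a time.\<close>

lemma pd_compatible:
  assumes \<mu>: "poly_over F \<mu>" "\<mu> \<noteq> 0" "poly \<mu> x = 0" "pd D x \<eta> \<mu> = 0"
    and min: "\<And>p. poly_over F p \<Longrightarrow> poly p x = 0 \<Longrightarrow> degree p < degree \<mu> \<Longrightarrow> p = 0"
  shows "poly_over F p \<Longrightarrow> poly p x = 0 \<Longrightarrow> pd D x \<eta> p = 0"
proof (induction "degree p" arbitrary: p rule: less_induct)
  case less
  show ?case
  proof (cases "degree p < degree \<mu>")
    case True
    with less.prems have "p = 0" by (intro min)
    then show ?thesis by (simp add: pd_def)
  next
    case False
    define m where "m = monom (lead_coeff p / lead_coeff \<mu>) (degree p - degree \<mu>)"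
    define r where "r = p - m * \<mu>"
    have m: "poly_over F m" unfolding m_def
      using less.prems \<mu> by (intro poly_over_monom[OF F] is_subfieldD(8)[OF F]) (auto simp: poly_over_def)
    have r: "poly_over F r" "poly r x = 0"
      unfolding r_def using m \<mu> less.prems
      by (auto intro: poly_over_diff[OF F] poly_over_mult[OF F])
    have "pd D x \<eta> r = 0"
    proof (cases "degree p = 0")
      case True
      then obtain c where "p = [:c:]" by (rule degree_eq_zeroE)
      then have "p = 0" using less.prems by simp
      then show ?thesis by (simp add: r_def m_def pd_def)
    next
      case pos: False
      have "degree r < degree p \<or> r = 0"
      proof (cases "p = 0")
        case True
        then show ?thesis using pos by simp
      next
        case p0: False
        have m0: "m \<noteq> 0" using p0 \<mu>(2) by (simp add: m_def)
        have deg: "degree (m * \<mu>) = degree p"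
          using m0 \<mu>(2) False p0 by (simp add: degree_mult_eq) (simp add: m_def degree_monom_eq)
        have "coeff (m * \<mu>) (degree p) = coeff p (degree p)"
        proof -
          have "lead_coeff (m * \<mu>) = lead_coeff m * lead_coeff \<mu>" by (rule lead_coeff_mult)
          also have "\<dots> = lead_coeff p" using \<mu>(2) by (simp add: m_def degree_monom_eq p0)
          finally show ?thesis using deg by simp
        qed
        then have "degree r \<le> degree p" "coeff r (degree p) = 0"
          using deg by (auto simp: r_def intro: degree_diff_le)
        then show ?thesis using eq_zero_or_degree_less by blast
      qed
      then show ?thesis using less.hyps[OF _ r] by (auto simp: pd_def)
    qed
    moreover have "p = r + m * \<mu>" by (simp add: r_def)
    then have "pd D x \<eta> p = pd D x \<eta> r + (poly m x * pd D x \<eta> \<mu> + pd D x \<eta> m * poly \<mu> x)"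
      using r m \<mu> by (simp only: pd_add pd_mult poly_over_mult[OF F])
    ultimately show ?thesis using \<mu> by simp
  qed
qed

text \<open>The quotient rule defines \<open>D'\<close> on fractions, and compatibility makes the
  value independent of the fraction. \<open>D\<close> may take values in \<open>adj F x\<close>,
  because exchanging coordinates corrects derivations by coefficients from there.\<close>

lemma deriv_extend:
  assumes Dadj: "\<forall>a\<in>F. D a \<in> adj F x" and \<eta>: "\<eta> \<in> adj F x"
    and compat: "\<And>p. poly_over F p \<Longrightarrow> poly p x = 0 \<Longrightarrow> pd D x \<eta> p = 0"
  shows "\<exists>D'. deriv_on (adj F x) D' \<and> (\<forall>a\<in>adj F x. D' a \<in> adj F x) \<and> (\<forall>a\<in>F. D' a = D a) \<and> D' x = \<eta>"
proof -
  note adj = subfield_adj[OF F, of x]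
  define rp where "rp y a b \<longleftrightarrow> poly_over F a \<and> poly_over F b \<and> poly b x \<noteq> 0 \<and> y = poly a x / poly b x" for y a b
  define D' where "D' y = (let (a, b) = (SOME (a, b). rp y a b) in (pd D x \<eta> a - y * pd D x \<eta> b) / poly b x)" for y
  have D': "D' y = (pd D x \<eta> a - y * pd D x \<eta> b) / poly b x" if ab: "rp y a b" for y a b
  proof -
    obtain c d where cd: "(SOME (a, b). rp y a b) = (c, d)" by fastforce
    have "\<exists>z. case z of (a, b) \<Rightarrow> rp y a b" using ab by auto
    from someI_ex[OF this] have "rp y c d" using cd by simp
    define A B C E where "A = poly a x" and "B = poly b x" and "C = poly c x" and "E = poly d x"
    have nz: "B \<noteq> 0" "E \<noteq> 0" and "y = A / B" "y = C / E"
      using ab \<open>rp y c d\<close> unfolding rp_def A_def B_def C_def E_def by blast+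
    then have y: "y * B = A" "y * E = C" by (metis nonzero_eq_divide_eq)+
    have over: "poly_over F a" "poly_over F b" "poly_over F c" "poly_over F d"
      using ab \<open>rp y c d\<close> by (auto simp: rp_def)
    \<comment> \<open>The cross-multiplied difference of two fractions for \<open>y\<close> vanishes
      at \<open>x\<close>, so \<open>compat\<close> applies to it.\<close>
    have "poly (a * d - c * b) x = A * E - C * B" by (simp add: A_def B_def C_def E_def)
    also have "\<dots> = 0" by (simp flip: y)
    finally have "pd D x \<eta> (a * d - c * b) = 0"
      using over by (intro compat poly_over_diff[OF F] poly_over_mult[OF F])
    then have "A * pd D x \<eta> d + pd D x \<eta> a * E - (C * pd D x \<eta> b + pd D x \<eta> c * B) = 0"
      using over by (simp add: pd_diff pd_mult poly_over_mult[OF F] A_def B_def C_def E_def)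
    then have "(pd D x \<eta> c - y * pd D x \<eta> d) * B = (pd D x \<eta> a - y * pd D x \<eta> b) * E"
      unfolding y[symmetric] by (simp add: algebra_simps)
    then have "(pd D x \<eta> c - y * pd D x \<eta> d) / E = (pd D x \<eta> a - y * pd D x \<eta> b) / B"
      using nz by (simp add: frac_eq_eq)
    then show ?thesis unfolding D'_def cd by (simp add: B_def E_def)
  qed
  have rpE: "\<exists>a b. rp y a b" if "y \<in> adj F x" for y
    using that unfolding rp_def by (elim adjE[OF F]) blast
  have pd_adj: "pd D x \<eta> p \<in> adj F x" if p: "poly_over F p" for p
  proof -
    have "poly_over (adj F x) (map_poly D p)"
      using p Dadj by (auto simp: poly_over_def coeff_map_poly deriv_0)
    moreover have "poly_over (adj F x) (pderiv p)"
    proof -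
      have "of_nat k * coeff p m \<in> F" for k m
        using p is_subfieldD(1,3)[OF F] by (induction k) (auto simp: poly_over_def algebra_simps)
      then have "coeff (pderiv p) i \<in> F" for i unfolding coeff_pderiv .
      then show ?thesis using subset_adj[OF F, of x] by (auto simp: poly_over_def)
    qed
    ultimately show ?thesis
      unfolding pd_def using \<eta> gen_in_adj[OF F, of x]
      by (intro is_subfieldD(3)[OF adj] is_subfieldD(4)[OF adj] subfield_poly[OF adj])
  qed
  have "D' y \<in> adj F x" if y: "y \<in> adj F x" for y
  proof -
    obtain a b where ab: "rp y a b" using rpE y by blast
    have "poly b x \<in> adj F x"
      using ab subset_adj[OF F, of x] gen_in_adj[OF F, of x]
      by (intro subfield_poly[OF adj]) (auto simp: rp_def poly_over_def)
    then show ?thesis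
      unfolding D'[OF ab] using y ab
      by (intro is_subfieldD(8)[OF adj] is_subfieldD(7)[OF adj] is_subfieldD(4)[OF adj] pd_adj) (auto simp: rp_def)
  qed
  moreover have "D' (y + z) = D' y + D' z \<and> D' (y * z) = y * D' z + D' y * z"
    if yz: "y \<in> adj F x" "z \<in> adj F x" for y z
  proof -
    obtain a b where ab: "rp y a b" using rpE yz by blast
    obtain c d where cd: "rp z c d" using rpE yz by blast
    define A B C E where "A = poly a x" and "B = poly b x" and "C = poly c x" and "E = poly d x"
    have nz: "B \<noteq> 0" "E \<noteq> 0" and "y = A / B" "z = C / E"
      using ab cd unfolding rp_def A_def B_def C_def E_def by blast+
    then have y: "y * B = A" "z * E = C" by (metis nonzero_eq_divide_eq)+
    have over: "poly_over F a" "poly_over F b" "poly_over F c" "poly_over F d"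
      using ab cd by (auto simp: rp_def)
    have s: "rp (y + z) (a * d + c * b) (b * d)" and m: "rp (y * z) (a * c) (b * d)"
      using ab cd by (auto simp: rp_def field_simps intro!: poly_over_add[OF F] poly_over_mult[OF F])
    have pbd: "pd D x \<eta> (b * d) = B * pd D x \<eta> d + pd D x \<eta> b * E"
      using over by (simp add: pd_mult B_def E_def)
    have "pd D x \<eta> (a * d + c * b) = y * B * pd D x \<eta> d + pd D x \<eta> a * E + (z * E * pd D x \<eta> b + pd D x \<eta> c * B)"
      unfolding y using over by (simp add: pd_add pd_mult poly_over_mult[OF F] A_def B_def C_def E_def)
    then have "D' (y + z) = D' y + D' z"
      unfolding D'[OF s] D'[OF ab] D'[OF cd] pbd using nz
      by (simp add: B_def[symmetric] E_def[symmetric] field_simps)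
    moreover have "pd D x \<eta> (a * c) = y * B * pd D x \<eta> c + pd D x \<eta> a * (z * E)"
      unfolding y using over by (simp add: pd_mult A_def C_def)
    then have "D' (y * z) = y * D' z + D' y * z"
      unfolding D'[OF m] D'[OF ab] D'[OF cd] pbd using nz
      by (simp add: B_def[symmetric] E_def[symmetric] field_simps)
    ultimately show ?thesis by blast
  qed
  moreover have pd1: "pd D x \<eta> [:1:] = 0" by (simp add: pd_def map_poly_pCons deriv_0 deriv_1)
  have "D' a = D a" if a: "a \<in> F" for a
  proof -
    have "rp a [:a:] [:1:]"
      using a is_subfieldD(2)[OF F] by (auto simp: rp_def intro!: poly_over_const[OF F])
    from D'[OF this] show ?thesis by (simp add: pd1) (simp add: pd_def map_poly_pCons deriv_0)
  qed
  moreover have "D' x = \<eta>"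
  proof -
    have "rp x [:0, 1:] [:1:]"
      using is_subfieldD(1,2)[OF F] by (auto simp: rp_def poly_over_def coeff_pCons split: nat.split)
    from D'[OF this] show ?thesis
      by (simp add: pd1) (simp add: pd_def map_poly_pCons deriv_0 deriv_1 pderiv_pCons)
  qed
  ultimately show ?thesis unfolding deriv_on_def by blast
qed

end

text \<open>Abstract partial derivatives: derivations that kill the constants \<open>C\<close> and
  are dual to the elements \<open>x k\<close> with \<open>k\<close> in \<open>Q\<close>. Closure of
  \<open>F\<close> under them allows iteration.\<close>

definition dersys :: "'l::field set \<Rightarrow> 'l set \<Rightarrow> ('v \<Rightarrow> 'l) \<Rightarrow> 'v set \<Rightarrow> ('v \<Rightarrow> 'l \<Rightarrow> 'l) \<Rightarrow> bool" where
  "dersys C F x Q D \<longleftrightarrow> is_subfield F \<and> C \<subseteq> F \<and> (\<forall>k\<in>Q. x k \<in> F) \<and>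
     (\<forall>j\<in>Q. deriv_on F (D j) \<and> (\<forall>a\<in>F. D j a \<in> F) \<and> (\<forall>c\<in>C. D j c = 0) \<and>
        (\<forall>k\<in>Q. D j (x k) = (if j = k then 1 else 0)))"

text \<open>Common part of all ways of adjoining \<open>x v\<close>: \<open>\<delta> j\<close> is
  the derivation prescribed on \<open>F\<close> and \<open>\<eta> j\<close> its value at the new
  element.\<close>

lemma dersys_adj:
  assumes sys: "dersys C F x Q D" and Q': "Q' \<subseteq> insert v Q"
    and \<delta>: "\<And>j. j \<in> Q' \<Longrightarrow> deriv_on F (\<delta> j)" "\<And>j a. j \<in> Q' \<Longrightarrow> a \<in> F \<Longrightarrow> \<delta> j a \<in> adj F (x v)"
      "\<And>j c. j \<in> Q' \<Longrightarrow> c \<in> C \<Longrightarrow> \<delta> j c = 0"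
      "\<And>j k. j \<in> Q' \<Longrightarrow> k \<in> Q' \<Longrightarrow> k \<noteq> v \<Longrightarrow> \<delta> j (x k) = (if j = k then 1 else 0)"
    and \<eta>: "\<And>j. j \<in> Q' \<Longrightarrow> \<eta> j \<in> adj F (x v)" "\<And>j. j \<in> Q' \<Longrightarrow> v \<in> Q' \<Longrightarrow> \<eta> j = (if j = v then 1 else 0)"
    and compat: "\<And>j p. j \<in> Q' \<Longrightarrow> poly_over F p \<Longrightarrow> poly p (x v) = 0 \<Longrightarrow> pd (\<delta> j) (x v) (\<eta> j) p = 0"
  shows "\<exists>D'. dersys C (adj F (x v)) x Q' D'"
proof -
  have F: "is_subfield F" and CF: "C \<subseteq> F" and xF: "\<And>k. k \<in> Q \<Longrightarrow> x k \<in> F"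
    using sys unfolding dersys_def by blast+
  let ?G = "adj F (x v)"
  have "\<forall>j\<in>Q'. \<exists>D'. deriv_on ?G D' \<and> (\<forall>a\<in>?G. D' a \<in> ?G) \<and> (\<forall>a\<in>F. D' a = \<delta> j a) \<and> D' (x v) = \<eta> j"
    by (rule ballI, rule deriv_extend[OF F \<delta>(1)]) (use \<delta>(2) \<eta>(1) compat in auto)
  then obtain D' where D': "\<forall>j\<in>Q'. deriv_on ?G (D' j) \<and> (\<forall>a\<in>?G. D' j a \<in> ?G) \<and> (\<forall>a\<in>F. D' j a = \<delta> j a) \<and> D' j (x v) = \<eta> j"
    by (elim bchoice[THEN exE])
  have "x k \<in> ?G" if "k \<in> Q'" for k
    using that Q' xF subset_adj[OF F, of "x v"] gen_in_adj[OF F, of "x v"] by (cases "k = v") auto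
  moreover have "D' j (x k) = (if j = k then 1 else 0)" if jk: "j \<in> Q'" "k \<in> Q'" for j k
  proof (cases "k = v")
    case True
    then show ?thesis using bspec[OF D' jk(1)] \<eta>(2)[OF jk(1)] jk(2) by simp
  next
    case False
    then have "x k \<in> F" using Q' xF jk(2) by auto
    then show ?thesis using bspec[OF D' jk(1)] \<delta>(4)[OF jk False] by simp
  qed
  moreover have "D' j c = 0" if jc: "j \<in> Q'" "c \<in> C" for j c
    using bspec[OF D' jc(1)] \<delta>(3)[OF jc] CF jc(2) by (simp add: subset_iff)
  moreover have "C \<subseteq> ?G" using CF subset_adj[OF F, of "x v"] by auto
  ultimately have "dersys C ?G x Q' D'"
    unfolding dersys_def using subfield_adj[OF F] D' by simp
  then show ?thesis by (intro exI[of _ D'])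
qed

lemma deriv_on_zero: "deriv_on F (\<lambda>_. 0)"
  by (simp add: deriv_on_def)

lemma pd_zero: "pd (\<lambda>_. 0) (x :: 'a::field) \<eta> p = poly (pderiv p) x * \<eta>"
proof -
  have "map_poly (\<lambda>_. 0 :: 'a) p = 0" by (rule poly_eqI) (simp add: coeff_map_poly)
  then show ?thesis by (simp add: pd_def)
qed

text \<open>An algebraic element costs at most one derivation. If it is separable, every derivation
  extends uniquely. If it is inseparable, the condition for extending a derivation is a single
  linear one, and the derivation with respect to the new element is gained.\<close>

lemma dersys_step:
  assumes sys: "dersys C F x Q D" and fin: "finite Q" and v: "v \<notin> Q"
  shows "\<exists>Q' D'. Q' \<subseteq> insert v Q \<and> card Q \<le> card Q' \<and> dersys C (adj F (x v)) x Q' D' \<and>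
    ((\<forall>p. poly_over F p \<longrightarrow> poly p (x v) = 0 \<longrightarrow> p = 0) \<longrightarrow> Q' = insert v Q)"
proof -
  have F: "is_subfield F" and CF: "C \<subseteq> F" and xF: "\<And>k. k \<in> Q \<Longrightarrow> x k \<in> F"
    and D: "\<And>j. j \<in> Q \<Longrightarrow> deriv_on F (D j)" "\<And>j a. j \<in> Q \<Longrightarrow> a \<in> F \<Longrightarrow> D j a \<in> F"
      "\<And>j c. j \<in> Q \<Longrightarrow> c \<in> C \<Longrightarrow> D j c = 0"
      "\<And>j k. j \<in> Q \<Longrightarrow> k \<in> Q \<Longrightarrow> D j (x k) = (if j = k then 1 else 0)"
    using sys unfolding dersys_def by blast+
  let ?G = "adj F (x v)"
  note G = subfield_adj[OF F, of "x v"] and FG = subsetD[OF subset_adj[OF F, of "x v"]]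
  note G01 = is_subfieldD(1,2)[OF G]
  have polyG: "poly p (x v) \<in> ?G" if "poly_over ?G p" for p
    using that gen_in_adj[OF F, of "x v"] by (rule subfield_poly[OF G])
  have D0: "D j 0 = 0" if "j \<in> Q" for j using deriv_0[OF F D(1)[OF that]] .
  show ?thesis
  proof (cases "\<forall>p. poly_over F p \<longrightarrow> poly p (x v) = 0 \<longrightarrow> p = 0")
    \<comment> \<open>No relation restricts the value at a transcendental element, so every
      derivation extends by 0 and a new one is gained.\<close>
    case trans: True
    have "\<exists>D'. dersys C ?G x (insert v Q) D'"
    proof (rule dersys_adj[OF sys order_refl,
          where \<delta> = "\<lambda>j. if j = v then \<lambda>_. 0 else D j" and \<eta> = "\<lambda>j. if j = v then 1 else 0"])
      fix j p assume "poly_over F p" "poly p (x v) = 0"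
      then have "p = 0" using trans by blast
      then show "pd (if j = v then \<lambda>_. 0 else D j) (x v) (if j = v then 1 else 0) p = 0"
        by (simp add: pd_def)
    qed (use v D FG G01 deriv_on_zero in auto)
    moreover have "card Q \<le> card (insert v Q)" using fin by (intro card_mono) auto
    ultimately show ?thesis by (intro exI[of _ "insert v Q"]) blast
  next
    case False
    let ?R = "\<lambda>p. poly_over F p \<and> poly p (x v) = 0 \<and> p \<noteq> 0"
    obtain p0 where "?R p0" using False by blast
    then obtain \<mu> where \<mu>: "?R \<mu>" and least: "\<And>p. ?R p \<Longrightarrow> degree \<mu> \<le> degree p"
      using ex_has_least_nat[of ?R p0 degree] by blast
    have min: "p = 0" if "poly_over F p" "poly p (x v) = 0" "degree p < degree \<mu>" for p
      using that least[of p] by fastforce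
    have compat: "pd \<delta> (x v) \<eta> p = 0"
      if "deriv_on F \<delta>" "pd \<delta> (x v) \<eta> \<mu> = 0" "poly_over F p" "poly p (x v) = 0" for \<delta> \<eta> p
      by (rule pd_compatible[OF F that(1), of \<mu>]) (use \<mu> that min in auto)
    define s where "s = poly (pderiv \<mu>) (x v)"
    define c where "c j = poly (map_poly (D j) \<mu>) (x v)" for j
    have pd\<mu>: "pd (D j) (x v) \<eta> \<mu> = c j + s * \<eta>" for j \<eta> by (simp add: pd_def c_def s_def)
    have cG: "c j \<in> ?G" if "j \<in> Q" for j
      unfolding c_def using that \<mu> D(2) FG
      by (intro polyG) (auto simp: poly_over_def coeff_map_poly D0)
    have sG: "s \<in> ?G"
    proof -
      have "of_nat k * coeff \<mu> m \<in> F" for k m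
        using \<mu> is_subfieldD(1,3)[OF F] by (induction k) (auto simp: poly_over_def algebra_simps)
      then have "coeff (pderiv \<mu>) i \<in> F" for i unfolding coeff_pderiv .
      then show ?thesis unfolding s_def using FG by (intro polyG) (auto simp: poly_over_def)
    qed
    \<comment> \<open>The condition for extending \<open>D j\<close> with value
      \<open>\<eta>\<close> at \<open>x v\<close> is \<open>c j + s * \<eta> = 0\<close>.\<close>
    consider (sep) "s \<noteq> 0" | (insep) "s = 0" "\<forall>j\<in>Q. c j = 0" | (drop) j0 where "s = 0" "j0 \<in> Q" "c j0 \<noteq> 0"
      by blast
    then show ?thesis
    proof cases
      case sep
      have "\<exists>D'. dersys C ?G x Q D'"
      proof (rule dersys_adj[OF sys, where \<delta> = D and \<eta> = "\<lambda>j. - c j / s"])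
        fix j p assume j: "j \<in> Q" and p: "poly_over F p" "poly p (x v) = 0"
        show "pd (D j) (x v) (- c j / s) p = 0"
          by (rule compat[OF D(1)[OF j] _ p]) (simp add: pd\<mu> sep)
      next
        fix j assume "j \<in> Q"
        then show "- c j / s \<in> ?G" by (intro is_subfieldD(8)[OF G] is_subfieldD(5)[OF G] cG sG)
      qed (use v D FG in auto)
      then show ?thesis using False by (intro exI[of _ Q]) auto
    next
      case insep
      have "\<exists>D'. dersys C ?G x (insert v Q) D'"
      proof (rule dersys_adj[OF sys order_refl,
            where \<delta> = "\<lambda>j. if j = v then \<lambda>_. 0 else D j" and \<eta> = "\<lambda>j. if j = v then 1 else 0"])
        fix j p assume j: "j \<in> insert v Q" and p: "poly_over F p" "poly p (x v) = 0"
        show "pd (if j = v then \<lambda>_. 0 else D j) (x v) (if j = v then 1 else 0) p = 0"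
        proof (cases "j = v")
          case True
          have "pd (\<lambda>_. 0) (x v) 1 p = 0"
            by (rule compat[OF deriv_on_zero _ p]) (simp add: pd_zero insep(1) flip: s_def)
          then show ?thesis using True by simp
        next
          case False
          then have jQ: "j \<in> Q" using j by simp
          have "pd (D j) (x v) 0 p = 0"
            by (rule compat[OF D(1)[OF jQ] _ p]) (simp add: pd\<mu> insep(2) jQ)
          then show ?thesis using False by simp
        qed
      qed (use v D FG G01 deriv_on_zero in auto)
      moreover have "card Q \<le> card (insert v Q)" using fin by (intro card_mono) auto
      ultimately show ?thesis using False by (intro exI[of _ "insert v Q"]) blast
    next
      case drop
      \<comment> \<open>Subtracting this multiple of \<open>D j0\<close> cancels \<open>c j\<close>.
        The index \<open>j0\<close> is lost, but since \<open>s\<close> is 0 the derivation with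
        respect to \<open>x v\<close> replaces it.\<close>
      define w where "w j = c j / c j0" for j
      define \<delta> where "\<delta> j = (if j = v then \<lambda>_. 0 else (\<lambda>a. D j a - w j * D j0 a))" for j
      let ?Q' = "insert v (Q - {j0})"
      have jv: "j0 \<noteq> v" using drop v by blast
      have d\<delta>: "deriv_on F (\<delta> j)" if "j \<in> ?Q'" for j
        using that D(1)[of j] D(1)[OF drop(2)]
        by (auto simp: \<delta>_def deriv_on_def algebra_simps)
      have wG: "w j \<in> ?G" if "j \<in> Q" for j
        unfolding w_def using that drop(2) by (intro is_subfieldD(8)[OF G] cG)
      have "\<exists>D'. dersys C ?G x ?Q' D'"
      proof (rule dersys_adj[OF sys, where \<delta> = \<delta> and \<eta> = "\<lambda>j. if j = v then 1 else 0"])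
        fix j p assume j: "j \<in> ?Q'" and p: "poly_over F p" "poly p (x v) = 0"
        show "pd (\<delta> j) (x v) (if j = v then 1 else 0) p = 0"
        proof (rule compat[OF d\<delta>[OF j] _ p], cases "j = v")
          case True
          then show "pd (\<delta> j) (x v) (if j = v then 1 else 0) \<mu> = 0"
            using drop(1) by (simp add: \<delta>_def pd_zero s_def)
        next
          case jnv: False
          then have jQ: "j \<in> Q" using j by simp
          have "map_poly (\<delta> j) \<mu> = map_poly (D j) \<mu> - smult (w j) (map_poly (D j0) \<mu>)"
            using jnv by (intro poly_eqI) (simp add: \<delta>_def coeff_map_poly D0[OF jQ] D0[OF drop(2)])
          then have "poly (map_poly (\<delta> j) \<mu>) (x v) = c j - w j * c j0" by (simp add: c_def)
          also have "\<dots> = 0" using drop(3) by (simp add: w_def)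
          finally show "pd (\<delta> j) (x v) (if j = v then 1 else 0) \<mu> = 0" using jnv by (simp add: pd_def)
        qed
      next
        fix j a assume j: "j \<in> ?Q'" and a: "a \<in> F"
        show "\<delta> j a \<in> ?G"
        proof (cases "j = v")
          case True
          then show ?thesis by (simp add: \<delta>_def G01)
        next
          case jv': False
          then have jQ: "j \<in> Q" using j by simp
          have "D j a \<in> ?G" "D j0 a \<in> ?G" using D(2)[OF jQ a] D(2)[OF drop(2) a] FG by auto
          then have "D j a - w j * D j0 a \<in> ?G"
            by (intro is_subfieldD(7)[OF G] is_subfieldD(4)[OF G] wG jQ)
          then show ?thesis using jv' by (simp add: \<delta>_def)
        qed
      next
        fix j k assume "j \<in> ?Q'" "k \<in> ?Q'" "k \<noteq> v"
        then show "\<delta> j (x k) = (if j = k then 1 else 0)"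
          using D(4)[of j k] D(4)[OF drop(2), of k] by (auto simp: \<delta>_def)
      next
        fix j assume "j \<in> ?Q'"
        show "(if j = v then 1 else 0) \<in> ?G" using G01 by simp
      next
        fix j k assume "j \<in> ?Q'" "k \<in> C"
        then show "\<delta> j k = 0" using D(3)[of j k] D(3)[OF drop(2), of k] by (auto simp: \<delta>_def)
      qed (use d\<delta> in auto)
      moreover have "card ?Q' = card Q"
        using v fin card_Suc_Diff1[OF fin drop(2)] by (simp only: card_insert_disjoint finite_Diff Diff_iff simp_thms)
      ultimately show ?thesis using False by (intro exI[of _ ?Q']) auto
    qed
  qed
qed

section \<open>Derivations of the function field\<close>

text \<open>With \<open>E\<close> as evaluation at a point, this is the field generated by the
  constants and the coordinates in \<open>V\<close> of that point.\<close>

definition rat_field :: "((('v \<Rightarrow> 'k::comm_ring_1) \<Rightarrow> 'k) \<Rightarrow> 'l::field) \<Rightarrow> 'v set \<Rightarrow> 'l set" where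
  "rat_field E V = {E a / E b | a b. a \<in> pf V \<and> b \<in> pf V \<and> E b \<noteq> 0}"

context
  fixes E :: "(('v \<Rightarrow> 'k::field) \<Rightarrow> 'k) \<Rightarrow> 'l::field" and J :: "'v set"
  assumes inf: "infinite (UNIV :: 'k set)"
    and E_add: "\<And>p q. E (\<lambda>s. p s + q s) = E p + E q"
    and E_mult: "\<And>p q. E (\<lambda>s. p s * q s) = E p * E q"
    and E_1: "E (\<lambda>_. 1) = 1"
    and E_inj: "\<And>q. q \<in> pf J \<Longrightarrow> E q = 0 \<Longrightarrow> \<forall>y. q y = 0"
begin

lemma E_0: "E (\<lambda>_. 0) = 0"
proof -
  have "E (\<lambda>_. 0) = E (\<lambda>_. 0) + E (\<lambda>_. 0)" using E_add[of "\<lambda>_. 0" "\<lambda>_. 0"] by simp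
  then show ?thesis by (metis add_cancel_right_right)
qed

lemma E_uminus: "E (\<lambda>s. - p s) = - E p"
  using E_add[of p "\<lambda>s. - p s"] E_0 by (simp add: add_eq_0_iff)

lemma E_sum: "E (\<lambda>s. \<Sum>i\<in>A. f i s) = (\<Sum>i\<in>A. E (f i))"
  by (induction A rule: infinite_finite_induct) (simp_all add: E_0 E_add)

lemma E_prod: "E (\<lambda>s. \<Prod>i\<in>A. f i s) = (\<Prod>i\<in>A. E (f i))"
  by (induction A rule: infinite_finite_induct) (simp_all add: E_1 E_mult)

lemma E_power: "E (\<lambda>s. p s ^ k) = E p ^ k"
  by (induction k) (simp_all add: E_1 E_mult)

lemma rat_fieldI: "a \<in> pf V \<Longrightarrow> b \<in> pf V \<Longrightarrow> E b \<noteq> 0 \<Longrightarrow> y = E a / E b \<Longrightarrow> y \<in> rat_field E V"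
  unfolding rat_field_def by blast

lemma rat_fieldE:
  assumes "y \<in> rat_field E V"
  obtains a b where "a \<in> pf V" "b \<in> pf V" "E b \<noteq> 0" "y = E a / E b"
  using assms unfolding rat_field_def by blast

lemma pf_in_rat_field: "a \<in> pf V \<Longrightarrow> E a \<in> rat_field E V"
  by (rule rat_fieldI[of a V "\<lambda>_. 1"]) (auto simp: E_1 intro: pf_const)

lemma subfield_rat_field: "is_subfield (rat_field E V)"
proof -
  have "y + z \<in> rat_field E V \<and> y * z \<in> rat_field E V" if yz: "y \<in> rat_field E V" "z \<in> rat_field E V" for y z
  proof -
    obtain a b where a: "a \<in> pf V" "b \<in> pf V" "E b \<noteq> 0" "y = E a / E b" using yz(1) by (rule rat_fieldE)
    obtain c d where c: "c \<in> pf V" "d \<in> pf V" "E d \<noteq> 0" "z = E c / E d" using yz(2) by (rule rat_fieldE)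
    have bd: "(\<lambda>s. b s * d s) \<in> pf V" using a c by (intro pf_mult)
    have "y + z \<in> rat_field E V"
      by (rule rat_fieldI[OF _ bd, of "\<lambda>s. a s * d s + c s * b s"])
         (use a c in \<open>auto intro: pf_add pf_mult simp: E_add E_mult add_frac_eq\<close>)
    moreover have "y * z \<in> rat_field E V"
      by (rule rat_fieldI[OF _ bd, of "\<lambda>s. a s * c s"])
         (use a c in \<open>auto intro: pf_mult simp: E_mult\<close>)
    ultimately show ?thesis by blast
  qed
  moreover have "- y \<in> rat_field E V \<and> inverse y \<in> rat_field E V" if y: "y \<in> rat_field E V" for y
  proof -
    obtain a b where a: "a \<in> pf V" "b \<in> pf V" "E b \<noteq> 0" "y = E a / E b" using y by (rule rat_fieldE)
    have "- y \<in> rat_field E V"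
      by (rule rat_fieldI[of "\<lambda>s. - a s" V b]) (use a in \<open>auto intro: pf_uminus simp: E_uminus\<close>)
    moreover have "inverse y \<in> rat_field E V"
    proof (cases "E a = 0")
      case True
      then show ?thesis using pf_in_rat_field[OF pf_const, of 0 V] a E_0 by simp
    next
      case False
      then show ?thesis by (intro rat_fieldI[of b V a]) (use a in auto)
    qed
    ultimately show ?thesis by blast
  qed
  moreover have "0 \<in> rat_field E V" "1 \<in> rat_field E V"
    using pf_in_rat_field[OF pf_const, of 0 V] pf_in_rat_field[OF pf_const, of 1 V] E_0 E_1 by auto
  ultimately show ?thesis unfolding is_subfield_def by blast
qed

text \<open>Clearing denominators turns \<open>p\<close> into a polynomial \<open>R\<close> in the
  variables \<open>V\<close> and \<open>v\<close> that vanishes at the generic point. By injectivity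
  of \<open>E\<close> on \<open>pf J\<close> it vanishes identically, and so do its coefficients as
  a polynomial in \<open>v\<close>.\<close>

lemma transcendental_over_rat_field:
  assumes V: "V \<subseteq> J" "v \<in> J" "v \<notin> V" and p: "poly_over (rat_field E V) p" "poly p (E (\<lambda>s. s v)) = 0"
  shows "p = 0"
proof -
  have "\<forall>i. \<exists>a b. a \<in> pf V \<and> b \<in> pf V \<and> E b \<noteq> 0 \<and> coeff p i = E a / E b"
    using p(1) unfolding poly_over_def rat_field_def by blast
  then obtain a b where ab: "\<forall>i. a i \<in> pf V \<and> b i \<in> pf V \<and> E (b i) \<noteq> 0 \<and> coeff p i = E (a i) / E (b i)"
    unfolding choice_iff by (elim exE) (rule that)
  let ?n = "degree p"
  \<comment> \<open>Numerators over the common denominator of all coefficients of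
    \<open>p\<close>.\<close>
  define P where "P i s = a i s * (\<Prod>j\<in>{..?n} - {i}. b j s)" for i s
  have Ppf: "P i \<in> pf V" for i unfolding P_def[abs_def] using ab by (intro pf_mult pf_prod) auto
  define B where "B = (\<Prod>j\<le>?n. E (b j))"
  have B: "B \<noteq> 0" unfolding B_def using ab by simp
  have EP: "E (P i) = coeff p i * B" if i: "i \<le> ?n" for i
  proof -
    have "B = E (b i) * (\<Prod>j\<in>{..?n} - {i}. E (b j))"
      unfolding B_def using i by (intro prod.remove) auto
    then show ?thesis using spec[OF ab, of i] by (simp add: P_def[abs_def] E_mult E_prod)
  qed
  define R where "R s = (\<Sum>i\<le>?n. P i s * s v ^ i)" for s
  have Rpf: "R \<in> pf J"
    unfolding R_def[abs_def] using V by (intro pf_sum pf_mult pf_power pf_var pf_mono[OF Ppf])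
  have "E R = (\<Sum>i\<le>?n. coeff p i * B * E (\<lambda>s. s v) ^ i)"
    unfolding R_def[abs_def] by (simp add: E_sum E_mult E_power EP)
  also have "\<dots> = B * poly p (E (\<lambda>s. s v))"
    by (simp add: poly_altdef sum_distrib_left algebra_simps)
  finally have R0: "\<forall>y. R y = 0" using E_inj[OF Rpf] p(2) by simp
  have "P i y = 0" if i: "i \<le> ?n" for i y
  proof -
    define r where "r = (\<Sum>i\<le>?n. monom (P i y) i)"
    have "poly r l = 0" for l
    proof -
      \<comment> \<open>\<open>P i\<close> does not involve the coordinate \<open>v\<close>, so
        varying it alone turns \<open>R\<close> into a univariate polynomial that vanishes
        everywhere on an infinite field.\<close>
      have "P i (y(v := l)) = P i y" for i
        by (rule pf_cong[OF Ppf]) (use V in auto)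
      then have "poly r l = R (y(v := l))" by (simp add: r_def R_def poly_sum poly_monom)
      then show ?thesis using R0 by simp
    qed
    then have "r = 0" using inf poly_roots_finite[of r] by auto
    then have "coeff r i = 0" by simp
    then show ?thesis using i by (simp add: r_def coeff_sum)
  qed
  then have "P i = (\<lambda>_. 0)" if "i \<le> ?n" for i using that by (simp add: fun_eq_iff)
  then have "coeff p i = 0" if "i \<le> ?n" for i using EP[OF that] E_0 B that by simp
  then have "lead_coeff p = 0" by simp
  then show ?thesis by simp
qed

text \<open>Each free coordinate is transcendental over the field of the previous ones, so none is
  lost from the dual system. The bound by \<open>rat_field\<close> is carried along to prove
  transcendence.\<close>

lemma dersys_free:
  assumes "finite V" "V \<subseteq> J"
  shows "\<exists>F D. dersys (range (\<lambda>c. E (\<lambda>_. c))) F (\<lambda>v. E (\<lambda>s. s v)) V D \<and> F \<subseteq> rat_field E V"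
  using assms
proof (induction V rule: finite_induct)
  case empty
  have "is_subfield (rat_field E {})" by (rule subfield_rat_field)
  moreover have "range (\<lambda>c. E (\<lambda>_. c)) \<subseteq> rat_field E {}" using pf_in_rat_field[OF pf_const] by auto
  ultimately have "dersys (range (\<lambda>c. E (\<lambda>_. c))) (rat_field E {}) (\<lambda>v. E (\<lambda>s. s v)) {} (\<lambda>_ _. 0)"
    by (simp add: dersys_def)
  then show ?case by blast
next
  case (insert v V)
  let ?C = "range (\<lambda>c. E (\<lambda>_. c))" and ?x = "\<lambda>v. E (\<lambda>s. s v)"
  obtain F D where sys: "dersys ?C F ?x V D" and F: "F \<subseteq> rat_field E V" using insert by auto
  have sF: "is_subfield F" using sys by (simp add: dersys_def)
  have "p = 0" if p: "poly_over F p" "poly p (?x v) = 0" for p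
  proof (rule transcendental_over_rat_field[of V v])
    show "poly_over (rat_field E V) p" using p(1) F by (auto simp: poly_over_def)
  qed (use insert p in auto)
  then obtain D' where D': "dersys ?C (adj F (?x v)) ?x (insert v V) D'"
    using dersys_step[OF sys insert.hyps(1,2)] by blast
  have "rat_field E V \<subseteq> rat_field E (insert v V)"
  proof
    fix y assume "y \<in> rat_field E V"
    then show "y \<in> rat_field E (insert v V)"
      by (elim rat_fieldE) (rule rat_fieldI, auto elim: pf_mono)
  qed
  then have "adj F (?x v) \<subseteq> rat_field E (insert v V)"
    using F by (intro adj_least[OF sF] subfield_rat_field pf_in_rat_field pf_var) auto
  then show ?case using D' by blast
qed

text \<open>The remaining coordinates may be algebraic. Adjoining them can move \<open>Q\<close> to
  coordinates outside \<open>J\<close>, but never makes it smaller than \<open>J\<close>.\<close>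

lemma dersys_all:
  assumes "finite J" "finite W"
  shows "\<exists>F Q D. dersys (range (\<lambda>c. E (\<lambda>_. c))) F (\<lambda>v. E (\<lambda>s. s v)) Q D \<and> Q \<subseteq> J \<union> W \<and> card J \<le> card Q \<and>
    (\<forall>v\<in>J \<union> W. E (\<lambda>s. s v) \<in> F)"
  using assms(2)
proof (induction W rule: finite_induct)
  case empty
  obtain F D where sys: "dersys (range (\<lambda>c. E (\<lambda>_. c))) F (\<lambda>v. E (\<lambda>s. s v)) J D"
    using dersys_free[OF assms(1) order_refl] by blast
  then have "\<forall>v\<in>J. E (\<lambda>s. s v) \<in> F" by (simp add: dersys_def)
  then show ?case using sys by (intro exI[of _ F] exI[of _ J] exI[of _ D]) simp
next
  case (insert v W)
  let ?C = "range (\<lambda>c. E (\<lambda>_. c))" and ?x = "\<lambda>v. E (\<lambda>s. s v)"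
  obtain F Q D where sys: "dersys ?C F ?x Q D" and Q: "Q \<subseteq> J \<union> W" "card J \<le> card Q"
    and x: "\<forall>v\<in>J \<union> W. ?x v \<in> F"
    using insert.IH by blast
  have sF: "is_subfield F" using sys by (simp add: dersys_def)
  show ?case
  proof (cases "v \<in> J")
    case True
    then show ?thesis using sys Q x by (intro exI[of _ F] exI[of _ Q] exI[of _ D]) auto
  next
    case False
    then have "v \<notin> Q" using Q insert by auto
    moreover have "finite Q" using Q(1) assms(1) insert.hyps(1) by (meson finite_UnI finite_subset)
    ultimately obtain Q' D' where "Q' \<subseteq> insert v Q" "card Q \<le> card Q'" "dersys ?C (adj F (?x v)) ?x Q' D'"
      using dersys_step[OF sys] by blast
    then show ?thesis
      using Q x subset_adj[OF sF, of "?x v"] gen_in_adj[OF sF, of "?x v"]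
      by (intro exI[of _ "adj F (?x v)"] exI[of _ Q'] exI[of _ D']) auto
  qed
qed

end

section \<open>Iterated derivations of products\<close>

text \<open>Only derivations with index in \<open>A\<close> are applied, smallest index first; the
  order is fixed because they need not commute.\<close>

primrec iter_der :: "(nat \<Rightarrow> 'l \<Rightarrow> 'l) \<Rightarrow> nat \<Rightarrow> nat set \<Rightarrow> 'l \<Rightarrow> 'l" where
  "iter_der \<delta> 0 A y = y"
| "iter_der \<delta> (Suc k) A y = (if k \<in> A then \<delta> k (iter_der \<delta> k A y) else iter_der \<delta> k A y)"

lemma iter_der_cong:
  "(\<And>a. a < k \<Longrightarrow> a \<in> A \<longleftrightarrow> a \<in> B) \<Longrightarrow> (\<And>a. a < k \<Longrightarrow> a \<in> A \<Longrightarrow> \<delta> a = \<delta>' a) \<Longrightarrow>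
    iter_der \<delta> k A y = iter_der \<delta>' k B y"
  by (induction k) auto

lemma iter_der_empty [simp]: "iter_der \<delta> k {} y = y"
  by (induction k) auto

lemma iter_der_closed: "(\<And>i a. i < k \<Longrightarrow> a \<in> F \<Longrightarrow> \<delta> i a \<in> F) \<Longrightarrow> y \<in> F \<Longrightarrow> iter_der \<delta> k A y \<in> F"
  by (induction k) auto

lemma subfield_prod: "is_subfield F \<Longrightarrow> (\<And>i. i \<in> A \<Longrightarrow> f i \<in> F) \<Longrightarrow> prod f A \<in> F"
  by (induction A rule: infinite_finite_induct) (auto intro: is_subfieldD)

lemma deriv_prod:
  assumes F: "is_subfield F" and D: "deriv_on F D" and "finite A" "\<And>i. i \<in> A \<Longrightarrow> z i \<in> F"
  shows "D (\<Prod>i\<in>A. z i) = (\<Sum>l\<in>A. \<Prod>i\<in>A. if i = l then D (z i) else z i)"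
  using assms(3,4)
proof (induction A rule: finite_induct)
  case empty
  then show ?case using deriv_1[OF F D] by simp
next
  case (insert b A)
  have A: "prod z A \<in> F" using insert by (intro subfield_prod[OF F]) auto
  have "D (\<Prod>i\<in>insert b A. z i) = z b * D (prod z A) + D (z b) * prod z A"
    using insert A by (simp add: deriv_mult[OF F D])
  also have "z b * D (prod z A) = (\<Sum>l\<in>A. \<Prod>i\<in>insert b A. if i = l then D (z i) else z i)"
  proof -
    have "z b * (\<Prod>i\<in>A. if i = l then D (z i) else z i) = (\<Prod>i\<in>insert b A. if i = l then D (z i) else z i)"
      if "l \<in> A" for l
      using insert that by auto
    moreover have "z b * D (prod z A) = (\<Sum>l\<in>A. z b * (\<Prod>i\<in>A. if i = l then D (z i) else z i))"
      using insert.IH insert.prems by (simp add: sum_distrib_left)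
    ultimately show ?thesis by (simp only: cong: sum.cong)
  qed
  also have "D (z b) * prod z A = (\<Prod>i\<in>insert b A. if i = b then D (z i) else z i)"
  proof -
    have "(\<Prod>i\<in>A. if i = b then D (z i) else z i) = prod z A"
      using insert by (intro prod.cong) auto
    then show ?thesis using insert by simp
  qed
  finally show ?case using insert by (simp add: add.commute)
qed

text \<open>\<open>\<phi> a\<close> is the factor hit by derivation \<open>a\<close>, so factor
  \<open>i\<close> is differentiated by the fibre of \<open>\<phi>\<close> over
  \<open>i\<close>.\<close>

lemma iter_der_prod:
  assumes F: "is_subfield F" and \<delta>: "\<And>i. i < k \<Longrightarrow> deriv_on F (\<delta> i)" "\<And>i a. i < k \<Longrightarrow> a \<in> F \<Longrightarrow> \<delta> i a \<in> F"
    and A: "finite A" and y: "\<And>i. i \<in> A \<Longrightarrow> y i \<in> F"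
  shows "iter_der \<delta> k UNIV (\<Prod>i\<in>A. y i) =
    (\<Sum>\<phi>\<in>PiE {..<k} (\<lambda>_. A). \<Prod>i\<in>A. iter_der \<delta> k {a. a < k \<and> \<phi> a = i} (y i))"
  using \<delta>
proof (induction k)
  case 0
  then show ?case by simp
next
  case (Suc k)
  let ?\<Phi> = "PiE {..<k} (\<lambda>_. A)"
  define z where "z \<phi> i = iter_der \<delta> k {a. a < k \<and> \<phi> a = i} (y i)" for \<phi> i
  have zF: "z \<phi> i \<in> F" if "i \<in> A" for \<phi> i
    unfolding z_def using Suc.prems(2) y that by (intro iter_der_closed) auto
  have inj: "inj_on (\<lambda>(l, \<phi>). \<phi>(k := l)) (A \<times> ?\<Phi>)" by (rule inj_combinator) simp
  have PiE_Suc: "PiE {..<Suc k} (\<lambda>_. A) = (\<lambda>(l, \<phi>). \<phi>(k := l)) ` (A \<times> ?\<Phi>)"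
    unfolding lessThan_Suc PiE_insert_eq ..
  have upd: "iter_der \<delta> (Suc k) {a. a < Suc k \<and> (\<phi>(k := l)) a = i} (y i) =
      (if i = l then \<delta> k (z \<phi> i) else z \<phi> i)" for \<phi> l i
  proof -
    have "iter_der \<delta> k {a. a < Suc k \<and> (\<phi>(k := l)) a = i} (y i) = z \<phi> i"
      unfolding z_def by (rule iter_der_cong) auto
    then show ?thesis
      by (simp only: iter_der.simps mem_Collect_eq fun_upd_same lessI simp_thms eq_commute[of l i])
  qed
  have "iter_der \<delta> (Suc k) UNIV (\<Prod>i\<in>A. y i) = \<delta> k (\<Sum>\<phi>\<in>?\<Phi>. \<Prod>i\<in>A. z \<phi> i)"
    using Suc by (simp add: z_def)
  also have "\<dots> = (\<Sum>\<phi>\<in>?\<Phi>. \<delta> k (\<Prod>i\<in>A. z \<phi> i))"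
    using Suc.prems(1) zF by (intro deriv_sum[OF F] subfield_prod[OF F]) auto
  also have "\<dots> = (\<Sum>\<phi>\<in>?\<Phi>. \<Sum>l\<in>A. \<Prod>i\<in>A. if i = l then \<delta> k (z \<phi> i) else z \<phi> i)"
    using Suc.prems(1) zF A by (intro sum.cong refl deriv_prod[OF F]) auto
  also have "\<dots> = (\<Sum>\<phi>\<in>?\<Phi>. \<Sum>l\<in>A. \<Prod>i\<in>A. iter_der \<delta> (Suc k) {a. a < Suc k \<and> (\<phi>(k := l)) a = i} (y i))"
    by (simp only: upd)
  also have "\<dots> = (\<Sum>(l, \<phi>)\<in>A \<times> ?\<Phi>. \<Prod>i\<in>A. iter_der \<delta> (Suc k) {a. a < Suc k \<and> (\<phi>(k := l)) a = i} (y i))"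
    by (subst sum.swap) (simp only: sum.cartesian_product)
  also have "\<dots> = (\<Sum>\<phi>\<in>PiE {..<Suc k} (\<lambda>_. A). \<Prod>i\<in>A. iter_der \<delta> (Suc k) {a. a < Suc k \<and> \<phi> a = i} (y i))"
    unfolding PiE_Suc by (subst sum.reindex[OF inj]) (simp only: case_prod_unfold comp_def)
  finally show ?case .
qed

lemma iter_der_linear:
  assumes F: "is_subfield F" and \<delta>: "\<And>i. i < k \<Longrightarrow> deriv_on F (\<delta> i)" "\<And>i a. i < k \<Longrightarrow> a \<in> F \<Longrightarrow> \<delta> i a \<in> F"
    and c: "\<And>s. s \<in> T \<Longrightarrow> c s \<in> F" "\<And>i s. i < k \<Longrightarrow> s \<in> T \<Longrightarrow> \<delta> i (c s) = 0" and y: "\<And>s. s \<in> T \<Longrightarrow> y s \<in> F"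
  shows "iter_der \<delta> k A (\<Sum>s\<in>T. c s * y s) = (\<Sum>s\<in>T. c s * iter_der \<delta> k A (y s))"
  using \<delta> c(2)
proof (induction k)
  case 0
  then show ?case by simp
next
  case (Suc k)
  have IH: "iter_der \<delta> k A (\<Sum>s\<in>T. c s * y s) = (\<Sum>s\<in>T. c s * iter_der \<delta> k A (y s))"
    using Suc by simp
  have D: "deriv_on F (\<delta> k)" using Suc.prems by simp
  have yF: "iter_der \<delta> k A (y s) \<in> F" if "s \<in> T" for s
    using Suc.prems(2) y that by (intro iter_der_closed) auto
  have "\<delta> k (\<Sum>s\<in>T. c s * iter_der \<delta> k A (y s)) = (\<Sum>s\<in>T. \<delta> k (c s * iter_der \<delta> k A (y s)))"
    using c(1) yF by (intro deriv_sum[OF F D] is_subfieldD(4)[OF F]) auto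
  also have "\<dots> = (\<Sum>s\<in>T. c s * \<delta> k (iter_der \<delta> k A (y s)))"
    using c(1) yF Suc.prems(3) by (intro sum.cong) (auto simp: deriv_mult[OF F D])
  finally show ?case using IH by simp
qed

text \<open>The expansion is sorted by the first factor from which \<open>v\<close> is taken; later
  factors stay together, so every remainder term has one marked factor \<open>v i\<close>.\<close>

lemma prod_add_telescope:
  fixes u v :: "nat \<Rightarrow> 'a::comm_ring_1"
  shows "(\<Prod>i<k. u i + v i) = (\<Prod>i<k. u i) +
    (\<Sum>i<k. (\<Prod>i'<i. u i') * v i * (\<Prod>i'\<in>{Suc i..<k}. u i' + v i'))"
proof (induction k)
  case (Suc k)
  have "(\<Sum>i<k. (\<Prod>i'<i. u i') * v i * (\<Prod>i'\<in>{Suc i..<Suc k}. u i' + v i')) =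
      (\<Sum>i<k. (\<Prod>i'<i. u i') * v i * (\<Prod>i'\<in>{Suc i..<k}. u i' + v i')) * (u k + v k)"
    unfolding sum_distrib_right by (intro sum.cong) (auto simp: prod.atLeastLessThan_Suc mult.assoc)
  then show ?case using Suc by (simp add: algebra_simps)
qed simp

section \<open>Decomposing the tensor\<close>

text \<open>For fixed \<open>\<tau>\<close> the equation at \<open>x\<close> is differentiated by
  the derivations dual to \<open>x (i, \<tau> i)\<close>. If all coordinates belonged to
  \<open>Q\<close>, the Leibniz terms would add up to \<open>c \<tau> w\<close>. Each actual
  derivative \<open>h\<close> is split into an ideal value \<open>u\<close> and an error
  \<open>\<alpha>\<close>, which vanishes on \<open>Q\<close> and for empty \<open>A\<close>. The
  first error in a term becomes the left factor, everything else goes into \<open>\<beta>\<close>.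
  The derivations indexed by \<open>A\<close> are used up by \<open>\<alpha> A v\<close>, so the
  dependence on \<open>\<tau>\<close> splits along \<open>A\<close> and its complement.\<close>

lemma tensor_decomposition:
  fixes D :: "nat \<times> nat \<Rightarrow> 'l::field \<Rightarrow> 'l" and x :: "nat \<times> nat \<Rightarrow> 'l"
    and c :: "(nat \<Rightarrow> nat) \<Rightarrow> 'w \<Rightarrow> 'l"
  defines "box k n \<equiv> PiE {..<k} (\<lambda>i. {..<n i})"
  assumes sys: "dersys C F x Q D"
    and xF: "\<And>v. v \<in> Sigma {..<k} (\<lambda>i. {..<n i}) \<Longrightarrow> x v \<in> F"
    and cC: "\<And>\<sigma> w. \<sigma> \<in> box k n \<Longrightarrow> c \<sigma> w \<in> C"
    and zero: "\<And>w. w \<in> W \<Longrightarrow> (\<Sum>\<sigma>\<in>box k n. c \<sigma> w * (\<Prod>i<k. x (i, \<sigma> i))) = 0"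
  shows "\<exists>\<alpha> \<beta>. (\<forall>\<tau>\<in>box k n. \<forall>w\<in>W. c \<tau> w =
        (\<Sum>(A, v)\<in>(Pow {..<k} - {{}}) \<times> (Sigma {..<k} (\<lambda>i. {..<n i}) - Q). \<alpha> A v \<tau> * \<beta> A v \<tau> w)) \<and>
      (\<forall>A v \<tau> \<tau>'. (\<forall>i\<in>A. \<tau> i = \<tau>' i) \<longrightarrow> \<alpha> A v \<tau> = \<alpha> A v \<tau>') \<and>
      (\<forall>A v \<tau> \<tau>' w. (\<forall>i\<in>{..<k} - A. \<tau> i = \<tau>' i) \<longrightarrow> \<beta> A v \<tau> w = \<beta> A v \<tau>' w)"
proof -
  let ?I = "Sigma {..<k} (\<lambda>i. {..<n i})" and ?\<Phi> = "PiE {..<k} (\<lambda>_. {..<k})"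
  let ?Idx = "(Pow {..<k} - {{}}) \<times> (?I - Q)"
  have F: "is_subfield F" and CF: "C \<subseteq> F" using sys by (auto simp: dersys_def)
  have D: "\<And>j. j \<in> Q \<Longrightarrow> deriv_on F (D j)" "\<And>j a. j \<in> Q \<Longrightarrow> a \<in> F \<Longrightarrow> D j a \<in> F"
      "\<And>j c. j \<in> Q \<Longrightarrow> c \<in> C \<Longrightarrow> D j c = 0"
      "\<And>j k. j \<in> Q \<Longrightarrow> k \<in> Q \<Longrightarrow> D j (x k) = (if j = k then 1 else 0)"
    using sys unfolding dersys_def by blast+
  \<comment> \<open>Where no dual derivation exists the zero derivation is used; the error term
    absorbs the difference.\<close>
  define \<delta> where "\<delta> \<tau> i = (if (i, \<tau> i) \<in> Q then D (i, \<tau> i) else (\<lambda>_. 0))" for \<tau> :: "nat \<Rightarrow> nat" and i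
  have \<delta>: "deriv_on F (\<delta> \<tau> i)" "a \<in> F \<Longrightarrow> \<delta> \<tau> i a \<in> F" "a \<in> C \<Longrightarrow> \<delta> \<tau> i a = 0" for \<tau> i a
    unfolding \<delta>_def using D is_subfieldD(1)[OF F] by (auto simp: deriv_on_zero)
  define h where "h \<tau> A v = iter_der (\<delta> \<tau>) k A (x v)" for \<tau> A v
  \<comment> \<open>Ideal behaviour: a first derivative is 0 or 1, and every higher derivative is
    0.\<close>
  define u where "u \<tau> A v = (if A = {} then x v else if A = {fst v} \<and> snd v = \<tau> (fst v) then 1 else 0)"
    for \<tau> :: "nat \<Rightarrow> nat" and A v
  define \<alpha> where "\<alpha> A v \<tau> = h \<tau> A v - u \<tau> A v" for A v \<tau>
  define fib where "fib \<phi> i = {a. a < k \<and> \<phi> a = i}" for \<phi> :: "nat \<Rightarrow> nat" and i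
  define rest where "rest \<tau> \<phi> \<sigma> i = (\<Prod>i'<i. u \<tau> (fib \<phi> i') (i', \<sigma> i')) *
      (\<Prod>i'\<in>{Suc i..<k}. h \<tau> (fib \<phi> i') (i', \<sigma> i'))" for \<tau> \<phi> \<sigma> i
  \<comment> \<open>Collects the cofactors of all occurrences of \<open>\<alpha> A v\<close>, with
    the sign from moving them to the other side.\<close>
  define \<beta> where "\<beta> A v \<tau> w = - (\<Sum>\<sigma>\<in>box k n. \<Sum>\<phi>\<in>?\<Phi>. \<Sum>i<k.
      if (A, v) = (fib \<phi> i, (i, \<sigma> i)) then c \<sigma> w * rest \<tau> \<phi> \<sigma> i else 0)" for A v \<tau> w
  have fin: "finite (box k n)" "finite ?\<Phi>" "finite ?Idx"
    unfolding box_def by (auto intro!: finite_PiE)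
  have h_Q: "h \<tau> A v = u \<tau> A v" if v: "v \<in> Q" and A: "A \<subseteq> {..<k}" "A \<noteq> {}" for \<tau> A v
  proof -
    have "iter_der (\<delta> \<tau>) m A (x v) = (if A \<inter> {..<m} = {} then x v
        else if A \<inter> {..<m} = {fst v} \<and> snd v = \<tau> (fst v) then 1 else 0)" for m
    proof (induction m)
      case (Suc m)
      have 01: "\<delta> \<tau> m 0 = 0" "\<delta> \<tau> m 1 = 0"
        using deriv_0[OF F \<delta>(1)] deriv_1[OF F \<delta>(1)] by auto
      show ?case
      proof (cases "m \<in> A")
        case False
        then have "A \<inter> {..<Suc m} = A \<inter> {..<m}" by (auto simp: less_Suc_eq)
        then show ?thesis using Suc False by simp
      next
        case True
        then have ins: "A \<inter> {..<Suc m} = insert m (A \<inter> {..<m})" by (auto simp: less_Suc_eq)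
        show ?thesis
        proof (cases "A \<inter> {..<m} = {}")
          case empty: True
          have "\<delta> \<tau> m (x v) = (if (m, \<tau> m) = v then 1 else 0)"
            unfolding \<delta>_def using D(4)[OF _ v] v by auto
          then show ?thesis using Suc True empty ins by (cases v) auto
        next
          case ne: False
          then obtain b where "b \<in> A" "b < m" by auto
          have two: "A \<inter> {..<Suc m} \<noteq> {fst v}"
          proof
            assume eq: "A \<inter> {..<Suc m} = {fst v}"
            have "m \<in> {fst v}" "b \<in> {fst v}"
              unfolding eq[symmetric] using True \<open>b \<in> A\<close> \<open>b < m\<close> by simp_all
            then show False using \<open>b < m\<close> by simp
          qed
          have "\<delta> \<tau> m (iter_der (\<delta> \<tau>) m A (x v)) = 0"
            unfolding Suc using ne 01 by simp
          moreover have "A \<inter> {..<Suc m} \<noteq> {}" unfolding ins by simp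
          ultimately show ?thesis using True two by (simp only: iter_der.simps if_True if_False simp_thms)
        qed
      qed
    qed simp
    from this[of k] show ?thesis using A by (simp add: h_def u_def Int_absorb2)
  qed
  have \<alpha>0: "\<alpha> A v \<tau> = 0" if "v \<in> Q \<or> A = {}" "A \<subseteq> {..<k}" for A v \<tau>
    using that h_Q by (cases "A = {}") (auto simp: \<alpha>_def h_def u_def)
  have fib_sub: "fib \<phi> i \<subseteq> {..<k}" for \<phi> i by (auto simp: fib_def)
  have leading: "(\<Prod>i<k. u \<tau> (fib \<phi> i) (i, \<sigma> i)) = (if \<phi> = restrict id {..<k} \<and> \<sigma> = \<tau> then 1 else 0)"
    if \<tau>: "\<tau> \<in> box k n" and \<sigma>: "\<sigma> \<in> box k n" and \<phi>: "\<phi> \<in> ?\<Phi>" for \<tau> \<sigma> \<phi>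
  proof (cases "\<forall>i<k. \<phi> i = i")
    case True
    then have \<phi>_id: "\<phi> = restrict id {..<k}"
      using \<phi> by (intro PiE_ext[OF \<phi>]) auto
    have "fib \<phi> i = {i}" if "i < k" for i using True that by (auto simp: fib_def)
    then have "(\<Prod>i<k. u \<tau> (fib \<phi> i) (i, \<sigma> i)) = (\<Prod>i<k. if \<sigma> i = \<tau> i then 1 else 0)"
      by (intro prod.cong) (auto simp: u_def)
    also have "\<dots> = (if \<forall>i<k. \<sigma> i = \<tau> i then 1 else 0)" by (auto intro: prod_zero)
    also have "(\<forall>i<k. \<sigma> i = \<tau> i) \<longleftrightarrow> \<sigma> = \<tau>"
      using \<sigma> \<tau> PiE_ext[of \<sigma> "{..<k}" "\<lambda>i. {..<n i}" \<tau>] unfolding box_def by auto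
    finally have r: "(\<Prod>i<k. u \<tau> (fib \<phi> i) (i, \<sigma> i)) = (if \<sigma> = \<tau> then 1 else 0)" .
    show ?thesis unfolding r by (simp only: \<phi>_id simp_thms)
  next
    case False
    \<comment> \<open>The factor \<open>\<phi> a\<close> is hit by the foreign derivation
      \<open>a\<close>, so its ideal value is 0.\<close>
    then obtain a where a: "a < k" "\<phi> a \<noteq> a" by blast
    have "\<phi> a < k" using \<phi> a(1) by auto
    moreover have "u \<tau> (fib \<phi> (\<phi> a)) (\<phi> a, \<sigma> (\<phi> a)) = 0"
    proof -
      have "a \<in> fib \<phi> (\<phi> a)" using a by (simp add: fib_def)
      then have "fib \<phi> (\<phi> a) \<noteq> {}" "fib \<phi> (\<phi> a) \<noteq> {\<phi> a}" using a(2) by auto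
      then show ?thesis by (simp add: u_def)
    qed
    ultimately have "(\<Prod>i<k. u \<tau> (fib \<phi> i) (i, \<sigma> i)) = 0" by (intro prod_zero) auto
    moreover have "\<phi> \<noteq> restrict id {..<k}" using a by auto
    ultimately show ?thesis by simp
  qed
  have "c \<tau> w = (\<Sum>(A, v)\<in>?Idx. \<alpha> A v \<tau> * \<beta> A v \<tau> w)" if \<tau>: "\<tau> \<in> box k n" and w: "w \<in> W" for \<tau> w
  proof -
    have xF': "x (i, \<sigma> i) \<in> F" if "\<sigma> \<in> box k n" "i < k" for \<sigma> i
      using that by (intro xF) (auto simp: box_def)
    have prodF: "(\<Prod>i<k. x (i, \<sigma> i)) \<in> F" if "\<sigma> \<in> box k n" for \<sigma>
      using xF' that by (intro subfield_prod[OF F]) auto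
    have r\<Phi>: "restrict id {..<k} \<in> ?\<Phi>" by (simp add: restrict_PiE_iff)
    have "iter_der (\<delta> \<tau>) k UNIV 0 = 0"
      using deriv_0[OF F \<delta>(1)] by (induction k) auto
    then have "0 = iter_der (\<delta> \<tau>) k UNIV (\<Sum>\<sigma>\<in>box k n. c \<sigma> w * (\<Prod>i<k. x (i, \<sigma> i)))"
      using zero[OF w] by simp
    also have "\<dots> = (\<Sum>\<sigma>\<in>box k n. c \<sigma> w * iter_der (\<delta> \<tau>) k UNIV (\<Prod>i<k. x (i, \<sigma> i)))"
      by (rule iter_der_linear[OF F]) (use \<delta> cC CF prodF in auto)
    also have "\<dots> = (\<Sum>\<sigma>\<in>box k n. c \<sigma> w * (\<Sum>\<phi>\<in>?\<Phi>. \<Prod>i<k. h \<tau> (fib \<phi> i) (i, \<sigma> i)))"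
    proof (intro sum.cong refl arg_cong2[of _ _ _ _ "(*)"])
      fix \<sigma> assume "\<sigma> \<in> box k n"
      then show "iter_der (\<delta> \<tau>) k UNIV (\<Prod>i<k. x (i, \<sigma> i)) = (\<Sum>\<phi>\<in>?\<Phi>. \<Prod>i<k. h \<tau> (fib \<phi> i) (i, \<sigma> i))"
        unfolding h_def fib_def by (intro iter_der_prod[OF F] \<delta>) (auto intro: xF')
    qed
    also have "\<dots> = (\<Sum>\<sigma>\<in>box k n. \<Sum>\<phi>\<in>?\<Phi>. c \<sigma> w * (\<Prod>i<k. u \<tau> (fib \<phi> i) (i, \<sigma> i)) +
        (\<Sum>i<k. \<alpha> (fib \<phi> i) (i, \<sigma> i) \<tau> * (c \<sigma> w * rest \<tau> \<phi> \<sigma> i)))"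
    proof (subst sum_distrib_left, intro sum.cong refl)
      fix \<sigma> \<phi>
      have "(\<Prod>i<k. h \<tau> (fib \<phi> i) (i, \<sigma> i)) =
          (\<Prod>i<k. u \<tau> (fib \<phi> i) (i, \<sigma> i)) + (\<Sum>i<k. \<alpha> (fib \<phi> i) (i, \<sigma> i) \<tau> * rest \<tau> \<phi> \<sigma> i)"
        using prod_add_telescope[of "\<lambda>i. u \<tau> (fib \<phi> i) (i, \<sigma> i)" "\<lambda>i. \<alpha> (fib \<phi> i) (i, \<sigma> i) \<tau>" k]
        by (simp add: \<alpha>_def rest_def algebra_simps)
      then show "c \<sigma> w * (\<Prod>i<k. h \<tau> (fib \<phi> i) (i, \<sigma> i)) = c \<sigma> w * (\<Prod>i<k. u \<tau> (fib \<phi> i) (i, \<sigma> i)) +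
        (\<Sum>i<k. \<alpha> (fib \<phi> i) (i, \<sigma> i) \<tau> * (c \<sigma> w * rest \<tau> \<phi> \<sigma> i))"
        by (simp add: distrib_left sum_distrib_left mult.left_commute)
    qed
    also have "\<dots> = (\<Sum>\<sigma>\<in>box k n. \<Sum>\<phi>\<in>?\<Phi>. c \<sigma> w * (\<Prod>i<k. u \<tau> (fib \<phi> i) (i, \<sigma> i))) +
        (\<Sum>\<sigma>\<in>box k n. \<Sum>\<phi>\<in>?\<Phi>. \<Sum>i<k. \<alpha> (fib \<phi> i) (i, \<sigma> i) \<tau> * (c \<sigma> w * rest \<tau> \<phi> \<sigma> i))"
      by (simp add: sum.distrib)
    also have "(\<Sum>\<sigma>\<in>box k n. \<Sum>\<phi>\<in>?\<Phi>. c \<sigma> w * (\<Prod>i<k. u \<tau> (fib \<phi> i) (i, \<sigma> i))) =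
        (\<Sum>\<sigma>\<in>box k n. \<Sum>\<phi>\<in>?\<Phi>. if \<phi> = restrict id {..<k} then (if \<sigma> = \<tau> then c \<sigma> w else 0) else 0)"
      using leading[OF \<tau>] by (intro sum.cong refl) auto
    also have "\<dots> = (\<Sum>\<sigma>\<in>box k n. if \<sigma> = \<tau> then c \<sigma> w else 0)"
      by (intro sum.cong refl) (simp only: sum.delta[OF fin(2)] r\<Phi> if_True)
    also have "\<dots> = c \<tau> w" using fin \<tau> by simp
    \<comment> \<open>Regrouping by the fibre and the coordinate of the marked factor; pairs outside
      the index set have zero error.\<close>
    also have "(\<Sum>\<sigma>\<in>box k n. \<Sum>\<phi>\<in>?\<Phi>. \<Sum>i<k. \<alpha> (fib \<phi> i) (i, \<sigma> i) \<tau> * (c \<sigma> w * rest \<tau> \<phi> \<sigma> i)) =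
        (\<Sum>\<sigma>\<in>box k n. \<Sum>\<phi>\<in>?\<Phi>. \<Sum>i<k. \<Sum>(A, v)\<in>?Idx.
          if (A, v) = (fib \<phi> i, (i, \<sigma> i)) then \<alpha> A v \<tau> * (c \<sigma> w * rest \<tau> \<phi> \<sigma> i) else 0)"
    proof (intro sum.cong refl)
      fix \<sigma> \<phi> i assume "\<sigma> \<in> box k n" "i \<in> {..<k}"
      then have I: "(i, \<sigma> i) \<in> ?I" by (auto simp: box_def)
      have "(\<Sum>(A, v)\<in>?Idx. if (A, v) = (fib \<phi> i, (i, \<sigma> i)) then \<alpha> A v \<tau> * (c \<sigma> w * rest \<tau> \<phi> \<sigma> i) else 0) =
          (\<Sum>z\<in>?Idx. if z = (fib \<phi> i, (i, \<sigma> i)) then \<alpha> (fib \<phi> i) (i, \<sigma> i) \<tau> * (c \<sigma> w * rest \<tau> \<phi> \<sigma> i) else 0)"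
        by (intro sum.cong) (auto split: if_splits)
      also have "\<dots> = (if (fib \<phi> i, (i, \<sigma> i)) \<in> ?Idx then \<alpha> (fib \<phi> i) (i, \<sigma> i) \<tau> * (c \<sigma> w * rest \<tau> \<phi> \<sigma> i) else 0)"
        by (rule sum.delta[OF fin(3)])
      also have "\<dots> = \<alpha> (fib \<phi> i) (i, \<sigma> i) \<tau> * (c \<sigma> w * rest \<tau> \<phi> \<sigma> i)"
      proof (cases "(fib \<phi> i, (i, \<sigma> i)) \<in> ?Idx")
        case False
        then have "(i, \<sigma> i) \<in> Q \<or> fib \<phi> i = {}" using I fib_sub by blast
        then have "\<alpha> (fib \<phi> i) (i, \<sigma> i) \<tau> = 0" by (rule \<alpha>0[OF _ fib_sub])
        then show ?thesis by simp
      qed (simp only: if_True)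
      finally show "\<alpha> (fib \<phi> i) (i, \<sigma> i) \<tau> * (c \<sigma> w * rest \<tau> \<phi> \<sigma> i) =
        (\<Sum>(A, v)\<in>?Idx. if (A, v) = (fib \<phi> i, (i, \<sigma> i)) then \<alpha> A v \<tau> * (c \<sigma> w * rest \<tau> \<phi> \<sigma> i) else 0)" ..
    qed
    also have "\<dots> = (\<Sum>(A, v)\<in>?Idx. \<Sum>\<sigma>\<in>box k n. \<Sum>\<phi>\<in>?\<Phi>. \<Sum>i<k.
          if (A, v) = (fib \<phi> i, (i, \<sigma> i)) then \<alpha> A v \<tau> * (c \<sigma> w * rest \<tau> \<phi> \<sigma> i) else 0)"
      unfolding case_prod_unfold
      by (simp only: sum.swap[of _ ?Idx])
    also have "\<dots> = - (\<Sum>(A, v)\<in>?Idx. \<alpha> A v \<tau> * \<beta> A v \<tau> w)"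
      unfolding sum_negf[symmetric] \<beta>_def
      by (intro sum.cong refl) (auto simp: sum_distrib_left sum_negf if_distrib[of "\<lambda>y. _ * y"] cong: if_cong)
    finally show ?thesis by (simp add: eq_neg_iff_add_eq_0 add_eq_0_iff)
  qed
  moreover have "\<alpha> A v \<tau> = \<alpha> A v \<tau>'" if "\<forall>i\<in>A. \<tau> i = \<tau>' i" for A v \<tau> \<tau>'
  proof -
    have "h \<tau> A v = h \<tau>' A v"
      unfolding h_def by (rule iter_der_cong) (use that in \<open>auto simp: \<delta>_def\<close>)
    moreover have "u \<tau> A v = u \<tau>' A v" using that by (auto simp: u_def)
    ultimately show ?thesis by (simp add: \<alpha>_def)
  qed
  moreover have "\<beta> A v \<tau> w = \<beta> A v \<tau>' w" if eq: "\<forall>i\<in>{..<k} - A. \<tau> i = \<tau>' i" for A v \<tau> \<tau>' w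
  proof -
    have "rest \<tau> \<phi> \<sigma> i = rest \<tau>' \<phi> \<sigma> i" if A: "A = fib \<phi> i" for \<phi> \<sigma> i
    proof -
      \<comment> \<open>Fibres over different factors are disjoint, so the other factors use only
        derivations outside \<open>A\<close>.\<close>
      have *: "\<tau> a = \<tau>' a" if "a \<in> fib \<phi> i'" "i' \<noteq> i" for a i'
        using that eq unfolding A by (auto simp: fib_def)
      have "h \<tau> (fib \<phi> i') v = h \<tau>' (fib \<phi> i') v" if "i' \<noteq> i" for i' v
        unfolding h_def by (rule iter_der_cong) (use * that in \<open>auto simp: \<delta>_def\<close>)
      moreover have "u \<tau> (fib \<phi> i') v = u \<tau>' (fib \<phi> i') v" if "i' \<noteq> i" for i' v
        using *[of "fst v" i'] that by (cases "fib \<phi> i' = {fst v}") (simp_all add: u_def)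
      ultimately show ?thesis
        unfolding rest_def by (intro arg_cong2[of _ _ _ _ "(*)"] prod.cong refl) auto
    qed
    then show ?thesis unfolding \<beta>_def by (intro arg_cong[of _ _ uminus] sum.cong refl) auto
  qed
  ultimately show ?thesis by (intro exI[of _ \<alpha>] exI[of _ \<beta>] conjI) blast+
qed

text \<open>Finitely many equations in the ultrapower hold simultaneously for representatives at
  some index \<open>h\<close>, and \<open>\<rho>\<close> evaluates the representatives there. No
  homomorphism is claimed; only these equations are transported.\<close>

lemma upow_descent:
  fixes f :: "'s \<Rightarrow> 'k::field" and a b :: "'i \<Rightarrow> 's \<Rightarrow> ('p, 'k) upow"
  assumes T: "finite T" and eq: "\<And>\<tau>. \<tau> \<in> T \<Longrightarrow> emb (f \<tau>) = (\<Sum>i\<in>N. a i \<tau> * b i \<tau>)"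
  shows "\<exists>\<rho> :: ('p, 'k) upow \<Rightarrow> 'k. \<forall>\<tau>\<in>T. f \<tau> = (\<Sum>i\<in>N. \<rho> (a i \<tau>) * \<rho> (b i \<tau>))"
proof -
  have "abs_upow (\<lambda>h. \<Sum>i\<in>N. rep_upow (a i \<tau>) h * rep_upow (b i \<tau>) h) = (\<Sum>i\<in>N. a i \<tau> * b i \<tau>)" for \<tau>
  proof (induction N rule: infinite_finite_induct)
    case (insert j N)
    then show ?case
      by (simp add: abs_upow_add abs_upow_mult Quotient_abs_rep[OF Quotient_upow])
  qed (simp_all add: zero_upow.abs_eq)
  then have "eventually (\<lambda>h. f \<tau> = (\<Sum>i\<in>N. rep_upow (a i \<tau>) h * rep_upow (b i \<tau>) h)) pick_ultra" if "\<tau> \<in> T" for \<tau>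
    using eq[OF that] by (simp add: emb_def flip: abs_upow_eq_iff)
  then have "eventually (\<lambda>h. \<forall>\<tau>\<in>T. f \<tau> = (\<Sum>i\<in>N. rep_upow (a i \<tau>) h * rep_upow (b i \<tau>) h)) pick_ultra"
    using T by (intro eventually_ball_finite) auto
  moreover have "(pick_ultra :: ('p filter \<Rightarrow> 'p) filter) \<noteq> bot"
    using pick_ultra(2) by (auto simp: ultra_def)
  ultimately obtain h where "\<forall>\<tau>\<in>T. f \<tau> = (\<Sum>i\<in>N. rep_upow (a i \<tau>) h * rep_upow (b i \<tau>) h)"
    using eventually_happens' by blast
  then show ?thesis by (intro exI[of _ "\<lambda>y. rep_upow y h"])
qed

section \<open>Multilinear functions from tensors\<close>

lemma multilinear_on_mult:
  assumes g: "multilinear_on A n g" and h: "multilinear_on B n h" and AB: "A \<inter> B = {}"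
  shows "multilinear_on (A \<union> B) n (\<lambda>x. g x * h x)"
proof -
  have "g x * h x = g y * h y" if "\<forall>i\<in>A \<union> B. \<forall>j<n i. x i j = y i j" for x y
    using multilinear_on_cong[OF g, of x y] multilinear_on_cong[OF h, of x y] that by auto
  moreover have "g (x(i := (\<lambda>j. a * u j + b * w j))) * h (x(i := (\<lambda>j. a * u j + b * w j))) =
      a * (g (x(i := u)) * h (x(i := u))) + b * (g (x(i := w)) * h (x(i := w)))"
    if i: "i \<in> A \<union> B" for i x u w a b
  proof (cases "i \<in> A")
    case True
    have "h (x(i := y)) = h x" for y
      using AB True by (intro multilinear_on_cong[OF h]) auto
    moreover have "g (x(i := (\<lambda>j. a * u j + b * w j))) = a * g (x(i := u)) + b * g (x(i := w))"
      using g True unfolding multilinear_on_def by blast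
    ultimately show ?thesis by (simp only: algebra_simps)
  next
    case False
    have "g (x(i := y)) = g x" for y
      using False by (intro multilinear_on_cong[OF g]) auto
    moreover have "h (x(i := (\<lambda>j. a * u j + b * w j))) = a * h (x(i := u)) + b * h (x(i := w))"
      using h False i unfolding multilinear_on_def by blast
    ultimately show ?thesis by (simp only: algebra_simps)
  qed
  ultimately show ?thesis unfolding multilinear_on_def by blast
qed

lemma multilinear_on_sum:
  assumes "\<And>s. s \<in> T \<Longrightarrow> multilinear_on A n (g s)"
  shows "multilinear_on A n (\<lambda>x. \<Sum>s\<in>T. g s x)"
proof -
  have "(\<Sum>s\<in>T. g s x) = (\<Sum>s\<in>T. g s y)" if "\<forall>i\<in>A. \<forall>j<n i. x i j = y i j" for x y
    using that by (intro sum.cong refl multilinear_on_cong[OF assms]) auto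
  moreover have "(\<Sum>s\<in>T. g s (x(i := (\<lambda>j. a * u j + b * w j)))) =
      a * (\<Sum>s\<in>T. g s (x(i := u))) + b * (\<Sum>s\<in>T. g s (x(i := w)))" if "i \<in> A" for i x u w a b
  proof -
    have "g s (x(i := (\<lambda>j. a * u j + b * w j))) = a * g s (x(i := u)) + b * g s (x(i := w))" if "s \<in> T" for s
      using assms[OF that] \<open>i \<in> A\<close> unfolding multilinear_on_def by blast
    then show ?thesis by (simp only: sum_distrib_left flip: sum.distrib cong: sum.cong)
  qed
  ultimately show ?thesis unfolding multilinear_on_def by blast
qed

lemma multilinear_on_cmult: "multilinear_on A n g \<Longrightarrow> multilinear_on A n (\<lambda>x. c * g x)"
  unfolding multilinear_on_def by (simp add: algebra_simps)

lemma multilinear_on_coord: "j < n i \<Longrightarrow> multilinear_on {i} n (\<lambda>x. x i j)"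
  unfolding multilinear_on_def by simp

lemma multilinear_on_monomial:
  "finite A \<Longrightarrow> (\<And>i. i \<in> A \<Longrightarrow> \<tau> i < n i) \<Longrightarrow> 
    multilinear_on A n (\<lambda>x :: nat \<Rightarrow> nat \<Rightarrow> 'k::field. \<Prod>i\<in>A. x i (\<tau> i))"
proof (induction A rule: finite_induct)
  case empty
  then show ?case by (simp add: multilinear_on_def)
next
  case (insert b A)
  have "multilinear_on ({b} \<union> A) n (\<lambda>x :: nat \<Rightarrow> nat \<Rightarrow> 'k. x b (\<tau> b) * (\<Prod>i\<in>A. x i (\<tau> i)))"
    by (rule multilinear_on_mult[OF multilinear_on_coord]) (use insert in auto)
  then show ?case using insert by simp
qed

text \<open>The condition on \<open>c\<close> makes it a tensor with indices in \<open>A\<close>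
  only, although \<open>\<tau>\<close> ranges over functions on all of the naturals.\<close>

lemma multilinear_on_of_tensor:
  fixes c :: "(nat \<Rightarrow> nat) \<Rightarrow> 'k::field"
  assumes A: "finite A" and c: "\<And>\<tau> \<tau>'. \<forall>i\<in>A. \<tau> i = \<tau>' i \<Longrightarrow> c \<tau> = c \<tau>'"
  shows "\<exists>g. multilinear_on A n g \<and> (\<forall>\<tau>. (\<forall>i\<in>A. \<tau> i < n i) \<longrightarrow> g (\<lambda>i. unit_vec (\<tau> i)) = c \<tau>)"
proof -
  let ?box = "PiE A (\<lambda>i. {..<n i})"
  define g where "g x = (\<Sum>\<rho>\<in>?box. c \<rho> * (\<Prod>i\<in>A. x i (\<rho> i)))" for x :: "nat \<Rightarrow> nat \<Rightarrow> 'k"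
  have "multilinear_on A n g"
    unfolding g_def[abs_def] using A
    by (intro multilinear_on_sum multilinear_on_cmult multilinear_on_monomial) (auto dest: PiE_mem)
  moreover have "g (\<lambda>i. unit_vec (\<tau> i)) = c \<tau>" if \<tau>: "\<forall>i\<in>A. \<tau> i < n i" for \<tau>
  proof -
    have fin: "finite ?box" using A by (intro finite_PiE) auto
    define r where "r = restrict \<tau> A"
    have r: "r \<in> ?box" using \<tau> by (auto simp: r_def)
    have unit: "(\<Prod>i\<in>A. unit_vec (\<tau> i) (\<rho> i)) = (if \<rho> = r then 1 else (0::'k))"
      if \<rho>: "\<rho> \<in> ?box" for \<rho>
    proof (cases "\<forall>i\<in>A. \<rho> i = \<tau> i")
      case True
      then have "\<rho> = r" using \<rho> r by (intro PiE_ext[OF \<rho> r]) (auto simp: r_def)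
      then show ?thesis using True by (simp add: unit_vec_def)
    next
      case False
      then obtain i where "i \<in> A" "\<rho> i \<noteq> \<tau> i" by blast
      then have "(\<Prod>i\<in>A. unit_vec (\<tau> i) (\<rho> i)) = (0::'k)"
        using A by (intro prod_zero) (auto simp: unit_vec_def)
      moreover have "\<rho> \<noteq> r" using \<open>i \<in> A\<close> \<open>\<rho> i \<noteq> \<tau> i\<close> by (auto simp: r_def)
      ultimately show ?thesis by simp
    qed
    have "g (\<lambda>i. unit_vec (\<tau> i)) = (\<Sum>\<rho>\<in>?box. if \<rho> = r then c \<rho> else 0)"
      unfolding g_def by (intro sum.cong refl) (simp add: unit)
    also have "\<dots> = c (r)" by (simp only: sum.delta[OF fin] r if_True)
    also have "\<dots> = c \<tau>" by (rule c) (simp add: r_def)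
    finally show ?thesis .
  qed
  ultimately show ?thesis by blast
qed

lemma multilinear_on_eqI:
  assumes g: "multilinear_on A n g" and h: "multilinear_on A n h" and A: "finite A"
    and eq: "\<And>\<tau>. \<tau> \<in> PiE A (\<lambda>i. {..<n i}) \<Longrightarrow> g (\<lambda>i. unit_vec (\<tau> i)) = h (\<lambda>i. unit_vec (\<tau> i))"
  shows "g = h"
proof
  fix x
  show "g x = h x"
    unfolding multilinear_on_expand[OF g A, of x] multilinear_on_expand[OF h A, of x]
    by (intro sum.cong refl) (simp add: eq)
qed

lemma multilinear_on_fix_slot:
  assumes f: "multilinear_on (insert k A) n f" and k: "k \<notin> A"
  shows "multilinear_on A n (\<lambda>x. f (x(k := u)))"
proof -
  have "f (x(k := u)) = f (y(k := u))" if "\<forall>i\<in>A. \<forall>j<n i. x i j = y i j" for x y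
    using that by (intro multilinear_on_cong[OF f]) auto
  moreover have "f ((x(i := (\<lambda>j. a * v j + b * w j)))(k := u)) =
      a * f ((x(i := v))(k := u)) + b * f ((x(i := w))(k := u))" if i: "i \<in> A" for i x v w a b
  proof -
    have ik: "i \<noteq> k" using i k by auto
    have "f ((x(k := u))(i := (\<lambda>j. a * v j + b * w j))) = a * f ((x(k := u))(i := v)) + b * f ((x(k := u))(i := w))"
      using f i unfolding multilinear_on_def by blast
    then show ?thesis by (simp only: fun_upd_twist[OF ik])
  qed
  ultimately show ?thesis unfolding multilinear_on_def by blast
qed

section \<open>The two bounds\<close>

text \<open>Each pair of a nonempty set \<open>A\<close> and a coordinate outside \<open>Q\<close>
  contributes one product. The last argument always goes to the second factor, so \<open>A\<close>
  is a proper subset. \<open>Q\<close> is at least as large as \<open>J\<close>, which gives the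
  count.\<close>

lemma partition_from_free:
  fixes f :: "(nat \<Rightarrow> nat \<Rightarrow> 'k::field) \<Rightarrow> 'k"
  assumes d: "d \<ge> 1" and inf: "infinite (UNIV :: 'k set)" and f: "multilinear d n f"
    and J: "J \<subseteq> ar_index d n" and free: "free_on J (Z_F d n f)"
  shows "\<exists>gs. length gs \<le> (2 ^ (d - 1) - 1) * (card (ar_index d n) - card J) \<and>
    (\<forall>g\<in>set gs. pr_one d n g) \<and> f = (\<lambda>x. \<Sum>g\<leftarrow>gs. g x)"
proof -
  define k where "k = d - 1"
  have dk: "d = Suc k" using d by (simp add: k_def)
  let ?I = "Sigma {..<k} (\<lambda>i. {..<n i})" and ?box = "PiE {..<k} (\<lambda>i. {..<n i})"
  have I: "ar_index d n = ?I" by (simp add: ar_index_def k_def)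
  have fI: "finite ?I" by auto
  have fJ: "finite J" using J fI finite_subset unfolding I by blast
  obtain \<Phi> where \<Phi>: "\<forall>q :: (nat \<times> nat \<Rightarrow> 'k) \<Rightarrow> 'k. (\<forall>s\<in>Z_F d n f. q s = 0) \<longrightarrow> at_point \<Phi> q = 0"
    and \<Phi>J: "\<forall>q\<in>pf J. at_point \<Phi> q = 0 \<longrightarrow> (\<forall>y. q y = 0)"
    using generic_point_exists[OF inf free] by blast
  let ?E = "at_point \<Phi>"
  have E1: "?E (\<lambda>_. 1) = 1" by (simp add: at_point_const)
  define x where "x v = ?E (\<lambda>s. s v)" for v
  have "\<exists>F Q D. dersys (range (\<lambda>c. ?E (\<lambda>_. c))) F (\<lambda>v. ?E (\<lambda>s. s v)) Q D \<and> Q \<subseteq> J \<union> ?I \<and> card J \<le> card Q \<and>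
    (\<forall>v\<in>J \<union> ?I. ?E (\<lambda>s. s v) \<in> F)"
    by (rule dersys_all[OF inf at_point_add at_point_mult E1 _ fJ fI]) (use \<Phi>J in blast)
  then obtain F Q D where sys: "dersys (range emb) F x Q D" and Q: "Q \<subseteq> ?I" "card J \<le> card Q"
    and xF: "\<forall>v\<in>?I. x v \<in> F"
    using J unfolding I x_def[abs_def] at_point_const by (auto simp: Un_absorb1)
  define c where "c \<sigma> w = f (\<lambda>i. unit_vec ((\<sigma>(k := w)) i))" for \<sigma> w
  have f': "multilinear_on (insert k {..<k}) n f" using f by (simp add: dk lessThan_Suc)
  \<comment> \<open>The equations of the zero set, one for each unit vector in the last argument,
    hold at the generic point.\<close>
  have zero: "(\<Sum>\<sigma>\<in>?box. emb (c \<sigma> w) * (\<Prod>i<k. x (i, \<sigma> i))) = 0" for w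
  proof -
    have vanish: "(\<Sum>\<sigma>\<in>?box. c \<sigma> w * (\<Prod>i<k. s (i, \<sigma> i))) = 0" if s: "s \<in> Z_F d n f" for s
    proof -
      let ?Y = "\<lambda>i j. s (i, j)"
      have upd: "(\<lambda>i. unit_vec (\<sigma> i))(k := unit_vec w) = (\<lambda>i. unit_vec ((\<sigma>(k := w)) i) :: nat \<Rightarrow> 'k)" for \<sigma>
        by (auto simp: fun_eq_iff)
      have "(\<lambda>x. f (x(k := unit_vec w))) ?Y =
          (\<Sum>\<sigma>\<in>?box. f ((\<lambda>i. unit_vec (\<sigma> i))(k := unit_vec w)) * (\<Prod>i<k. ?Y i (\<sigma> i)))"
        by (rule multilinear_on_expand[OF multilinear_on_fix_slot[OF f']]) auto
      also have "\<dots> = (\<Sum>\<sigma>\<in>?box. c \<sigma> w * (\<Prod>i<k. s (i, \<sigma> i)))"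
        unfolding c_def upd ..
      finally have "(\<Sum>\<sigma>\<in>?box. c \<sigma> w * (\<Prod>i<k. s (i, \<sigma> i))) = f (?Y(k := unit_vec w))" ..
      also have "?Y(k := unit_vec w) = (\<lambda>i j. if i = d - 1 then unit_vec w j else s (i, j))"
        by (auto simp: fun_eq_iff k_def)
      also have "f \<dots> = 0" using s unfolding Z_F_def by blast
      finally show ?thesis .
    qed
    have "?E (\<lambda>s. \<Sum>\<sigma>\<in>?box. c \<sigma> w * (\<Prod>i<k. s (i, \<sigma> i))) = 0"
      by (rule \<Phi>[rule_format]) (rule vanish)
    moreover have "?E (\<lambda>s. \<Sum>\<sigma>\<in>B. c \<sigma> w * (\<Prod>i<k. s (i, \<sigma> i))) = (\<Sum>\<sigma>\<in>B. emb (c \<sigma> w) * (\<Prod>i<k. x (i, \<sigma> i)))" for B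
    proof -
      have prod: "?E (\<lambda>s. \<Prod>i<m. s (i, \<sigma> i)) = (\<Prod>i<m. x (i, \<sigma> i))" for m and \<sigma> :: "nat \<Rightarrow> nat"
        by (induction m) (simp_all add: at_point_const at_point_mult x_def)
      show ?thesis
        by (induction B rule: infinite_finite_induct)
           (simp_all add: at_point_const at_point_add at_point_mult prod)
    qed
    ultimately show ?thesis by simp
  qed
  let ?Idx = "(Pow {..<k} - {{}}) \<times> (?I - Q)"
  have fIdx: "finite ?Idx" using fI by auto
  have xF': "x v \<in> F" if "v \<in> ?I" for v using xF that by blast
  have "\<exists>\<alpha> \<beta>. (\<forall>\<tau>\<in>?box. \<forall>w\<in>UNIV. (emb (c \<tau> w) :: (nat \<times> nat \<Rightarrow> 'k, 'k) upow) = (\<Sum>(A, v)\<in>?Idx. \<alpha> A v \<tau> * \<beta> A v \<tau> w)) \<and>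
      (\<forall>A v \<tau> \<tau>'. (\<forall>i\<in>A. \<tau> i = \<tau>' i) \<longrightarrow> \<alpha> A v \<tau> = \<alpha> A v \<tau>') \<and>
      (\<forall>A v \<tau> \<tau>' w. (\<forall>i\<in>{..<k} - A. \<tau> i = \<tau>' i) \<longrightarrow> \<beta> A v \<tau> w = \<beta> A v \<tau>' w)"
    by (rule tensor_decomposition[OF sys xF']) (simp_all add: zero)
  then obtain \<alpha> \<beta> where dec: "\<forall>\<tau>\<in>?box. \<forall>w\<in>UNIV. (emb (c \<tau> w) :: (nat \<times> nat \<Rightarrow> 'k, 'k) upow) = (\<Sum>(A, v)\<in>?Idx. \<alpha> A v \<tau> * \<beta> A v \<tau> w)"
    and \<alpha>: "\<forall>A v \<tau> \<tau>'. (\<forall>i\<in>A. \<tau> i = \<tau>' i) \<longrightarrow> \<alpha> A v \<tau> = \<alpha> A v \<tau>'"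
    and \<beta>: "\<forall>A v \<tau> \<tau>' w. (\<forall>i\<in>{..<k} - A. \<tau> i = \<tau>' i) \<longrightarrow> \<beta> A v \<tau> w = \<beta> A v \<tau>' w"
    by (elim exE conjE) (rule that)
  let ?T = "?box \<times> {..<n k}"
  have fT: "finite ?T" by (auto intro!: finite_PiE)
  have embT: "emb (c (fst t) (snd t)) = (\<Sum>z\<in>?Idx. \<alpha> (fst z) (snd z) (fst t) * \<beta> (fst z) (snd z) (fst t) (snd t))"
    if "t \<in> ?T" for t :: "(nat \<Rightarrow> nat) \<times> nat"
  proof -
    have "fst t \<in> ?box" using that by (simp only: mem_Times_iff)
    from bspec[OF bspec[OF dec this] UNIV_I, of "snd t"] show ?thesis
      by (simp only: case_prod_unfold)
  qed
  have "\<exists>\<rho> :: (nat \<times> nat \<Rightarrow> 'k, 'k) upow \<Rightarrow> 'k. \<forall>t\<in>?T. c (fst t) (snd t) =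
      (\<Sum>z\<in>?Idx. \<rho> (\<alpha> (fst z) (snd z) (fst t)) * \<rho> (\<beta> (fst z) (snd z) (fst t) (snd t)))"
    by (rule upow_descent[OF fT embT])
  then obtain \<rho> :: "(nat \<times> nat \<Rightarrow> 'k, 'k) upow \<Rightarrow> 'k" where \<rho>: "\<forall>t\<in>?T. c (fst t) (snd t) =
      (\<Sum>z\<in>?Idx. \<rho> (\<alpha> (fst z) (snd z) (fst t)) * \<rho> (\<beta> (fst z) (snd z) (fst t) (snd t)))"
    by (elim exE) (rule that)
  have "\<forall>z\<in>?Idx. \<exists>g h. multilinear_on (fst z) n g \<and> multilinear_on ({..<d} - fst z) n h \<and>
      (\<forall>\<tau>. (\<forall>i\<in>fst z. \<tau> i < n i) \<longrightarrow> g (\<lambda>i. unit_vec (\<tau> i)) = \<rho> (\<alpha> (fst z) (snd z) \<tau>)) \<and>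
      (\<forall>\<tau>. (\<forall>i\<in>{..<d} - fst z. \<tau> i < n i) \<longrightarrow> h (\<lambda>i. unit_vec (\<tau> i)) = \<rho> (\<beta> (fst z) (snd z) \<tau> (\<tau> k)))"
    (is "\<forall>z\<in>_. ?P z")
  proof
    fix z assume z: "z \<in> ?Idx"
    have A: "fst z \<subseteq> {..<k}" using z by auto
    then have fA: "finite (fst z)" using finite_subset by blast
    have "\<exists>g. multilinear_on (fst z) n g \<and>
        (\<forall>\<tau>. (\<forall>i\<in>fst z. \<tau> i < n i) \<longrightarrow> g (\<lambda>i. unit_vec (\<tau> i)) = \<rho> (\<alpha> (fst z) (snd z) \<tau>))"
      by (rule multilinear_on_of_tensor[OF fA]) (intro arg_cong[of _ _ \<rho>] \<alpha>[rule_format], blast)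
    moreover have "\<exists>h. multilinear_on ({..<d} - fst z) n h \<and>
        (\<forall>\<tau>. (\<forall>i\<in>{..<d} - fst z. \<tau> i < n i) \<longrightarrow> h (\<lambda>i. unit_vec (\<tau> i)) = \<rho> (\<beta> (fst z) (snd z) \<tau> (\<tau> k)))"
    proof (rule multilinear_on_of_tensor)
      fix \<tau> \<tau>' :: "nat \<Rightarrow> nat" assume eq: "\<forall>i\<in>{..<d} - fst z. \<tau> i = \<tau>' i"
      have "k \<in> {..<d} - fst z" using A by (auto simp: dk)
      then have "\<tau> k = \<tau>' k" using eq by blast
      moreover have "\<forall>i\<in>{..<k} - fst z. \<tau> i = \<tau>' i" using eq by (auto simp: dk)
      then have "\<beta> (fst z) (snd z) \<tau> (\<tau> k) = \<beta> (fst z) (snd z) \<tau>' (\<tau> k)" by (intro \<beta>[rule_format]) blast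
      ultimately show "\<rho> (\<beta> (fst z) (snd z) \<tau> (\<tau> k)) = \<rho> (\<beta> (fst z) (snd z) \<tau>' (\<tau>' k))" by simp
    qed auto
    ultimately show "?P z" by blast
  qed
  then obtain g h where gh: "\<forall>z\<in>?Idx. multilinear_on (fst z) n (g z) \<and> multilinear_on ({..<d} - fst z) n (h z) \<and>
      (\<forall>\<tau>. (\<forall>i\<in>fst z. \<tau> i < n i) \<longrightarrow> g z (\<lambda>i. unit_vec (\<tau> i)) = \<rho> (\<alpha> (fst z) (snd z) \<tau>)) \<and>
      (\<forall>\<tau>. (\<forall>i\<in>{..<d} - fst z. \<tau> i < n i) \<longrightarrow> h z (\<lambda>i. unit_vec (\<tau> i)) = \<rho> (\<beta> (fst z) (snd z) \<tau> (\<tau> k)))"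
    unfolding bchoice_iff by (elim exE) (rule that)
  define p where "p z x = g z x * h z x" for z x
  have pm: "multilinear_on {..<d} n (p z)" if z: "z \<in> ?Idx" for z
  proof -
    have "multilinear_on (fst z \<union> ({..<d} - fst z)) n (p z)"
      unfolding p_def[abs_def] using bspec[OF gh z] by (intro multilinear_on_mult) auto
    moreover have "fst z \<union> ({..<d} - fst z) = {..<d}" using z by (auto simp: dk)
    ultimately show ?thesis by simp
  qed
  have f_sum: "f = (\<lambda>x. \<Sum>z\<in>?Idx. p z x)"
  proof (rule multilinear_on_eqI[OF f multilinear_on_sum[OF pm]])
    fix \<tau> assume \<tau>: "\<tau> \<in> PiE {..<d} (\<lambda>i. {..<n i})"
    have \<tau>i: "\<tau> i < n i" if "i < d" for i using \<tau> that by auto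
    let ?r = "restrict \<tau> {..<k}"
    have t: "(?r, \<tau> k) \<in> ?T" using \<tau>i by (auto simp: dk)
    have pz: "p z (\<lambda>i. unit_vec (\<tau> i)) = \<rho> (\<alpha> (fst z) (snd z) ?r) * \<rho> (\<beta> (fst z) (snd z) ?r (\<tau> k))"
      if z: "z \<in> ?Idx" for z
    proof -
      have A: "fst z \<subseteq> {..<k}" using z by auto
      from bspec[OF gh z]
      have gz: "\<forall>\<tau>. (\<forall>i\<in>fst z. \<tau> i < n i) \<longrightarrow> g z (\<lambda>i. unit_vec (\<tau> i)) = \<rho> (\<alpha> (fst z) (snd z) \<tau>)"
        and hz: "\<forall>\<tau>. (\<forall>i\<in>{..<d} - fst z. \<tau> i < n i) \<longrightarrow> h z (\<lambda>i. unit_vec (\<tau> i)) = \<rho> (\<beta> (fst z) (snd z) \<tau> (\<tau> k))"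
        by simp_all
      have "g z (\<lambda>i. unit_vec (\<tau> i)) = \<rho> (\<alpha> (fst z) (snd z) \<tau>)"
        by (rule gz[rule_format]) (use A in \<open>auto intro!: \<tau>i simp: dk\<close>)
      moreover have "h z (\<lambda>i. unit_vec (\<tau> i)) = \<rho> (\<beta> (fst z) (snd z) \<tau> (\<tau> k))"
        by (rule hz[rule_format]) (auto intro!: \<tau>i)
      moreover have "\<forall>i\<in>fst z. \<tau> i = ?r i" using A by auto
      then have "\<alpha> (fst z) (snd z) \<tau> = \<alpha> (fst z) (snd z) ?r" by (intro \<alpha>[rule_format]) blast
      moreover have "\<forall>i\<in>{..<k} - fst z. \<tau> i = ?r i" by auto
      then have "\<beta> (fst z) (snd z) \<tau> (\<tau> k) = \<beta> (fst z) (snd z) ?r (\<tau> k)" by (intro \<beta>[rule_format]) blast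
      ultimately show ?thesis by (simp add: p_def)
    qed
    have "f (\<lambda>i. unit_vec (\<tau> i)) = c ?r (\<tau> k)"
      unfolding c_def by (rule multilinear_on_cong[OF f]) (auto simp: dk)
    also have "\<dots> = (\<Sum>z\<in>?Idx. \<rho> (\<alpha> (fst z) (snd z) ?r) * \<rho> (\<beta> (fst z) (snd z) ?r (\<tau> k)))"
      using bspec[OF \<rho> t] by simp
    also have "\<dots> = (\<Sum>z\<in>?Idx. p z (\<lambda>i. unit_vec (\<tau> i)))"
      by (intro sum.cong refl) (simp only: pz)
    finally show "f (\<lambda>i. unit_vec (\<tau> i)) = (\<Sum>z\<in>?Idx. p z (\<lambda>i. unit_vec (\<tau> i)))" .
  qed auto
  obtain zs where zs: "set zs = ?Idx" "distinct zs" using finite_distinct_list[OF fIdx] by blast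
  \<comment> \<open>Zero products are dropped because \<open>pr_one\<close> excludes the zero
    function; this only shortens the list.\<close>
  define gs where "gs = map p (filter (\<lambda>z. p z \<noteq> (\<lambda>x. 0)) zs)"
  have "length gs \<le> length zs" by (simp add: gs_def)
  also have "length zs = card ?Idx" using zs distinct_card by metis
  also have "\<dots> = (2 ^ k - 1) * card (?I - Q)"
    by (simp add: card_cartesian_product card_Diff_subset card_Pow)
  also have "card (?I - Q) = card ?I - card Q"
    using Q(1) fI finite_subset by (intro card_Diff_subset) auto
  also have "(2 ^ k - 1) * (card ?I - card Q) \<le> (2 ^ k - 1) * (card ?I - card J)"
    using Q(2) by (intro mult_le_mono2) auto
  finally have "length gs \<le> (2 ^ (d - 1) - 1) * (card (ar_index d n) - card J)"
    by (simp add: I k_def)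
  moreover have "\<forall>q\<in>set gs. pr_one d n q"
  proof
    fix q assume "q \<in> set gs"
    then obtain z where z: "z \<in> ?Idx" "q = p z" "p z \<noteq> (\<lambda>x. 0)" by (auto simp: gs_def zs(1))
    have "fst z \<noteq> {}" "fst z \<subset> {..<d}" using z(1) by (auto simp: dk)
    moreover have "q = (\<lambda>x. g z x * h z x)" using z(2) by (simp add: p_def[abs_def])
    ultimately show "pr_one d n q"
      unfolding pr_one_def using z bspec[OF gh z(1)] by (intro conjI exI[of _ "fst z"] exI[of _ "g z"] exI[of _ "h z"]) simp_all
  qed
  moreover have "f = (\<lambda>x. \<Sum>q\<leftarrow>gs. q x)"
  proof
    fix x
    have "(\<Sum>q\<leftarrow>gs. q x) = (\<Sum>z\<leftarrow>zs. p z x)"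
      unfolding gs_def by (induction zs) auto
    also have "\<dots> = (\<Sum>z\<in>?Idx. p z x)" using zs by (simp add: sum_list_distinct_conv_sum_set)
    finally show "f x = (\<Sum>q\<leftarrow>gs. q x)" using f_sum by metis
  qed
  ultimately show ?thesis by blast
qed

lemma free_on_empty: "S \<noteq> {} \<Longrightarrow> free_on {} S"
  unfolding free_on_def using pf_cong[of _ "{}"] by (metis all_not_in_conv)

text \<open>For \<open>d \<ge> 2\<close> the zero point fills an argument other than the last, which
  makes \<open>f\<close> vanish.\<close>

lemma zero_in_Z_F:
  assumes "d \<ge> 2" "multilinear d n f"
  shows "(\<lambda>_. 0) \<in> Z_F d n f"
proof -
  have "f (\<lambda>i j. if i = d - 1 then w j else 0) = 0" for w
  proof -
    have "f ((\<lambda>i j. if i = d - 1 then w j else 0)(0 := (\<lambda>j. 0))) = 0"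
      using assms by (intro multilinear_on_zero_slot[OF assms(2)]) auto
    also have "(\<lambda>i j. if i = d - 1 then w j else 0)(0 := (\<lambda>j. 0)) = (\<lambda>i j. if i = d - 1 then w j else 0)"
      using assms(1) by (auto simp: fun_eq_iff)
    finally show ?thesis .
  qed
  then show ?thesis by (simp add: Z_F_def aff_def)
qed

theorem theorem4p4:
  fixes f :: "(nat \<Rightarrow> nat \<Rightarrow> 'k::field) \<Rightarrow> 'k" and d :: nat and n :: "nat \<Rightarrow> nat"
  assumes "d \<ge> 2"
    and "infinite (UNIV :: 'k set)"
    and "multilinear d n f"
  shows "analytic_rank d n f \<le> partition_rank d n f \<and>
         partition_rank d n f \<le> (2 ^ (d - 1) - 1) * analytic_rank d n f"
proof -
  let ?I = "ar_index d n" and ?S = "Z_F d n f"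
  let ?chain = "\<lambda>m C. (\<forall>i\<le>m. zariski_irreducible ?I (C i) \<and> C i \<subseteq> zariski_closure_K ?I ?S) \<and>
    (\<forall>i<m. C i \<subset> C (Suc i))"
  let ?M = "{m. \<exists>C. ?chain m C}"
  let ?rep = "\<lambda>r. \<exists>gs. length gs = r \<and> (\<forall>g\<in>set gs. pr_one d n g) \<and> f = (\<lambda>x. \<Sum>g\<leftarrow>gs. g x)"
  have d: "d \<ge> 1" using assms(1) by simp
  have free: "\<exists>J\<subseteq>?I. card J = m \<and> free_on J ?S" if m: "m \<in> ?M" for m
  proof -
    obtain C where "?chain m C" using m by (elim CollectE exE)
    then show ?thesis by (intro chain_imp_free[OF assms(2) finite_ar_index, where m = m and C = C]) simp_all
  qed
  \<comment> \<open>The dimension is a \<open>Sup\<close> of natural numbers; it becomes a maximum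
    once the set of chain lengths is known to be finite and nonempty.\<close>
  have bounded: "m \<le> card ?I" if "m \<in> ?M" for m
    using free[OF that] card_mono[OF finite_ar_index] by metis
  have "finite ?M" by (rule finite_subset[of _ "{..card ?I}"]) (use bounded in auto)
  have upper: "\<exists>r \<le> (2 ^ (d - 1) - 1) * (card ?I - card J). ?rep r" if "J \<subseteq> ?I" "free_on J ?S" for J
    using partition_from_free[OF d assms(2,3) that] by blast
  have "?S \<noteq> {}" using zero_in_Z_F[OF assms(1,3)] by blast
  \<comment> \<open>The empty set of coordinates already yields some decomposition, so the
    \<open>LEAST\<close> in the partition rank is attained.\<close>
  then have "\<exists>r. ?rep r" using upper[of "{}"] free_on_empty by blast
  then have "?rep (partition_rank d n f)" unfolding partition_rank_def by (rule LeastI_ex)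
  then obtain gs where gs: "length gs = partition_rank d n f" "\<forall>g\<in>set gs. pr_one d n g"
    "f = (\<lambda>x. \<Sum>g\<leftarrow>gs. g x)" by (elim exE conjE) (rule that)
  obtain C m where m: "card ?I - partition_rank d n f \<le> m" "?chain m C"
    using partition_chain[OF d assms(2) gs(2,3)] unfolding gs(1) by (elim exE conjE) (rule that, simp_all)
  then have mM: "m \<in> ?M" by (intro CollectI exI[of _ C]) 
  have dim: "zariski_dim ?I (zariski_closure_K ?I ?S) = Max ?M"
    unfolding zariski_dim_def using \<open>finite ?M\<close> mM by (intro cSup_eq_Max) auto
  have "m \<le> Max ?M" using \<open>finite ?M\<close> mM by (rule Max_ge)
  then have "analytic_rank d n f \<le> partition_rank d n f"
    using m(1) unfolding analytic_rank_def zariski_codim_def dim by linarith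
  moreover have "partition_rank d n f \<le> (2 ^ (d - 1) - 1) * analytic_rank d n f"
  proof -
    \<comment> \<open>A longest chain gives as many free coordinates as the dimension, which turns
      \<open>card ?I - card J\<close> into the codimension.\<close>
    have "Max ?M \<in> ?M" using \<open>finite ?M\<close> mM by (intro Max_in) auto
    from free[OF this] obtain J where J: "J \<subseteq> ?I" "card J = Max ?M" "free_on J ?S"
      by (elim exE conjE) (rule that)
    obtain r where r: "r \<le> (2 ^ (d - 1) - 1) * (card ?I - card J)" "?rep r"
      by (rule exE[OF upper[OF J(1,3)]], erule conjE, rule that)
    have "partition_rank d n f \<le> r" unfolding partition_rank_def by (rule Least_le) (rule r(2))
    then show ?thesis
      using r(1) unfolding analytic_rank_def zariski_codim_def dim J(2) by linarith
  qed
  ultimately show ?thesis ..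
qed

end
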